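(* Let $\Omega\subset\mathbb{C}$ be a hyperbolic domain that satisfies Condition 1. Then the closure in $\mathbb{C}_\infty$ of every connected component of $\partial\Omega$ is a Jordan curve. Conversely, if $\Omega\subset\mathbb{C}$ is a hyperbolic domain such that the closure in $\mathbb{C}_\infty$ of every connected component of $\partial\Omega$ is a Jordan curve and $\partial\Omega$ is locally connected, then $\Omega$ satisfies Condition 1.
   Context: $\mathbb{C}_\infty=\mathbb{C}\cup\{\infty\}$ is the Riemann sphere; $\partial\Omega$ and $\overline\Omega$ are taken in $\mathbb{C}$; a Jordan curve is a homeomorphic image of the unit circle; $\mathbb{D}$ is the open unit disc. A domain $\Omega\subset\mathbb{C}$ is hyperbolic if its Kobayashi pseudodistance is a distance (equivalently $\mathbb{C}\setminus\Omega$ has at least two points). Condition 1: for every point $p\in\partial\Omega$ there exists a topological embedding $\tau_p:\overline{\mathbb{D}}\to\overline\Omega$ such that $\tau_p(\mathbb{D})\subset\Omega$ and such that every sequence $(z_n)_{n\ge1}$ in $\Omega$ converging to $p$ lies eventually in $\tau_p(\mathbb{D})$. *)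

theory Defs
  imports "HOL-Complex_Analysis.Complex_Analysis"
begin

text \<open>
  For points of the unit disc the norm of \<^term>\<open>Moebius_function 0 b a\<close> is
  \<open>\<bar>a - b\<bar> / \<bar>1 - cnj b * a\<bar>\<close>.  The normalisation of the Poincare distance
  (curvature -4 here) only scales the Kobayashi pseudodistance by a positive constant.
\<close>

definition poincare_dist :: "complex \<Rightarrow> complex \<Rightarrow> real" where
  "poincare_dist a b = artanh (norm (Moebius_function 0 b a))"

text \<open>
  The disc \<open>f i\<close> carries the chain from \<open>f i (a i)\<close> to \<open>f i (b i)\<close>, where the disc
  \<open>f (Suc i)\<close> takes over.
\<close>

definition disc_chain_lengths :: "complex set \<Rightarrow> complex \<Rightarrow> complex \<Rightarrow> real set" where
  "disc_chain_lengths \<Omega> z w =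
     {\<Sum>i<n. poincare_dist (a i) (b i) | (n::nat) (f :: nat \<Rightarrow> complex \<Rightarrow> complex) a b.
        0 < n \<and>
        (\<forall>i<n. f i holomorphic_on ball 0 1 \<and> f i ` ball 0 1 \<subseteq> \<Omega> \<and>
               a i \<in> ball 0 1 \<and> b i \<in> ball 0 1) \<and>
        f 0 (a 0) = z \<and>
        (\<forall>i. Suc i < n \<longrightarrow> f i (b i) = f (Suc i) (a (Suc i))) \<and>
        f (n - 1) (b (n - 1)) = w}"

text \<open>
  For \<open>z\<close> and \<open>w\<close> in a domain the set of lengths is nonempty and bounded below by 0, so that
  the infimum is the genuine one; the value is only used for such points.
\<close>

definition kobayashi_pseudodist :: "complex set \<Rightarrow> complex \<Rightarrow> complex \<Rightarrow> real" where
  "kobayashi_pseudodist \<Omega> z w = Inf (disc_chain_lengths \<Omega> z w)"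

text \<open>
  On a domain the Kobayashi pseudodistance is always nonnegative, symmetric, zero on the diagonal
  and subadditive, so it is a distance if and only if it separates points.
\<close>

definition hyperbolic_domain :: "complex set \<Rightarrow> bool" where
  "hyperbolic_domain \<Omega> \<longleftrightarrow>
     open \<Omega> \<and> connected \<Omega> \<and> \<Omega> \<noteq> {} \<and>
     (\<forall>z\<in>\<Omega>. \<forall>w\<in>\<Omega>. kobayashi_pseudodist \<Omega> z w = 0 \<longrightarrow> z = w)"

definition condition1 :: "complex set \<Rightarrow> bool" where
  "condition1 \<Omega> \<longleftrightarrow>
     (\<forall>p \<in> frontier \<Omega>. \<exists>\<tau> :: complex \<Rightarrow> complex.
        embedding_map (top_of_set (cball 0 1)) (top_of_set (closure \<Omega>)) \<tau> \<and>
        \<tau> ` ball 0 1 \<subseteq> \<Omega> \<and>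
        (\<forall>z :: nat \<Rightarrow> complex. (\<forall>n. z n \<in> \<Omega>) \<and> z \<longlonglongrightarrow> p \<longrightarrow>
           (\<forall>\<^sub>F n in sequentially. z n \<in> \<tau> ` ball 0 1)))"

text \<open>
  The Riemann sphere as the one-point compactification of the plane: \<^term>\<open>None\<close> is the point at
  infinity and \<^term>\<open>Some z\<close> is the finite point \<open>z\<close>.
\<close>

definition riemann_sphere :: "complex option topology" where
  "riemann_sphere = Alexandroff_compactification euclidean"

definition sphere_closure :: "complex set \<Rightarrow> complex option set" where
  "sphere_closure S = riemann_sphere closure_of (Some ` S)"

definition jordan_curve :: "complex option set \<Rightarrow> bool" where
  "jordan_curve J \<longleftrightarrow>
     subtopology riemann_sphere J homeomorphic_space top_of_set (sphere (0::complex) 1)"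

end

theory Submission
  imports Defs
begin

text \<open>
  Suppose Condition 1 holds.  Near a boundary point \<open>p\<close> the boundary coincides with the image of the
  unit circle under \<open>\<tau>\<^sub>p\<close>, so a boundary component is a connected, closed 1-manifold.  Such a set is
  either a simple closed curve, or a properly embedded line that \<open>\<infinity>\<close> closes up to a Jordan curve.

  Conversely, local connectedness makes a component \<open>C\<close> of the boundary relatively open, and \<open>\<Omega>\<close> lies on
  one side of the Jordan curve that is the closure of \<open>C\<close>.  A Moebius map with its pole on the other
  side makes that side the inside \<open>U\<close> of a plane Jordan curve.  By Caratheodory's theorem the
  Riemann map of \<open>U\<close> is a homeomorphism up to the boundary, so small half discs at boundary points of
  the unit disc provide the embeddings \<open>\<tau>\<^sub>p\<close>; they avoid the other boundary components, hence
  their interiors stay inside \<open>\<Omega>\<close>.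

  Caratheodory's theorem follows from maximum principles for products of rotated functions: a bounded
  function that is small on arcs near the circle joining two distinct boundary points vanishes
  (Koebe), which makes the Riemann map uniformly continuous; and a function that vanishes on one side
  of a boundary arc has a zero on the other side, which makes the extension injective.
\<close>

section \<open>Maximum principles for rotated functions\<close>

text \<open>Near the unit circle nothing is known about the function except that the open set where
  it must be controlled keeps clear of the circle in directions near one point \<open>c\<close>.
  Finitely many rotations spread this gap over all directions, and their number \<open>m\<close>
  must not depend on how small the function is elsewhere: only then can a bound of the form
  \<open>norm (F 0) ^ m \<le> \<epsilon> * C\<close> be pushed to 0. Infinity is the second
  obstacle. A boundary component may be unbounded, so both directions use an inversion with a pole
  in \<Omega>, which lies off every component and turns closures on the sphere into compact plane
  sets. This puts \<Omega> outside the image curve, and the converse needs a second inversion about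
  a point of the inside before Caratheodory's theorem applies. Local connectedness enters because
  other components could otherwise accumulate at \<open>p\<close>.\<close>

lemma norm_cis_diff: "norm (cis a - cis b) = 2 * \<bar>sin ((a - b) / 2)\<bar>"
proof -
  have "cis a - cis b = cis b * (exp (\<i> * of_real (a - b)) - 1)"
    by (simp add: cis_conv_exp algebra_simps flip: exp_add)
  then show ?thesis
    by (metis dist_exp_i_1 mult_1 norm_cis norm_mult)
qed

lemma norm_cis_diff_le: "norm (cis a - cis b) \<le> \<bar>a - b\<bar>"
  using abs_sin_x_le_abs_x[of "(a - b) / 2"] by (simp add: norm_cis_diff)

text \<open>The number \<open>m\<close> is chosen before \<open>u\<close> and \<open>c\<close>: it
  becomes an exponent in the estimates and has to stay fixed while the directions vary.\<close>

lemma roots_of_unity_dense: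
  assumes "0 < \<eta>"
  obtains m :: nat where "m > 0"
    "\<And>u c. \<lbrakk>norm u = 1; norm c = 1\<rbrakk> \<Longrightarrow> \<exists>j<m. norm (cis (2 * pi * j / m) * u - c) < \<eta>"
proof -
  obtain m :: nat where m: "m > 2 * pi / \<eta>"
    using reals_Archimedean2 by blast
  have "m > 0"
    using m assms by (metis divide_pos_pos gr0I less_asym' mult_pos_pos of_nat_0 pi_gt_zero zero_less_numeral)
  have "\<exists>j<m. norm (cis (2 * pi * j / m) * u - c) < \<eta>" if u: "norm u = 1" and c: "norm c = 1"
    for u c
  proof -
    have "norm (c / u) = 1" using u c by (simp add: norm_divide)
    then obtain t where t: "0 \<le> t" "t < 2 * pi" "c / u = cis t"
      using Arg2pi[of "c / u"] by (auto simp: cis_conv_exp is_Arg_def)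
    \<comment> \<open>\<open>t\<close> is the angle from \<open>u\<close> to \<open>c\<close>, and
      \<open>j\<close> indexes the last root of unity not beyond it, so the error is below one gap
      \<open>2 * pi / m\<close>.\<close>
    define j where "j = nat \<lfloor>t * m / (2 * pi)\<rfloor>"
    have "0 \<le> t * m / (2*pi)" "t * m / (2*pi) < m"
      using t \<open>m > 0\<close> by (auto simp: field_simps)
    then have j: "real j \<le> t * m / (2*pi)" "t * m / (2*pi) < real j + 1" "j < m"
      unfolding j_def by (linarith, linarith, simp add: nat_less_iff floor_less_iff)
    have "2 * pi * j / m \<le> t" "t < (2 * pi * j + 2 * pi) / m"
      using j \<open>m > 0\<close> by (auto simp: field_simps)
    then have "2 * pi * j / m \<le> t" "t - 2 * pi * j / m < 2 * pi / m"
      by (auto simp: add_divide_distrib)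
    moreover have "2 * pi / m < \<eta>"
      using m \<open>m > 0\<close> assms by (simp add: field_simps)
    ultimately have "\<bar>2 * pi * j / m - t\<bar> < \<eta>"
      by linarith
    moreover have "norm (cis (2 * pi * j / m) * u - c) = norm (cis (2 * pi * j / m) - cis t)"
    proof -
      have "cis (2 * pi * j / m) * u - c = (cis (2 * pi * j / m) - cis t) * u"
        using t u by (auto simp: field_simps simp flip: t(3))
      then show ?thesis using u by (simp add: norm_mult)
    qed
    ultimately show ?thesis
      using norm_cis_diff_le j(3) by (metis order_le_less_trans)
  qed
  then show ?thesis using \<open>m > 0\<close> that by blast
qed

text \<open>
  The maximum principle is applied to the product of the rotated functions on the intersection of the
  rotated sets, which stays away from the unit circle.
\<close>

lemma rotated_maximum_modulus:
  fixes F :: "complex \<Rightarrow> complex"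
  assumes m: "m > 0" "\<And>u. norm u = 1 \<Longrightarrow> \<exists>j<m. norm (cis (2 * pi * real j / real m) * u - c) < \<eta>"
    and F: "continuous_on (ball 0 1) F" "F holomorphic_on V"
    and V: "open V" "V \<subseteq> ball 0 1" "0 \<in> V"
    and M: "\<And>z. z \<in> ball 0 1 \<Longrightarrow> norm (F z) \<le> M"
    and \<epsilon>: "\<And>z. z \<in> ball 0 1 \<inter> frontier V \<Longrightarrow> norm (F z) \<le> \<epsilon>"
    and \<rho>: "\<rho> < 1" "\<And>z. \<lbrakk>z \<in> V; \<rho> \<le> norm z\<rbrakk> \<Longrightarrow> \<eta> \<le> norm (z / norm z - c)"
  shows "norm (F 0) ^ m \<le> \<epsilon> * M ^ (m - 1)"
proof -
  define r where "r j = cis (2 * pi * real j / real m)" for j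
  have [simp]: "norm (r j) = 1" for j by (simp add: r_def)
  have [simp]: "r j \<noteq> 0" for j by (metis \<open>norm (r j) = 1\<close> norm_zero zero_neq_one)
  define N where "N z = (\<Prod>j<m. F (r j * z))" for z
  define W where "W = (\<Inter>j<m. (\<lambda>z. r j * z) -` V)"
  \<comment> \<open>Otherwise the gap in directions near \<open>c\<close> would concern all of
    \<open>V\<close>, although \<open>V\<close> contains a disc about 0.\<close>
  have "\<rho> > 0"
  proof (rule ccontr)
    assume "\<not> \<rho> > 0"
    obtain d where d: "d > 0" "ball 0 d \<subseteq> V"
      using V open_contains_ball by blast
    obtain j where j: "j < m" "norm (r j * 1 - c) < \<eta>"
      using m(2)[of 1] unfolding r_def by auto
    have "of_real (d/2) * r j \<in> V" using d by (intro subsetD[OF d(2)]) (auto simp: norm_mult)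
    moreover have "of_real (d/2) * r j / norm (of_real (d/2) * r j) = r j"
      using d by (simp add: norm_mult)
    ultimately show False using \<rho>(2)[of "of_real (d/2) * r j"] j \<open>\<not> \<rho> > 0\<close>
      by (smt (verit, best) mult.right_neutral norm_ge_zero)
  qed
  have W0: "0 \<in> W" using V by (auto simp: W_def)
  \<comment> \<open>Some rotation turns the direction of \<open>z\<close> to within \<eta> of
    \<open>c\<close>, and the rotated point would still lie in \<open>V\<close>.\<close>
  have W\<rho>: "W \<subseteq> ball 0 \<rho>"
  proof
    fix z assume z: "z \<in> W"
    show "z \<in> ball 0 \<rho>"
    proof (rule ccontr)
      assume "z \<notin> ball 0 \<rho>"
      then have n: "\<rho> \<le> norm z" "z \<noteq> 0" using \<open>\<rho> > 0\<close> by auto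
      then have "norm (z / norm z) = 1" by (simp add: norm_divide)
      then obtain j where j: "j < m" "norm (r j * (z / norm z) - c) < \<eta>"
        using m(2) unfolding r_def by blast
      moreover have "r j * z \<in> V" using z j by (auto simp: W_def)
      ultimately show False using \<rho>(2)[of "r j * z"] n by (simp add: norm_mult)
    qed
  qed
  have oW: "open W" unfolding W_def
    by (intro open_INT ballI open_vimage V continuous_intros) auto
  have clW: "closure W \<subseteq> cball 0 \<rho>"
    using W\<rho> by (meson ball_subset_cball closed_cball closure_minimal order_trans)
  have rclW: "r j * z \<in> ball 0 1" if "z \<in> closure W" for j z
    using that clW \<rho>(1) by (auto simp: norm_mult)
  \<comment> \<open>At a frontier point of \<open>W\<close> one rotated copy of \<open>V\<close> is
    left, so one factor is at most \<epsilon> and the other \<open>m - 1\<close> are at most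
    \<open>M\<close>.\<close>
  have frN: "norm (N z) \<le> \<epsilon> * M ^ (m - 1)" if z: "z \<in> frontier W" for z
  proof -
    have zc: "z \<in> closure W" using z by (simp add: frontier_def)
    have "z \<notin> W" using z oW by (simp add: frontier_def interior_open)
    then obtain i where i: "i < m" "r i * z \<notin> V" by (auto simp: W_def)
    have "(\<lambda>z. r i * z) ` closure W \<subseteq> closure V"
      by (rule image_closure_subset)
        (use i(1) closure_subset[of V] in \<open>auto intro!: continuous_intros simp: W_def\<close>)
    then have "r i * z \<in> frontier V"
      using zc i(2) V(1) by (auto simp: frontier_def interior_open)
    then have Fi: "norm (F (r i * z)) \<le> \<epsilon>" using \<epsilon> rclW[OF zc] by blast
    have "norm (N z) = norm (F (r i * z)) * (\<Prod>j\<in>{..<m}-{i}. norm (F (r j * z)))"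
      unfolding N_def by (simp add: prod_norm[symmetric] prod.remove[of _ i] i norm_mult)
    also have "(\<Prod>j\<in>{..<m}-{i}. norm (F (r j * z))) \<le> (\<Prod>j\<in>{..<m}-{i}. M)"
      by (intro prod_mono) (use M rclW[OF zc] in auto)
    also have "(\<Prod>j\<in>{..<m}-{i}. M) = M ^ (m - 1)" using i by simp
    finally show ?thesis using Fi M[of 0]
      by (smt (verit) centre_in_ball mult_left_mono mult_right_mono norm_ge_zero zero_le_power zero_less_one)
  qed
  have "norm (N 0) \<le> \<epsilon> * M ^ (m - 1)"
  proof (rule maximum_modulus_frontier[of N W])
    have "(\<lambda>z. F (r j * z)) holomorphic_on W" if "j < m" for j
    proof -
      have "(F \<circ> (\<lambda>z. r j * z)) holomorphic_on W"
        by (rule holomorphic_on_compose_gen[OF _ F(2)])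
          (use that in \<open>auto simp: W_def intro!: holomorphic_intros\<close>)
      then show ?thesis by (simp add: o_def)
    qed
    then show "N holomorphic_on interior W"
      unfolding N_def interior_open[OF oW] by (intro holomorphic_on_prod) auto
    show "continuous_on (closure W) N" unfolding N_def
      by (intro continuous_on_prod continuous_on_compose2[OF F(1)] continuous_on_mult continuous_on_const continuous_on_id) (use rclW in auto)
    show "bounded W" using W\<rho> bounded_ball bounded_subset by blast
  qed (use frN W0 in auto)
  then show ?thesis by (simp add: N_def norm_power)
qed

section \<open>Plane topology of crosscuts\<close>

text \<open>
  Janiszewski's theorem applies to the Jordan curve and to the union of a circle about \<open>q\<close> with the part
  of the curve far from \<open>q\<close>: they meet in an arc, and neither separates points of the inside near \<open>q\<close>.
\<close>

lemma Jordan_inside_locally_connected: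
  fixes g :: "real \<Rightarrow> complex"
  assumes g: "simple_path g" "pathfinish g = pathstart g" and q: "q \<in> path_image g" and "\<epsilon> > 0"
  obtains \<delta> where "\<delta> > 0"
    "\<And>x y. \<lbrakk>x \<in> inside (path_image g); y \<in> inside (path_image g); dist q x < \<delta>; dist q y < \<delta>\<rbrakk>
      \<Longrightarrow> \<exists>k. path k \<and> path_image k \<subseteq> inside (path_image g) \<inter> ball q \<epsilon> \<and> pathstart k = x \<and> pathfinish k = y"
proof -
  define J where "J = path_image g"
  obtain t where t: "t \<in> {0..1}" "g t = q" using q by (auto simp: path_image_def)
  \<comment> \<open>With \<open>q\<close> as base point, cutting off two short end pieces leaves an
    arc \<open>A\<close> that avoids \<open>q\<close>.\<close>
  define h where "h = shiftpath t g"
  have h: "simple_path h" "path_image h = J" "h 0 = q" "h 1 = q"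
    using g t pathstart_shiftpath[of t g] pathfinish_shiftpath[of t g]
    by (auto simp: h_def J_def simple_path_shiftpath path_image_shiftpath pathstart_def pathfinish_def)
  have conth: "continuous_on {0..1} h"
    using h(1) by (simp add: simple_path_def path_def)
  obtain s1 where s1: "s1 > 0" "\<And>x. \<lbrakk>x \<in> {0..1}; dist x 0 < s1\<rbrakk> \<Longrightarrow> dist (h x) q < \<epsilon>"
    using conth h(3) \<open>\<epsilon> > 0\<close> unfolding continuous_on_iff
      by (metis atLeastAtMost_iff order_refl zero_le_one)
  obtain s2 where s2: "s2 > 0" "\<And>x. \<lbrakk>x \<in> {0..1}; dist x 1 < s2\<rbrakk> \<Longrightarrow> dist (h x) q < \<epsilon>"
    using conth h(4) \<open>\<epsilon> > 0\<close> unfolding continuous_on_iff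
      by (metis atLeastAtMost_iff order_refl zero_le_one)
  define s where "s = min (1/3) (min s1 s2) / 2"
  have s: "0 < s" "s < 1 - s" "s < s1" "s < s2" using s1(1) s2(1) by (auto simp: s_def)
  define A where "A = h ` {s..1-s}"
  have A: "compact A" "connected A" "A \<subseteq> J"
    using s continuous_on_subset[OF conth, of "{s..1-s}"] h(2)
    by (auto simp: A_def path_image_def intro!: compact_continuous_image connected_continuous_image)
  have "q \<notin> A"
  proof
    assume "q \<in> A"
    then obtain x where "x \<in> {s..1-s}" "h x = h 0" using h(3) by (auto simp: A_def)
    then show False using h(1) s unfolding simple_path_def loop_free_def by force
  qed
  then obtain \<delta>0 where \<delta>0: "\<delta>0 > 0" "ball q \<delta>0 \<subseteq> - A"
    using A(1) by (metis ComplI compact_imp_closed open_Compl open_contains_ball)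
  define \<delta> where "\<delta> = min \<delta>0 \<epsilon>"
  \<comment> \<open>The two end pieces stay in the open ball of radius \<epsilon>, so the curve
    reaches its boundary circle only along \<open>A\<close>.\<close>
  have JA: "J \<inter> sphere q \<epsilon> \<subseteq> A"
  proof
    fix z assume z: "z \<in> J \<inter> sphere q \<epsilon>"
    then obtain x where x: "x \<in> {0..1}" "z = h x" using h(2) by (auto simp: path_image_def)
    have "\<not> dist (h x) q < \<epsilon>" using z x by (auto simp: dist_commute)
    then have "\<not> dist x 0 < s1" "\<not> dist x 1 < s2" using s1(2)[OF x(1)] s2(2)[OF x(1)] by blast+
    then have "s \<le> x" "x \<le> 1 - s" using s x(1) by (auto simp: dist_real_def)
    then show "z \<in> A" using x by (auto simp: A_def)
  qed
  have cJ: "compact J" using h by (metis compact_simple_path_image)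
  show ?thesis
  proof (rule that)
    show "\<delta> > 0" using \<delta>0 \<open>\<epsilon> > 0\<close> by (simp add: \<delta>_def)
    fix x y assume xy: "x \<in> inside (path_image g)" "y \<in> inside (path_image g)" "dist q x < \<delta>"
      "dist q y < \<delta>"
    define X where "X = connected_component_set (- (J \<union> (A \<union> sphere q \<epsilon>))) x"
    have "connected_component (- (J \<union> (A \<union> sphere q \<epsilon>))) x y"
    proof (rule Janiszewski)
      show "connected (J \<inter> (A \<union> sphere q \<epsilon>))"
        using JA A by (metis Int_Un_distrib Int_absorb1 sup.absorb1)
      show "closed (A \<union> sphere q \<epsilon>)" using A by (auto intro: compact_imp_closed)
      show "connected_component (- J) x y"
        unfolding connected_component_def
      proof (intro exI conjI)
        show "inside J \<subseteq> - J" using inside_no_overlap by blast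
      qed (use Jordan_inside_outside[OF g] xy(1,2) J_def in auto)
      show "connected_component (- (A \<union> sphere q \<epsilon>)) x y"
        unfolding connected_component_def
        using xy \<delta>0 by (intro exI[of _ "ball q \<delta>"]) (auto simp: \<delta>_def)
    qed (rule cJ)
    then have xyX: "x \<in> X" "y \<in> X"
      by (auto simp: X_def dest: connected_component_in)
    have "open (- (J \<union> (A \<union> sphere q \<epsilon>)))"
      using cJ A by (intro open_Compl closed_Un compact_imp_closed) auto
    then have X: "open X" "connected X" "X \<subseteq> - (J \<union> (A \<union> sphere q \<epsilon>))"
      unfolding X_def using connected_component_subset open_connected_component connected_connected_component
      by blast+
    \<comment> \<open>\<open>X\<close> misses the circle and the curve, so it can leave neither the
      ball nor the inside.\<close>
    have "X \<inter> ball q \<epsilon> \<noteq> {}" using xy xyX by (auto simp: \<delta>_def)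
    then have "X \<subseteq> ball q \<epsilon>"
      using connected_Int_frontier[OF X(2), of "ball q \<epsilon>"] X(3) \<open>\<epsilon> > 0\<close> by
        (auto simp: frontier_ball)
    moreover have "X \<subseteq> inside J"
      using connected_Int_frontier[OF X(2), of "inside J"] X(3) xy xyX Jordan_inside_outside[OF g]
      by (auto simp: J_def)
    moreover obtain k where "path k" "path_image k \<subseteq> X" "pathstart k = x" "pathfinish k = y"
      using X xyX by (metis connected_open_path_connected path_connected_def)
    ultimately show "\<exists>k. path k \<and> path_image k \<subseteq> inside (path_image g) \<inter> ball q \<epsilon> \<and> pathstart k = x
      \<and> pathfinish k = y"
      unfolding J_def by blast
  qed
qed

text \<open>Applied to the disc minus a closed set \<open>X\<close>, it places on \<open>X\<close>
  those frontier points of the component that lie in the open disc.\<close>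

lemma frontier_connected_component_notin_open:
  fixes S :: "'a::real_normed_vector set"
  assumes "open S" "z \<in> frontier (connected_component_set S x)"
  shows "z \<notin> S"
  using assms frontier_of_connected_component_subset[of S x] by
    (auto simp: frontier_def interior_open)

text \<open>
  If the component of \<open>0\<close> came close to both arcs of the circle, Janiszewski's theorem for
  \<open>X \<union> I1\<close> and \<open>X \<union> I2\<close> would join \<open>0\<close> to \<open>2\<close> across the unit circle.
\<close>

lemma crosscut_shields_arc:
  fixes X :: "complex set"
  assumes X: "compact X" "connected X" "X \<subseteq> cball 0 1" "X \<inter> sphere 0 1 = {a, b}" "0 \<notin> X"
    and I: "closed I1" "closed I2" "I1 \<union> I2 = sphere 0 1" "I1 \<inter> I2 = {a, b}"
    and \<eta>: "cball c1 \<eta> \<inter> I2 = {}" "cball c2 \<eta> \<inter> I1 = {}"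
  defines "V \<equiv> connected_component_set (ball 0 1 - X) 0"
  shows "\<exists>c \<in> {c1, c2}. \<exists>\<rho><1. \<forall>z\<in>V. \<rho> \<le> norm z \<longrightarrow> \<eta> \<le> norm (z / norm z - c)"
proof (rule ccontr)
  assume "\<not> ?thesis"
  then have neg: "\<And>\<rho> c. \<lbrakk>c \<in> {c1, c2}; \<rho> < 1\<rbrakk> \<Longrightarrow> \<exists>z\<in>V. \<rho> \<le> norm z \<and> norm (z / norm z - c) < \<eta>"
    by (meson not_le)
  have V: "connected V" "V \<subseteq> ball 0 1 - X" "0 \<in> V"
    unfolding V_def using X(5) by (auto simp: connected_component_subset)
  \<comment> \<open>From 0 run inside \<open>V\<close> to a point \<open>z\<close> close to the
    circle in a direction near \<open>c\<close>, then radially across the circle to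
    \<open>2 * u\<close>, and on to 2 outside the disc. This avoids both \<open>X\<close> and the
    arc \<open>I\<close>.\<close>
  have reach: "connected_component (- (X \<union> I)) 0 2"
    if c: "c \<in> {c1, c2}" and cI: "cball c \<eta> \<inter> I = {}" and I: "I \<subseteq> sphere 0 1" "{a, b} \<subseteq> I" for c I
  proof -
    let ?K = "sphere 0 1 \<inter> cball c \<eta>"
    have "?K \<inter> X = {}" using X(4) cI I by blast
    then have "\<exists>d>0. \<forall>x\<in>?K. \<forall>y\<in>X. d \<le> dist x y"
      by (intro separate_compact_closed) (auto simp: X compact_Int_closed compact_imp_closed)
    then obtain d where d: "d > 0" "\<And>x y. x \<in> ?K \<Longrightarrow> y \<in> X \<Longrightarrow> d \<le> dist x y" by blast
    \<comment> \<open>Beyond \<open>1 - d/2\<close> the radial segment from \<open>z\<close> to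
      \<open>u\<close> stays within \<open>d\<close> of \<open>u\<close> and so misses
      \<open>X\<close>; the bound 1/2 makes \<open>z\<close> nonzero.\<close>
    define \<rho> where "\<rho> = max (1/2) (1 - d/2)"
    have "\<rho> < 1" using d by (auto simp: \<rho>_def)
    then obtain z where z: "z \<in> V" "\<rho> \<le> norm z" "norm (z / norm z - c) < \<eta>"
      using neg c by blast
    have nz: "norm z < 1" "norm z > 0" using z V(2) by (auto simp: \<rho>_def)
    define u where "u = z / norm z"
    have u: "u \<in> ?K" using z nz by (auto simp: u_def norm_divide dist_norm norm_minus_commute)
    have nu: "norm u = 1" using u by simp
    define L where "L = (\<lambda>t::real. of_real t * u) ` {norm z..2}"
    have "connected L" unfolding L_def by (intro connected_continuous_image continuous_intros) simp
    have zL: "z \<in> L" unfolding L_def u_def using nz by (intro image_eqI[of _ _ "norm z"]) auto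
    have uL: "2 * u \<in> L" unfolding L_def using nz by (intro image_eqI[of _ _ 2]) auto
    have LX: "L \<inter> X = {}"
    proof (rule ccontr)
      assume "L \<inter> X \<noteq> {}"
      then obtain t where t: "norm z \<le> t" "t \<le> 2" "of_real t * u \<in> X" by (auto simp: L_def)
      have "t > 0" using t nz by linarith
      have "t \<le> 1" using t X(3) nu \<open>t > 0\<close> by (force simp: norm_mult)
      have "dist u (of_real t * u) = norm (of_real (1 - t) * u)"
        by (simp add: dist_norm algebra_simps)
      also have "\<dots> = 1 - t" using nu \<open>t \<le> 1\<close> by (simp only: norm_mult norm_of_real) simp
      finally have "1 - t \<ge> d" using d(2)[OF u t(3)] by simp
      then show False using t(1) z(2) d(1) by (auto simp: \<rho>_def)
    qed
    have LI: "L \<inter> I = {}"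
    proof (rule ccontr)
      assume "L \<inter> I \<noteq> {}"
      then obtain t where t: "norm z \<le> t" "t \<le> 2" "of_real t * u \<in> I" by (auto simp: L_def)
      then have "norm (of_real t * u) = 1" using I(1) by auto
      then have "t = 1" using nu nz t(1) by (simp add: norm_mult)
      then show False using t u cI by auto
    qed
    let ?E = "- cball 0 1 :: complex set"
    have E: "connected ?E" by (intro connected_complement_bounded_convex) auto
    have "connected (V \<union> L \<union> ?E)"
      using z zL uL nu
      by (intro connected_Un V \<open>connected L\<close> E) (auto simp: norm_mult intro!: exI[of _ "2 * u"])
    moreover have "V \<union> L \<union> ?E \<subseteq> - (X \<union> I)"
    proof -
      have "ball 0 1 \<inter> sphere (0::complex) 1 = {}" "- cball 0 1 \<inter> sphere (0::complex) 1 = {}"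
        by auto
      then show ?thesis using V(2) LX LI X(3) I(1) by blast
    qed
    moreover have "0 \<in> V \<union> L \<union> ?E" "2 \<in> V \<union> L \<union> ?E" using V(3) by auto
    ultimately show ?thesis unfolding connected_component_def by blast
  qed
  \<comment> \<open>The two closed sets share exactly the connected set \<open>X\<close>, since the
    arcs meet only in \<open>a\<close> and \<open>b\<close>.\<close>
  have "connected_component (- ((X \<union> I2) \<union> (X \<union> I1))) 0 2"
  proof (rule Janiszewski)
    have "bounded I2" using I(3) by (metis Un_upper2 bounded_sphere bounded_subset)
    then show "compact (X \<union> I2)" using X(1) I(2) by (intro compact_Un)
      (auto simp: compact_eq_bounded_closed)
    show "closed (X \<union> I1)" by (intro closed_Un compact_imp_closed X I)
    have "(X \<union> I2) \<inter> (X \<union> I1) = X" using I(4) X(4) by blast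
    then show "connected ((X \<union> I2) \<inter> (X \<union> I1))" using X by simp
    show "connected_component (- (X \<union> I2)) 0 2"
      by (rule reach[of c1]) (use \<eta> I in auto)
    show "connected_component (- (X \<union> I1)) 0 2"
      by (rule reach[of c2]) (use \<eta> I in auto)
  qed
  then obtain T where T: "connected T" "T \<subseteq> - ((X \<union> I2) \<union> (X \<union> I1))" "0 \<in> T" "2 \<in> T"
    unfolding connected_component_def by blast
  \<comment> \<open>0 and 2 lie on different sides of the circle, all of which has been removed with
    the two arcs.\<close>
  have "T \<inter> frontier (ball 0 1) \<noteq> {}"
    by (rule connected_Int_frontier[OF T(1)]) (use T(3,4) in force)+
  then show False using T(2) I(3) by auto
qed

text \<open>One \<eta> serves both arcs, since it is fixed before it is known whether a crosscut
  shields \<open>c1\<close> or \<open>c2\<close>.\<close>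

lemma circle_arcs:
  fixes a b :: complex
  assumes "norm a = 1" "norm b = 1" "a \<noteq> b"
  obtains I1 I2 c1 c2 \<eta> where "closed I1" "closed I2" "I1 \<union> I2 = sphere 0 1" "I1 \<inter> I2 = {a, b}"
    "norm c1 = 1" "norm c2 = 1" "0 < \<eta>" "cball c1 \<eta> \<inter> I2 = {}" "cball c2 \<eta> \<inter> I1 = {}"
proof -
  have c: "simple_path (circlepath 0 1)" "pathfinish (circlepath 0 1) = pathstart (circlepath 0 1)"
    "path_image (circlepath 0 1) = sphere (0::complex) 1"
    by (auto simp: simple_path_circlepath)
  obtain u d where ud: "arc u" "arc d" "pathstart u = a" "pathfinish u = b" "pathstart d = b"
    "pathfinish d = a"
    "path_image u \<inter> path_image d = {a, b}" "path_image u \<union> path_image d = sphere 0 1"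
    using exists_double_arc[OF c(1,2), of a b] c(3) assms by (metis dist_0_norm mem_sphere)
  have cl: "closed (path_image u)" "closed (path_image d)" using ud by (auto simp: closed_arc_image)
  have pt: "\<exists>c \<in> path_image g. c \<noteq> pathstart g \<and> c \<noteq> pathfinish g" if "arc g"
    for g :: "real \<Rightarrow> complex"
    using that unfolding arc_def path_image_def pathstart_def pathfinish_def
    by (intro bexI[of _ "g (1/2)"]) (auto dest: inj_onD)
  obtain c1 where c1: "c1 \<in> path_image u" "c1 \<noteq> a" "c1 \<noteq> b" using pt[OF ud(1)] ud by auto
  obtain c2 where c2: "c2 \<in> path_image d" "c2 \<noteq> a" "c2 \<noteq> b" using pt[OF ud(2)] ud by auto
  have "c1 \<notin> path_image d" "c2 \<notin> path_image u" using c1 c2 ud(7) by blast+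
  then obtain e1 e2 where e: "e1 > 0" "cball c1 e1 \<subseteq> - path_image d" "e2 > 0"
    "cball c2 e2 \<subseteq> - path_image u"
    using cl by (metis ComplI open_Compl open_contains_cball)
  have "cball c1 (min e1 e2) \<inter> path_image d = {}" "cball c2 (min e1 e2) \<inter> path_image u = {}"
    using e by auto
  moreover have "norm c1 = 1" "norm c2 = 1" using c1 c2 ud(8) by auto
  ultimately show ?thesis using that[of "path_image u" "path_image d" c1 c2 "min e1 e2"] cl ud e
    by simp
qed

section \<open>Caratheodory's theorem for Jordan domains\<close>

text \<open>Each curve, prolonged to \<open>a\<close> and \<open>b\<close>, is a crosscut that keeps
  the component of 0 away from the circle in directions near \<open>c1\<close> or near
  \<open>c2\<close>. The number \<open>m\<close> of rotations comes from \<open>a\<close> and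
  \<open>b\<close> alone, so \<open>norm (F 0) ^ m \<le> \<epsilon> * C\<close> holds with one
  \<open>C\<close> for all small \<epsilon>.\<close>

lemma Koebe_arcs:
  fixes F :: "complex \<Rightarrow> complex"
  assumes F: "F holomorphic_on ball 0 1" and M: "\<And>z. z \<in> ball 0 1 \<Longrightarrow> norm (F z) \<le> M"
    and ab: "norm a = 1" "norm b = 1" "a \<noteq> b"
    and k: "\<And>\<epsilon>. 0 < \<epsilon> \<Longrightarrow> \<exists>k. path k \<and> path_image k \<subseteq> ball 0 1 \<and> dist (pathstart k) a < \<epsilon> \<and>
      dist (pathfinish k) b < \<epsilon> \<and> (\<forall>z \<in> path_image k. norm (F z) \<le> \<epsilon> \<and> 1 - \<epsilon> \<le> norm z)"
  shows "F 0 = 0"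
proof -
  have "M \<ge> 0" using M[of 0] by (smt (verit) centre_in_ball norm_ge_zero)
  obtain I1 I2 c1 c2 \<eta> where I: "closed I1" "closed I2" "I1 \<union> I2 = sphere 0 1" "I1 \<inter> I2 = {a, b}"
    "norm c1 = 1" "norm c2 = 1" "0 < \<eta>" "cball c1 \<eta> \<inter> I2 = {}" "cball c2 \<eta> \<inter> I1 = {}"
    using circle_arcs[OF ab] by metis
  obtain m :: nat where m: "m > 0"
    "\<And>u c. \<lbrakk>norm u = 1; norm c = 1\<rbrakk> \<Longrightarrow> \<exists>j<m. norm (cis (2 * pi * j / m) * u - c) < \<eta>"
    using roots_of_unity_dense[OF \<open>0 < \<eta>\<close>] by blast
  txt \<open>The extra factors make \<open>G\<close> small on the segments that prolong the arcs to \<open>a\<close> and \<open>b\<close>.\<close>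
  define G where "G z = F z * ((z - a) * (z - b))" for z
  have holG: "G holomorphic_on ball 0 1"
    unfolding G_def by (intro holomorphic_intros F)
  have fac: "norm (z - a) \<le> 2" "norm (z - b) \<le> 2" if "norm z \<le> 1" for z
    using norm_triangle_ineq4[of z a] norm_triangle_ineq4[of z b] ab that by auto
  have G0: "norm (G 0) = norm (F 0)" by (simp add: G_def norm_mult ab)
  have GM: "norm (G z) \<le> M * (2 * 2)" if "z \<in> ball 0 1" for z
    unfolding G_def norm_mult using M[OF that] fac[of z] that \<open>M \<ge> 0\<close>
    by (intro mult_mono) auto
  \<comment> \<open>\<open>G\<close> is bounded by \<open>4 * M\<close> in the disc and by
    \<open>\<epsilon> * (4 + 4 * M)\<close> on the crosscut; the product has one factor of the
    second kind and \<open>m - 1\<close> of the first.\<close>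
  define C where "C = (4 + 4 * M) * (M * (2 * 2)) ^ (m - 1)"
  have bound: "norm (F 0) ^ m \<le> \<epsilon> * C" if \<epsilon>: "0 < \<epsilon>" "\<epsilon> < 1" for \<epsilon>
  proof -
    obtain k where k: "path k" "path_image k \<subseteq> ball 0 1" "dist (pathstart k) a < \<epsilon>"
      "dist (pathfinish k) b < \<epsilon>" "\<And>z. z \<in> path_image k \<Longrightarrow> norm (F z) \<le> \<epsilon> \<and> 1 - \<epsilon> \<le> norm z"
      using k[OF \<epsilon>(1)] by blast
    let ?s = "pathstart k" and ?f = "pathfinish k"
    \<comment> \<open>The curve ends only near \<open>a\<close> and \<open>b\<close>; the two
      segments complete it to a crosscut.\<close>
    define X where "X = closed_segment ?s a \<union> path_image k \<union> closed_segment ?f b"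
    have seg: "closed_segment p q \<subseteq> insert q (ball 0 1)" if "p \<in> ball 0 1" "norm q = 1"
      for p q :: complex
      using in_interior_closure_convex_segment[of "ball 0 1" p q] that
      by (auto simp: closed_segment_eq_open interior_open)
    have sf: "?s \<in> ball 0 1" "?f \<in> ball 0 1" using k(2) by auto
    have segd: "dist z q < \<epsilon>" if "z \<in> closed_segment p q" "dist p q < \<epsilon>" for z p q :: complex
      using that segment_bound(2)[of z p q] by (simp add: dist_norm norm_minus_commute)
    have X: "compact X" "connected X"
      unfolding X_def using k(1)
      by (auto intro!: compact_Un connected_Un simp: compact_path_image connected_path_image)
    have Xsub: "X \<subseteq> {a, b} \<union> ball 0 1" "a \<in> X" "b \<in> X"
      unfolding X_def using seg[OF sf(1) ab(1)] seg[OF sf(2) ab(2)] k(2) by auto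
    then have X3: "X \<subseteq> cball 0 1" "X \<inter> sphere 0 1 = {a, b}"
      using ab by auto
    have Xn: "1 - \<epsilon> \<le> norm z" if "z \<in> X" for z
    proof -
      have "1 - \<epsilon> \<le> norm z" if "dist z q < \<epsilon>" "norm q = 1" for q
        using that norm_triangle_ineq2[of q z] by (simp add: dist_norm norm_minus_commute)
      then show ?thesis using that k(3-5) segd ab unfolding X_def by blast
    qed
    have X0: "0 \<notin> X" using Xn[of 0] \<epsilon> by auto
    define V where "V = connected_component_set (ball 0 1 - X) 0"
    have opV: "open (ball 0 1 - X)" using X by (simp add: compact_imp_closed open_Diff)
    have V: "open V" "V \<subseteq> ball 0 1" "0 \<in> V"
      unfolding V_def using X0 opV connected_component_subset[of "ball 0 1 - X" 0]
      by (auto simp: open_connected_component)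
    \<comment> \<open>On the curve \<open>F\<close> is small, on the segments one of
      \<open>z - a\<close> and \<open>z - b\<close> is.\<close>
    have GX: "norm (G z) \<le> \<epsilon> * (4 + 4 * M)" if z: "z \<in> ball 0 1 \<inter> frontier V" for z
    proof -
      have "z \<in> X" using z frontier_connected_component_notin_open[OF opV] unfolding V_def by blast
      have "norm z \<le> 1" using z by simp
      note fz = fac[OF this] and Mz = M[of z]
      consider "z \<in> path_image k" | "norm (z - a) < \<epsilon>" | "norm (z - b) < \<epsilon>"
        using \<open>z \<in> X\<close> k(3,4) segd unfolding X_def dist_norm by blast
      then show ?thesis
      proof cases
        case 1
        have "norm (G z) \<le> \<epsilon> * (2 * 2)"
          unfolding G_def norm_mult using k(5)[OF 1] fz \<epsilon> by (intro mult_mono) auto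
        also have "\<dots> \<le> \<epsilon> * (4 + 4 * M)" using \<epsilon> \<open>M \<ge> 0\<close> by simp
        finally show ?thesis .
      next
        case 2
        have "norm (G z) \<le> M * (\<epsilon> * 2)"
          unfolding G_def norm_mult using 2 fz \<epsilon> Mz z \<open>M \<ge> 0\<close> by (intro mult_mono) auto
        also have "\<dots> \<le> \<epsilon> * (4 + 4 * M)" using \<epsilon> \<open>M \<ge> 0\<close> by (simp add: algebra_simps)
        finally show ?thesis .
      next
        case 3
        have "norm (G z) \<le> M * (2 * \<epsilon>)"
          unfolding G_def norm_mult using 3 fz \<epsilon> Mz z \<open>M \<ge> 0\<close> by (intro mult_mono) auto
        also have "\<dots> \<le> \<epsilon> * (4 + 4 * M)" using \<epsilon> \<open>M \<ge> 0\<close> by (simp add: algebra_simps)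
        finally show ?thesis .
      qed
    qed
    \<comment> \<open>Which of \<open>c1\<close> and \<open>c2\<close> is shielded may change with
      \<epsilon>; \<open>m\<close> and \<eta> do not.\<close>
    obtain c \<rho> where c: "c \<in> {c1, c2}" "\<rho> < 1" "\<And>z. \<lbrakk>z \<in> V; \<rho> \<le> norm z\<rbrakk> \<Longrightarrow> \<eta> \<le> norm (z / norm z - c)"
      using crosscut_shields_arc[OF X X3 X0 I(1-4) I(8,9)] unfolding V_def by blast
    have "norm (G 0) ^ m \<le> (\<epsilon> * (4 + 4 * M)) * (M * (2 * 2)) ^ (m - 1)"
    proof (rule rotated_maximum_modulus[where V = V and c = c and \<rho> = \<rho> and \<eta> = \<eta>])
      show "\<exists>j<m. norm (cis (2 * pi * real j / real m) * u - c) < \<eta>" if "norm u = 1" for u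
        using m(2)[OF that, of c] c(1) I(5,6) by blast
      show "G holomorphic_on V" using holG V(2) holomorphic_on_subset by blast
    qed (use m V GX GM c holG holomorphic_on_imp_continuous_on in auto)
    then show ?thesis using G0 by (simp add: C_def mult_ac)
  qed
  have "norm (F 0) ^ m \<le> 0"
  proof (rule ccontr)
    assume "\<not> ?thesis"
    then have pos: "norm (F 0) ^ m > 0" by simp
    have "C \<ge> 0" using \<open>M \<ge> 0\<close> by (simp add: C_def)
    \<comment> \<open>Small enough that \<open>\<epsilon> * C\<close> stays below
      \<open>norm (F 0) ^ m\<close>; \<open>C + 1\<close> keeps the denominator positive.\<close>
    define \<epsilon> where "\<epsilon> = min (1/2) (norm (F 0) ^ m / (2 * (C + 1)))"
    have "0 < \<epsilon>" "\<epsilon> < 1" using pos \<open>C \<ge> 0\<close> by (auto simp: \<epsilon>_def)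
    have "\<epsilon> * C \<le> (norm (F 0) ^ m / (2 * (C + 1))) * C"
      using \<open>C \<ge> 0\<close> by (intro mult_right_mono) (auto simp: \<epsilon>_def)
    also have "\<dots> < norm (F 0) ^ m" using pos \<open>C \<ge> 0\<close> by (simp add: field_simps add_nonneg_pos)
    finally show False using bound[OF \<open>0 < \<epsilon>\<close> \<open>\<epsilon> < 1\<close>] by simp
  qed
  then show ?thesis using m(1) by (auto simp: power_le_zero_eq)
qed

text \<open>
  The maximum principle is used on a disc centred in \<open>U\<close> whose boundary circle passes through an exterior
  point, near which \<open>h\<close> vanishes on an arc.
\<close>

lemma zero_near_boundary_imp_zero:
  fixes h :: "complex \<Rightarrow> complex"
  assumes U: "open U" "x0 \<in> closure U" "x0 \<in> closure (- closure U)" and "0 < r"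
    and h: "continuous_on (ball x0 r) h" "h holomorphic_on (U \<inter> ball x0 r)"
    and h0: "\<And>z. z \<in> ball x0 r - U \<Longrightarrow> h z = 0"
  obtains u where "u \<in> U" "u \<in> ball x0 r" "h u = 0"
proof -
  \<comment> \<open>With \<open>u\<close> and \<open>e\<close> both within \<open>r/4\<close> of
    \<open>x0\<close>, the disc about \<open>u\<close> through \<open>e\<close> remains in
    \<open>ball x0 r\<close>.\<close>
  obtain u where u: "u \<in> U" "dist u x0 < r/4"
    using U(2) \<open>0 < r\<close> by (metis closure_approachable divide_pos_pos zero_less_numeral)
  obtain e where e: "e \<in> - closure U" "dist e x0 < r/4"
    using U(3) \<open>0 < r\<close> by (metis closure_approachable divide_pos_pos zero_less_numeral)
  define R where "R = norm (e - u)"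
  have "e \<noteq> u" using u e closure_subset by blast
  then have "R > 0" by (simp add: R_def)
  have "R < r/2"
    using u e dist_triangle2[of e u x0] by (simp add: R_def dist_norm)
  have inb: "cball u R \<subseteq> ball x0 r"
  proof
    fix z assume "z \<in> cball u R"
    then show "z \<in> ball x0 r"
      using u \<open>R < r/2\<close> \<open>0 < r\<close> dist_triangle[of x0 z u] by (auto simp: dist_commute)
  qed
  obtain d where d: "d > 0" "ball e d \<subseteq> - closure U"
    using e(1) open_contains_ball[of "- closure U"] by auto
  have "u \<notin> ball e d" using d u closure_subset by blast
  then have "d \<le> R" by (simp add: R_def dist_norm)
  \<comment> \<open>A point of \<open>V\<close> within \<open>2 * \<eta>\<close> of \<open>c\<close>
    would be mapped by \<open>T\<close> to within \<open>d\<close> of \<open>e\<close>, that is, off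
    the closure of \<open>U\<close>.\<close>
  define \<eta> where "\<eta> = d / (2 * R)"
  have \<eta>: "0 < \<eta>" "\<eta> \<le> 1/2" using d \<open>R > 0\<close> \<open>d \<le> R\<close> by (auto simp: \<eta>_def field_simps)
  define c where "c = (e - u) / R"
  have nc: "norm c = 1" using \<open>R > 0\<close> by (simp add: c_def norm_divide R_def)
  obtain m :: nat where m: "m > 0"
    "\<And>u c. \<lbrakk>norm u = 1; norm c = 1\<rbrakk> \<Longrightarrow> \<exists>j<m. norm (cis (2 * pi * j / m) * u - c) < \<eta>"
    using roots_of_unity_dense[OF \<eta>(1)] by blast
  define T where "T z = u + of_real R * z" for z
  have T: "T z \<in> ball x0 r" if "z \<in> cball 0 1" for z
    using that \<open>R > 0\<close> by (intro subsetD[OF inb]) (auto simp: T_def dist_norm norm_mult)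
  have contT: "continuous_on A T" for A unfolding T_def by (intro continuous_intros)
  define V where "V = ball 0 1 \<inter> T -` U"
  define F where "F z = h (T z)" for z
  have contF: "continuous_on (cball 0 1) F"
    unfolding F_def by (rule continuous_on_compose2[OF h(1) contT]) (use T in auto)
  obtain M where M: "\<And>z. z \<in> cball 0 1 \<Longrightarrow> norm (F z) \<le> M"
    using compact_imp_bounded[OF compact_continuous_image[OF contF compact_cball]]
    unfolding bounded_iff by blast
  have "open V" unfolding V_def by (intro open_Int open_vimage U contT) auto
  have "norm (F 0) ^ m \<le> 0 * M ^ (m - 1)"
  proof (rule rotated_maximum_modulus[where V = V and c = c and \<rho> = "1 - \<eta>" and \<eta> = \<eta>])
    show "\<exists>j<m. norm (cis (2 * pi * real j / real m) * u - c) < \<eta>" if "norm u = 1" for u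
      using m(2)[OF that nc] .
    show "continuous_on (ball 0 1) F" using contF ball_subset_cball continuous_on_subset by blast
    have "T holomorphic_on V" unfolding T_def by (intro holomorphic_intros)
    then have "(h \<circ> T) holomorphic_on V"
      by (rule holomorphic_on_compose_gen[OF _ h(2)]) (use T in \<open>auto simp: V_def\<close>)
    moreover have "F = h \<circ> T" by (auto simp: F_def)
    ultimately show "F holomorphic_on V" by simp
    show "0 \<in> V" using u by (simp add: V_def T_def)
    \<comment> \<open>The small bound is 0 itself: at such a frontier point \<open>T z\<close> has
      left \<open>U\<close>, and \<open>h\<close> vanishes there.\<close>
    show "norm (F z) \<le> 0" if "z \<in> ball 0 1 \<inter> frontier V" for z
    proof -
      have "z \<notin> V" using that \<open>open V\<close> by (auto simp: frontier_def interior_open)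
      then show ?thesis using that T[of z] h0[of "T z"] by (auto simp: V_def F_def)
    qed
    show "\<eta> \<le> norm (z / norm z - c)" if "z \<in> V" "1 - \<eta> \<le> norm z" for z
    proof (rule ccontr)
      assume "\<not> ?thesis"
      then have "norm (z / norm z - c) < \<eta>" by simp
      moreover have "norm (z - z / norm z) \<le> \<eta>"
      proof -
        have "z \<noteq> 0" using that \<eta> by auto
        then have "z - z / norm z = (of_real (norm z) - 1) * (z / norm z)" by
          (simp add: field_simps)
        then have "norm (z - z / norm z) = norm (complex_of_real (norm z - 1)) * norm (z / norm z)"
          by (simp only: norm_mult of_real_diff of_real_1)
        also have "\<dots> = \<bar>norm z - 1\<bar>" using \<open>z \<noteq> 0\<close> by (simp only: norm_of_real)
          (simp add: norm_divide)
        finally show ?thesis using that by (simp add: V_def)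
      qed
      ultimately have "norm (z - c) < 2 * \<eta>"
        using norm_triangle_ineq[of "z - z / norm z" "z / norm z - c"] by simp
      then have "R * norm (z - c) < d" using \<open>R > 0\<close> by (simp add: \<eta>_def field_simps)
      moreover have "dist e (T z) = R * norm (z - c)"
      proof -
        have "T z - e = of_real R * (z - c)" using \<open>R > 0\<close> by (simp add: T_def c_def field_simps)
        then show ?thesis using \<open>R > 0\<close>
          by (metis dist_commute dist_norm norm_mult norm_of_real abs_of_pos)
      qed
      ultimately have "T z \<in> ball e d" by simp
      then have "T z \<in> - closure U" using d by blast
      then show False using that closure_subset by (auto simp: V_def)
    qed
  qed (use m M \<open>open V\<close> \<eta> in \<open>auto simp: V_def\<close>)
  then have "F 0 = 0" using m(1) by (auto simp: power_le_zero_eq)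
  then show ?thesis using u \<open>0 < r\<close> by (intro that[of u]) (auto simp: F_def T_def dist_commute)
qed

text \<open>Injectivity on the boundary is a statement about fibres. The fibre over a point of the
  circle is connected, and a connected subset of a Jordan curve with two points contains one of the
  two arcs between them; constancy of the extension on such an arc is then excluded.\<close>

theorem Caratheodory_Jordan_domain:
  fixes g :: "real \<Rightarrow> complex"
  assumes g: "simple_path g" "pathfinish g = pathstart g"
  defines "U \<equiv> inside (path_image g)"
  obtains \<Phi> :: "complex \<Rightarrow> complex" where "continuous_on (closure U) \<Phi>" "inj_on \<Phi> (closure U)"
    "\<Phi> ` closure U = cball 0 1" "\<Phi> ` U = ball 0 1"
proof -
  define J where "J = path_image g"
  have U: "open U" "connected U" "U \<noteq> {}" "bounded U" "frontier U = J"
    and out: "frontier (outside J) = J"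
    using Jordan_inside_outside[OF g] by (auto simp: U_def J_def)
  have clU: "closure U = U \<union> J" "U \<inter> J = {}"
    using closure_Un_frontier[of U] U(5) inside_no_overlap[of J] by (auto simp: U_def J_def)
  have cclU: "compact (closure U)" using U by (simp add: compact_closure)
  have "simply_connected U" unfolding U_def by (rule simply_connected_inside_simple_path[OF g(1)])
  moreover have "U \<noteq> UNIV" using U(4) not_bounded_UNIV by metis
  ultimately obtain \<phi> \<psi> where hol: "\<phi> holomorphic_on U" "\<psi> holomorphic_on ball 0 1"
    and \<phi>: "\<And>z. z \<in> U \<Longrightarrow> \<phi> z \<in> ball 0 1" "\<And>z. z \<in> U \<Longrightarrow> \<psi> (\<phi> z) = z"
    and \<psi>: "\<And>z. z \<in> ball 0 1 \<Longrightarrow> \<psi> z \<in> U" "\<And>z. z \<in> ball 0 1 \<Longrightarrow> \<phi> (\<psi> z) = z"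
    using Riemann_mapping_theorem[of U] U(1,3) by blast
  have cont: "continuous_on U \<phi>" "continuous_on (ball 0 1) \<psi>"
    using hol by (auto intro: holomorphic_on_imp_continuous_on)
  \<comment> \<open>A limit \<open>a\<close> in the open disc would make \<open>x n\<close> converge
    to \<open>\<psi> a\<close>, a point of \<open>U\<close>, instead of \<open>q\<close>.\<close>
  have bdry: "norm a = 1" if "x \<longlonglongrightarrow> q" "q \<in> J" "\<And>n. x n \<in> U" "(\<lambda>n. \<phi> (x n)) \<longlonglongrightarrow> a" for x q a
  proof (rule ccontr)
    assume "norm a \<noteq> 1"
    have "a \<in> cball 0 1"
      by (rule closed_sequentially[OF closed_cball _ that(4)])
        (use \<phi>(1)[OF that(3)] in \<open>auto simp: less_imp_le\<close>)
    then have a: "a \<in> ball 0 1" using \<open>norm a \<noteq> 1\<close> by simp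
    have "(\<lambda>n. \<psi> (\<phi> (x n))) \<longlonglongrightarrow> \<psi> a"
      by (rule continuous_on_tendsto_compose[OF cont(2) that(4) a]) (use \<phi>(1)[OF that(3)] in auto)
    then have "x \<longlonglongrightarrow> \<psi> a" using \<phi>(2)[OF that(3)] by simp
    then have "q = \<psi> a" using that(1) LIMSEQ_unique by blast
    then show False using \<psi>(1)[OF a] that(2) clU by blast
  qed
  \<comment> \<open>If the limits differed, \<phi> would carry short paths near \<open>q\<close> to
    curves from near \<open>a\<close> to near \<open>b\<close> on which \<open>\<psi> z - q\<close>
    is small. \<open>Koebe_arcs\<close> then gives \<open>\<psi> 0 = q\<close>, impossible for a
    boundary point.\<close>
  have lim_unique: "a = b"
    if q: "q \<in> J" and x: "x \<longlonglongrightarrow> q" "\<And>n. x n \<in> U" "(\<lambda>n. \<phi> (x n)) \<longlonglongrightarrow> a"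
    and y: "y \<longlonglongrightarrow> q" "\<And>n. y n \<in> U" "(\<lambda>n. \<phi> (y n)) \<longlonglongrightarrow> b" for q x y a b
  proof (rule ccontr)
    assume "a \<noteq> b"
    have ab: "norm a = 1" "norm b = 1"
      using bdry[OF x(1) q x(2,3)] bdry[OF y(1) q y(2,3)] .
    obtain M where M: "\<And>z. z \<in> closure U \<Longrightarrow> norm (z - q) \<le> M"
    proof -
      have "continuous_on (closure U) (\<lambda>z. z - q)" by (intro continuous_intros)
      from compact_imp_bounded[OF compact_continuous_image[OF this cclU]] show ?thesis
        using that unfolding bounded_iff by blast
    qed
    have "\<psi> 0 - q = 0"
    proof (rule Koebe_arcs[where F = "\<lambda>z. \<psi> z - q" and M = M and a = a and b = b])
      show "(\<lambda>z. \<psi> z - q) holomorphic_on ball 0 1" by (intro holomorphic_intros hol)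
      show "norm (\<psi> z - q) \<le> M" if "z \<in> ball 0 1" for z
        using M \<psi>(1)[OF that] closure_subset by blast
      fix \<epsilon> :: real assume "0 < \<epsilon>"
      \<comment> \<open>Some ball about \<open>q\<close> misses this compact image, so \<phi> maps
        paths inside that ball close to the circle.\<close>
      have "compact (\<psi> ` cball 0 (1 - \<epsilon>))"
        using \<open>0 < \<epsilon>\<close> by (intro compact_continuous_image continuous_on_subset[OF cont(2)]) auto
      moreover have "q \<notin> \<psi> ` cball 0 (1 - \<epsilon>)" using \<psi>(1) q clU \<open>0 < \<epsilon>\<close> by force
      ultimately obtain d where d: "d > 0" "ball q d \<subseteq> - \<psi> ` cball 0 (1 - \<epsilon>)"
        by (metis ComplI compact_imp_closed open_Compl open_contains_ball)
      obtain \<delta> where \<delta>: "\<delta> > 0"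
        "\<And>x y. \<lbrakk>x \<in> U; y \<in> U; dist q x < \<delta>; dist q y < \<delta>\<rbrakk>
          \<Longrightarrow> \<exists>k. path k \<and> path_image k \<subseteq> U \<inter> ball q (min d \<epsilon>) \<and> pathstart k = x \<and> pathfinish k = y"
        using Jordan_inside_locally_connected[OF g, of q "min d \<epsilon>"] q d(1) \<open>0 < \<epsilon>\<close>
        unfolding U_def J_def by auto
      have "eventually (\<lambda>n. dist (x n) q < \<delta> \<and> dist (y n) q < \<delta> \<and> dist (\<phi> (x n)) a < \<epsilon>
        \<and> dist (\<phi> (y n)) b < \<epsilon>) sequentially"
        using x y \<delta>(1) \<open>0 < \<epsilon>\<close> by (intro eventually_conj tendstoD)
      then obtain n where n: "dist (x n) q < \<delta>" "dist (y n) q < \<delta>" "dist (\<phi> (x n)) a < \<epsilon>"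
        "dist (\<phi> (y n)) b < \<epsilon>"
        by (metis (mono_tags, lifting) eventually_sequentially order_refl)
      then obtain k where k: "path k" "path_image k \<subseteq> U \<inter> ball q (min d \<epsilon>)" "pathstart k = x n"
        "pathfinish k = y n"
        using \<delta>(2)[of "x n" "y n"] x(2) y(2) by (auto simp: dist_commute)
      have "path (\<phi> \<circ> k)"
        using k by (intro path_continuous_image continuous_on_subset[OF cont(1)]) auto
      moreover have "path_image (\<phi> \<circ> k) \<subseteq> ball 0 1"
        using k(2) \<phi>(1) by (auto simp: path_image_compose)
      moreover have "norm (\<psi> z - q) \<le> \<epsilon> \<and> 1 - \<epsilon> \<le> norm z" if z: "z \<in> path_image (\<phi> \<circ> k)" for z
      proof -
        obtain w where w: "w \<in> U" "w \<in> ball q d" "w \<in> ball q \<epsilon>" "z = \<phi> w"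
        proof -
          obtain w where "w \<in> path_image k" "z = \<phi> w" using z by (auto simp: path_image_compose)
          moreover from this have "w \<in> U \<inter> ball q (min d \<epsilon>)" using k(2) by blast
          ultimately show ?thesis using that by auto
        qed
        have "\<not> norm z \<le> 1 - \<epsilon>"
        proof
          assume "norm z \<le> 1 - \<epsilon>"
          then have "w \<in> \<psi> ` cball 0 (1 - \<epsilon>)" using w \<phi>(2)[OF w(1)]
            by (intro image_eqI[of _ _ z]) auto
          then show False using d(2) w(2) by blast
        qed
        then show ?thesis using w \<phi>(2)[OF w(1)] by (auto simp: dist_norm norm_minus_commute)
      qed
      ultimately show "\<exists>k. path k \<and> path_image k \<subseteq> ball 0 1 \<and> dist (pathstart k) a < \<epsilon> \<and>
          dist (pathfinish k) b < \<epsilon> \<and> (\<forall>z\<in>path_image k. norm (\<psi> z - q) \<le> \<epsilon> \<and> 1 - \<epsilon> \<le> norm z)"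
        using n k by (intro exI[of _ "\<phi> \<circ> k"]) (auto simp: pathstart_compose pathfinish_compose)
    qed (use ab \<open>a \<noteq> b\<close> in auto)
    then show False using \<psi>(1)[of 0] q clU by auto
  qed
  have "uniformly_continuous_on U \<phi>"
  proof (rule ccontr)
    assume "\<not> ?thesis"
    then obtain e where e: "e > 0"
      "\<And>d. d > 0 \<Longrightarrow> \<exists>x\<in>U. \<exists>y\<in>U. dist y x < d \<and> e \<le> dist (\<phi> y) (\<phi> x)"
      unfolding uniformly_continuous_on_def not_less[symmetric] by blast
    have "\<exists>x y. x \<in> U \<and> y \<in> U \<and> dist y x < inverse (real (Suc n)) \<and> e \<le> dist (\<phi> y) (\<phi> x)" for n
      using e(2)[of "inverse (real (Suc n))"] by auto
    then obtain x y where xy: "\<And>n::nat. x n \<in> U" "\<And>n. y n \<in> U"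
      "\<And>n. dist (y n) (x n) < inverse (real (Suc n))"
      "\<And>n. e \<le> dist (\<phi> (y n)) (\<phi> (x n))"
      by metis
    \<comment> \<open>The triple gives limits of \<open>x n\<close>, \<open>\<phi> (x n)\<close> and
      \<open>\<phi> (y n)\<close> along one common subsequence; \<open>y n\<close> has the same
      limit as \<open>x n\<close>.\<close>
    have "compact (closure U \<times> (cball (0::complex) 1 \<times> cball (0::complex) 1))"
      using cclU by (intro compact_Times) auto
    moreover have "\<forall>n. (x n, \<phi> (x n), \<phi> (y n)) \<in> closure U \<times> (cball (0::complex) 1 \<times> cball (0::complex) 1)"
      using xy \<phi>(1) closure_subset[of U] by (auto simp: less_imp_le)
    ultimately obtain l r where lr: "strict_mono r" "((\<lambda>n. (x n, \<phi> (x n), \<phi> (y n))) \<circ> r) \<longlonglongrightarrow> l"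
      "l \<in> closure U \<times> (cball (0::complex) 1 \<times> cball (0::complex) 1)"
      unfolding compact_def by meson
    obtain q a b where l: "l = (q, a, b)" by (metis prod_cases3)
    have lx: "(\<lambda>n. x (r n)) \<longlonglongrightarrow> q" and lax: "(\<lambda>n. \<phi> (x (r n))) \<longlonglongrightarrow> a" and lby: "(\<lambda>n. \<phi> (y (r n))) \<longlonglongrightarrow> b"
      using tendsto_fst[OF lr(2)] tendsto_fst[OF tendsto_snd[OF lr(2)]] tendsto_snd[OF tendsto_snd[OF lr(2)]]
      by (auto simp: o_def l)
    have "(\<lambda>n. dist (y n) (x n)) \<longlonglongrightarrow> 0"
    proof (rule real_tendsto_sandwich[OF _ _ tendsto_const LIMSEQ_inverse_real_of_nat])
      show "eventually (\<lambda>n. dist (y n) (x n) \<le> inverse (real (Suc n))) sequentially"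
        using xy(3) less_imp_le by (intro always_eventually) blast
    qed simp
    then have "(\<lambda>n. dist (y (r n)) (x (r n))) \<longlonglongrightarrow> 0"
      using LIMSEQ_subseq_LIMSEQ[OF _ lr(1)] by (auto simp: o_def)
    then have "(\<lambda>n. y (r n) - x (r n)) \<longlonglongrightarrow> 0"
      by (simp add: dist_norm tendsto_norm_zero_iff)
    then have ly: "(\<lambda>n. y (r n)) \<longlonglongrightarrow> q"
      by (rule Lim_transform[OF lx])
    have "e \<le> dist b a"
      by (rule tendsto_lowerbound[OF tendsto_dist[OF lby lax]]) (use xy(4) in auto)
    have "a = b"
    proof (cases "q \<in> J")
      case True
      then show ?thesis using lim_unique[OF True lx xy(1) lax ly xy(2) lby] by blast
    next
      case False
      then have "q \<in> U" using lr(3) l clU by auto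
      then have "(\<lambda>n. \<phi> (x (r n))) \<longlonglongrightarrow> \<phi> q" "(\<lambda>n. \<phi> (y (r n))) \<longlonglongrightarrow> \<phi> q"
        using continuous_on_tendsto_compose[OF cont(1) lx] continuous_on_tendsto_compose[OF cont(1) ly] xy(1,2)
        by auto
      then show ?thesis using lax lby LIMSEQ_unique by metis
    qed
    then show False using \<open>e \<le> dist b a\<close> e(1) by simp
  qed
  then obtain \<Phi> where "uniformly_continuous_on (closure U) \<Phi>" and \<Phi>\<phi>: "\<And>z. z \<in> U \<Longrightarrow> \<phi> z = \<Phi> z"
    using uniformly_continuous_on_extension_on_closure by metis
  then have cont\<Phi>: "continuous_on (closure U) \<Phi>" by (simp add: uniformly_continuous_imp_continuous)
  have seq: "\<exists>x. (\<forall>n. x n \<in> U) \<and> x \<longlonglongrightarrow> q \<and> (\<lambda>n. \<phi> (x n)) \<longlonglongrightarrow> \<Phi> q" if q: "q \<in> closure U" for q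
  proof -
    obtain x where x: "\<And>n. x n \<in> U" "x \<longlonglongrightarrow> q" using q closure_sequential by blast
    then have "(\<lambda>n. \<Phi> (x n)) \<longlonglongrightarrow> \<Phi> q"
      using continuous_on_tendsto_compose[OF cont\<Phi> x(2) q] x(1) closure_subset[of U]
      by (simp add: subset_iff)
    then have "(\<lambda>n. \<phi> (x n)) \<longlonglongrightarrow> \<Phi> q" using \<Phi>\<phi>[OF x(1)] by simp
    then show ?thesis using x by blast
  qed
  have \<Phi>J: "norm (\<Phi> q) = 1" if "q \<in> J" for q
    using seq[of q] bdry[of _ q "\<Phi> q"] that clU by blast
  have \<Phi>U: "\<Phi> ` U = ball 0 1"
  proof
    show "\<Phi> ` U \<subseteq> ball 0 1" using \<Phi>\<phi> \<phi>(1) by force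
    show "ball 0 1 \<subseteq> \<Phi> ` U" using \<Phi>\<phi>[OF \<psi>(1)] \<psi> by force
  qed
  have \<Phi>cl: "\<Phi> ` closure U = cball 0 1"
  proof
    have "\<Phi> ` closure U = ball 0 1 \<union> \<Phi> ` J" by (simp add: clU image_Un \<Phi>U)
    then show "\<Phi> ` closure U \<subseteq> cball 0 1" using \<Phi>J by auto
    have "closure (ball (0::complex) 1) \<subseteq> \<Phi> ` closure U"
      using \<Phi>U closure_subset[of U] compact_continuous_image[OF cont\<Phi> cclU]
      by (intro closure_minimal) (auto simp: compact_imp_closed)
    then show "cball 0 1 \<subseteq> \<Phi> ` closure U" by simp
  qed
  have fibre: "connected {x \<in> closure U. \<Phi> x = a}" if a: "norm a = 1" for a
  proof -
    \<comment> \<open>The images of the convex sets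
      \<open>ball 0 1 \<inter> ball a (inverse (real (Suc n)))\<close> are connected; their closures
      are compact, decrease, and intersect in the fibre.\<close>
    define S where "S n = closure (\<psi> ` (ball 0 1 \<inter> ball a (inverse (real (Suc n)))))" for n
    have SU: "S n \<subseteq> closure U" for n
      unfolding S_def using \<psi>(1) by (intro closure_mono) auto
    have "connected (\<Inter> (range S))"
    proof (rule connected_nest)
      show "compact (S n)" for n
        using SU[of n] cclU by (metis S_def closed_closure compact_Int_closed inf.absorb2)
      show "connected (S n)" for n
        unfolding S_def
        by (intro connected_imp_connected_closure connected_continuous_image continuous_on_subset[OF cont(2)] convex_connected convex_Int) auto
      show "S n \<subseteq> S k" if "k \<le> n" for k n
        unfolding S_def using that by (intro closure_mono image_mono Int_mono subset_ball)
          (auto simp: le_imp_inverse_le)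
    qed
    also have "\<Inter> (range S) = {x \<in> closure U. \<Phi> x = a}"
    proof (intro equalityI subsetI)
      fix x assume x: "x \<in> \<Inter> (range S)"
      have xU: "x \<in> closure U" using x SU[of 0] by auto
      have "dist a (\<Phi> x) \<le> inverse (real (Suc n))" for n
      proof -
        have "\<Phi> ` S n \<subseteq> cball a (inverse (real (Suc n)))"
          unfolding S_def
        proof (rule image_closure_subset)
          show "continuous_on (closure (\<psi> ` (ball 0 1 \<inter> ball a (inverse (real (Suc n)))))) \<Phi>"
            using SU[of n] continuous_on_subset[OF cont\<Phi>] unfolding S_def by blast
          show "\<Phi> ` \<psi> ` (ball 0 1 \<inter> ball a (inverse (real (Suc n)))) \<subseteq> cball a (inverse (real (Suc n)))"
            using \<Phi>\<phi>[OF \<psi>(1)] \<psi>(2) by (auto simp: less_imp_le)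
        qed auto
        moreover have "x \<in> S n" using x by blast
        ultimately have "\<Phi> x \<in> cball a (inverse (real (Suc n)))" by blast
        then show ?thesis by (simp only: mem_cball)
      qed
      moreover have "(\<lambda>n. inverse (real (Suc n))) \<longlonglongrightarrow> 0" by (rule LIMSEQ_inverse_real_of_nat)
      ultimately have "dist a (\<Phi> x) \<le> 0" by (intro LIMSEQ_le_const[of _ 0]) auto
      then show "x \<in> {x \<in> closure U. \<Phi> x = a}" using xU by simp
    next
      fix x assume x: "x \<in> {x \<in> closure U. \<Phi> x = a}"
      then obtain s where s: "\<And>n. s n \<in> U" "s \<longlonglongrightarrow> x" "(\<lambda>n. \<phi> (s n)) \<longlonglongrightarrow> a"
        using seq[of x] by auto
      have "x \<in> S n" for n
      proof -
        have "eventually (\<lambda>k. dist (\<phi> (s k)) a < inverse (real (Suc n))) sequentially"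
          by (intro tendstoD[OF s(3)]) simp
        then have "eventually (\<lambda>k. s k \<in> S n) sequentially"
        proof eventually_elim
          case (elim k)
          have "s k \<in> \<psi> ` (ball 0 1 \<inter> ball a (inverse (real (Suc n))))"
            using elim \<phi>[OF s(1)[of k]]
            by (intro image_eqI[of _ _ "\<phi> (s k)"]) (auto simp: dist_commute)
          then show ?case unfolding S_def by (rule subsetD[OF closure_subset])
        qed
        then show ?thesis
          by (rule Lim_in_closed_set[OF _ _ sequentially_bot s(2), rotated]) (simp add: S_def)
      qed
      then show "x \<in> \<Inter> (range S)" by blast
    qed
    finally show ?thesis .
  qed
  have inj: "inj_on \<Phi> (closure U)"
  proof (rule inj_onI, rule ccontr)
    fix p q assume pq: "p \<in> closure U" "q \<in> closure U" "\<Phi> p = \<Phi> q" "p \<noteq> q"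
    have UU: "x \<in> J" if "x \<in> closure U" "y \<in> closure U" "\<Phi> x = \<Phi> y" "y \<in> J" for x y
    proof -
      have "\<Phi> x \<notin> \<Phi> ` U" using that(3) \<Phi>J[OF that(4)] \<Phi>U by simp
      then show ?thesis using that(1) clU(1) by blast
    qed
    have "\<not> (p \<in> U \<and> q \<in> U)" using pq \<Phi>\<phi> \<phi>(2) by metis
    then have pqJ: "p \<in> J" "q \<in> J" using UU pq clU by (metis Un_iff)+
    define a where "a = \<Phi> p"
    have a: "norm a = 1" using \<Phi>J pqJ a_def by blast
    define E where "E = {x \<in> closure U. \<Phi> x = a}"
    have EJ: "E \<subseteq> J" using UU[of _ p] pqJ clU by (auto simp: E_def a_def)
    have E: "connected E" "p \<in> E" "q \<in> E" using fibre[OF a] pq by (auto simp: E_def a_def)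
    obtain u d where ud: "arc u" "arc d" "pathstart u = p" "pathfinish u = q"
                    "pathstart d = q" "pathfinish d = p"
                    "path_image u \<inter> path_image d = {p,q}" "path_image u \<union> path_image d = J"
      using exists_double_arc[OF g, of p q] pqJ pq(4) by (metis J_def)
    \<comment> \<open>In a ball about the midpoint of \<open>v\<close> that avoids \<open>w\<close>,
      the curve lies in \<open>E\<close>. There \<open>\<Phi> z - a\<close>, set to 0 off the
      closure of \<open>U\<close>, is continuous and so has a zero in \<open>U\<close>, where \<phi>
      has norm below 1.\<close>
    have no_arc: False if v: "arc v" "path_image v \<subseteq> E" "J = path_image v \<union> path_image w"
      "closed (path_image w)" "path_image v \<inter> path_image w = {pathstart v, pathfinish v}"
        for v w :: "real \<Rightarrow> complex"
    proof -
      define x0 where "x0 = v (1/2)"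
      have x0: "x0 \<in> path_image v" "x0 \<noteq> pathstart v" "x0 \<noteq> pathfinish v"
        using v(1) by (auto simp: x0_def path_image_def pathstart_def pathfinish_def arc_def dest: inj_onD)
      then have "x0 \<notin> path_image w" using v(5) by blast
      then obtain r where r: "r > 0" "ball x0 r \<subseteq> - path_image w"
        using v(4) by (metis ComplI open_Compl open_contains_ball)
      have rE: "J \<inter> ball x0 r \<subseteq> E" using r v by blast
      have x0J: "x0 \<in> J" using x0 v by blast
      define h where "h z = (if z \<in> closure U then \<Phi> z - a else 0)" for z
      obtain u where "u \<in> U" "u \<in> ball x0 r" "h u = 0"
      proof (rule zero_near_boundary_imp_zero)
        show "x0 \<in> closure U" using x0J clU by blast
        show "x0 \<in> closure (- closure U)"
        proof -
          have "x0 \<in> closure (outside J)" using out x0J by (auto simp: frontier_def)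
          moreover have "outside J \<subseteq> - closure U"
            using inside_Int_outside[of J] outside_no_overlap[of J]
            unfolding clU(1) unfolding U_def J_def by blast
          ultimately show ?thesis by (meson closure_mono subsetD)
        qed
        show "h holomorphic_on U \<inter> ball x0 r"
        proof (rule holomorphic_transform)
          show "(\<lambda>z. \<phi> z - a) holomorphic_on U \<inter> ball x0 r"
            by (intro holomorphic_intros holomorphic_on_subset[OF hol(1)]) auto
        qed (use clU \<Phi>\<phi> in \<open>auto simp: h_def\<close>)
        show "h z = 0" if "z \<in> ball x0 r - U" for z
          using that rE clU by (auto simp: h_def E_def)
        have "continuous_on ((ball x0 r \<inter> closure U) \<union> (ball x0 r \<inter> - U)) h"
        proof (rule continuous_on_Un_local)
          have "continuous_on (ball x0 r \<inter> closure U) (\<lambda>z. \<Phi> z - a)"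
            by (intro continuous_intros continuous_on_subset[OF cont\<Phi>]) auto
          then show "continuous_on (ball x0 r \<inter> closure U) h"
            by (rule continuous_on_eq) (auto simp: h_def)
          have "continuous_on (ball x0 r \<inter> - U) (\<lambda>z. 0::complex)" by (rule continuous_on_const)
          then show "continuous_on (ball x0 r \<inter> - U) h"
            by (rule continuous_on_eq) (use rE clU in \<open>auto simp: h_def E_def\<close>)
          have *: "ball x0 r = (ball x0 r \<inter> closure U) \<union> (ball x0 r \<inter> - U)"
            using closure_subset[of U] by blast
          show "closedin (top_of_set (ball x0 r \<inter> closure U \<union> ball x0 r \<inter> - U)) (ball x0 r \<inter> closure U)"
            unfolding *[symmetric] by (simp add: closedin_closed_Int)
          show "closedin (top_of_set (ball x0 r \<inter> closure U \<union> ball x0 r \<inter> - U)) (ball x0 r \<inter> - U)"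
            unfolding *[symmetric] using U(1) by (intro closedin_closed_Int)
              (simp add: closed_Compl)
        qed
        moreover have "(ball x0 r \<inter> closure U) \<union> (ball x0 r \<inter> - U) = ball x0 r"
          using closure_subset[of U] by blast
        ultimately show "continuous_on (ball x0 r) h" by simp
      qed (use r U in auto)
      then have "\<phi> u = a" using \<Phi>\<phi> closure_subset[of U] by (auto simp: h_def split: if_splits)
      then show False using \<phi>(1)[OF \<open>u \<in> U\<close>] a by simp
    qed
    have cl: "closed (path_image u)" "closed (path_image d)" using ud by
      (auto simp: closed_arc_image)
    have "\<not> path_image u \<subseteq> E" "\<not> path_image d \<subseteq> E"
      using no_arc[OF ud(1) _ _ cl(2)] no_arc[OF ud(2) _ _ cl(1)] ud by
        (auto simp: Un_commute Int_commute insert_commute)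
    then obtain s1 s2 where s: "s1 \<in> {0..1}" "u s1 \<notin> E" "s2 \<in> {0..1}" "d s2 \<notin> E"
      unfolding path_image_def by blast
    have uc: "continuous_on {0..1} u" "continuous_on {0..1} d" "inj_on u {0..1}" "inj_on d {0..1}"
      using ud by (auto simp: arc_def path_def)
    have ends: "u 0 = p" "u 1 = q" "d 0 = q" "d 1 = p" using ud by
      (auto simp: pathstart_def pathfinish_def)
    have ne: "s1 \<noteq> 0" "s1 \<noteq> 1" "s2 \<noteq> 0" "s2 \<noteq> 1" using s E(2,3) ends by metis+
    \<comment> \<open>Neither arc lies in \<open>E\<close>, so the curve can be cut at
      \<open>u s1\<close> and \<open>d s2\<close> without touching \<open>E\<close>.
      \<open>?A\<close> is the closed piece through \<open>p\<close> and \<open>?B\<close> the one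
      through \<open>q\<close>, which disconnects \<open>E\<close>.\<close>
    let ?A = "u ` {0..s1} \<union> d ` {s2..1}" and ?B = "u ` {s1..1} \<union> d ` {0..s2}"
    have clA: "closed ?A" "closed ?B"
      using s by (auto intro!: closed_Un compact_imp_closed[OF compact_continuous_image]
          intro: continuous_on_subset[OF uc(1)] continuous_on_subset[OF uc(2)])
    have cover: "E \<subseteq> ?A \<union> ?B"
    proof -
      have "{0..1} = {0..s1} \<union> {s1..1}" "{0..1} = {0..s2} \<union> {s2..1}" using s by auto
      then have "path_image u \<subseteq> ?A \<union> ?B" "path_image d \<subseteq> ?A \<union> ?B" unfolding path_image_def by blast+
      then show ?thesis using EJ ud(8) by blast
    qed
    have "?A \<inter> ?B \<inter> E = {}"
    proof -
      have cross: "\<And>s t. s \<in> {0..1} \<Longrightarrow> t \<in> {0..1} \<Longrightarrow> u s = d t \<Longrightarrow> u s = p \<or> u s = q"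
        using ud(7) unfolding path_image_def by blast
      have up: "\<And>s. s \<in> {0..1} \<Longrightarrow> (u s = p \<longleftrightarrow> s = 0) \<and> (u s = q \<longleftrightarrow> s = 1)"
        using uc(3) ends by (metis atLeastAtMost_iff inj_onD order_refl zero_le_one)
      have dp: "\<And>s. s \<in> {0..1} \<Longrightarrow> (d s = q \<longleftrightarrow> s = 0) \<and> (d s = p \<longleftrightarrow> s = 1)"
        using uc(4) ends by (metis atLeastAtMost_iff inj_onD order_refl zero_le_one)
      have 1: "u ` {0..s1} \<inter> u ` {s1..1} \<subseteq> {u s1}"
        using uc(3) s(1) by (auto dest!: inj_onD)
      have 2: "d ` {s2..1} \<inter> d ` {0..s2} \<subseteq> {d s2}"
        using uc(4) s(3) by (auto dest!: inj_onD)
      have 3: "u ` {0..s1} \<inter> d ` {0..s2} = {}"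
      proof (rule ccontr)
        assume "u ` {0..s1} \<inter> d ` {0..s2} \<noteq> {}"
        then obtain s t where st: "s \<in> {0..s1}" "t \<in> {0..s2}" "u s = d t" by blast
        then have st1: "s \<in> {0..1}" "t \<in> {0..1}" using s by auto
        then show False using cross[OF st1 st(3)] up[OF st1(1)] dp[OF st1(2)] st s ne by auto
      qed
      have 4: "u ` {s1..1} \<inter> d ` {s2..1} = {}"
      proof (rule ccontr)
        assume "u ` {s1..1} \<inter> d ` {s2..1} \<noteq> {}"
        then obtain s t where st: "s \<in> {s1..1}" "t \<in> {s2..1}" "u s = d t" by blast
        then have st1: "s \<in> {0..1}" "t \<in> {0..1}" using s by auto
        then show False using cross[OF st1 st(3)] up[OF st1(1)] dp[OF st1(2)] st s ne by auto
      qed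
      have "(A1 \<union> A2) \<inter> (B1 \<union> B2) \<inter> E = {}"
        if "A1 \<inter> B1 \<subseteq> {x}" "A2 \<inter> B2 \<subseteq> {y}" "A1 \<inter> B2 = {}" "B1 \<inter> A2 = {}" "x \<notin> E" "y \<notin> E"
        for A1 A2 B1 B2 x y
        using that by blast
      from this[OF 1 2 3 4 s(2,4)] show ?thesis .
    qed
    from connected_closedD[OF E(1) this cover clA] have "?A \<inter> E = {} \<or> ?B \<inter> E = {}" .
    moreover have "p \<in> ?A" "q \<in> ?B" using ends s by (force, force)
    ultimately show False using E(2,3) by (metis IntI empty_iff)
  qed
  show ?thesis by (rule that[OF cont\<Phi> inj \<Phi>cl \<Phi>U])
qed

section \<open>Connected 1-manifolds\<close>

text \<open>A one-dimensional manifold without boundary, with arcs as charts so that subpaths and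
  joins apply directly. The parameter 1/2 keeps \<open>p\<close> off the ends of its chart.\<close>

definition curve_like :: "'a::euclidean_space set \<Rightarrow> bool" where
  "curve_like C \<longleftrightarrow> (\<forall>p\<in>C. \<exists>\<kappa>. arc \<kappa> \<and> \<kappa> (1/2) = p \<and> path_image \<kappa> \<subseteq> C \<and>
     openin (top_of_set C) (\<kappa> ` {0<..<1}))"

text \<open>Read in a chart, \<open>f\<close> is a continuous injection between open subsets of the
  line, to which invariance of domain applies.\<close>

lemma curve_like_image_open:
  fixes f :: "real \<Rightarrow> 'a::euclidean_space"
  assumes C: "curve_like C" and f: "open I" "continuous_on I f" "inj_on f I" "f ` I \<subseteq> C"
  shows "openin (top_of_set C) (f ` I)"
proof (subst openin_subopen, intro ballI)
  fix p assume "p \<in> f ` I"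
  then obtain t where t: "t \<in> I" "p = f t" by blast
  then obtain \<kappa> where \<kappa>: "arc \<kappa>" "\<kappa> (1/2) = p" "path_image \<kappa> \<subseteq> C"
    "openin (top_of_set C) (\<kappa> ` {0<..<1})"
    using C f(4) unfolding curve_like_def by blast
  obtain h where h: "homeomorphism {0..1} (path_image \<kappa>) \<kappa> h"
    using homeomorphism_arc[OF \<kappa>(1)] by blast
  define W where "W = \<kappa> ` {0<..<1}"
  have hW: "homeomorphism {0<..<1} W \<kappa> h"
    by (rule homeomorphism_of_subsets[OF h]) (auto simp: W_def)
  obtain T where T: "open T" "W = C \<inter> T" using \<kappa>(4) by (auto simp: openin_open W_def)
  define I' where "I' = I \<inter> f -` T"
  have "open I'" unfolding I'_def by (rule continuous_open_preimage[OF f(2,1) T(1)])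
  have fI': "f ` I' \<subseteq> W" using f(4) T(2) by (auto simp: I'_def)
  have "p \<in> W" using \<kappa>(2) by (auto simp: W_def)
  then have "t \<in> I'" using t T(2) by (auto simp: I'_def)
  have hinj: "inj_on h W" "h ` W = {0<..<1}" "continuous_on W h" "\<And>y. y \<in> W \<Longrightarrow> \<kappa> (h y) = y"
    using hW by (auto simp: homeomorphism_def inj_on_def)
  have "open ((h \<circ> f) ` I')"
  proof (rule invariance_of_domain)
    show "continuous_on I' (h \<circ> f)"
      using fI' by (intro continuous_on_compose continuous_on_subset[OF f(2)] continuous_on_subset[OF hinj(3)]) (auto simp: I'_def)
    show "inj_on (h \<circ> f) I'"
      using fI' by (intro comp_inj_on inj_on_subset[OF f(3)] inj_on_subset[OF hinj(1)])
        (auto simp: I'_def)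
  qed fact
  moreover have "(h \<circ> f) ` I' \<subseteq> {0<..<1}" using hinj(2) fI' by auto
  ultimately have "openin (top_of_set W) (\<kappa> ` (h \<circ> f) ` I')"
    by (intro homeomorphism_imp_open_map[OF hW]) (simp add: open_openin_trans)
  moreover have "\<kappa> ` (h \<circ> f) ` I' = f ` I'" using hinj(4) fI' by (force simp: image_iff)
  ultimately have "openin (top_of_set C) (f ` I')"
    using \<kappa>(4) openin_trans unfolding W_def by metis
  then show "\<exists>T. openin (top_of_set C) T \<and> p \<in> T \<and> T \<subseteq> f ` I"
    using t \<open>t \<in> I'\<close> by (intro exI[of _ "f ` I'"]) (auto simp: I'_def)
qed

text \<open>The image of a loop is compact, and by invariance of domain also relatively open, so it
  exhausts the connected set.\<close>

lemma curve_like_loop: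
  fixes C :: "'a::euclidean_space set"
  assumes C: "curve_like C" "connected C"
    and g: "simple_path g" "pathfinish g = pathstart g" "path_image g \<subseteq> C"
  shows "path_image g = C"
proof -
  have op: "openin (top_of_set C) (f ` {0<..<1})" if "simple_path f" "path_image f \<subseteq> C" for f
  proof (rule curve_like_image_open[OF C(1)])
    have "continuous_on {0..1} f" using that(1) by (simp add: simple_path_def path_def)
    then show "continuous_on {0<..<1} f" by (rule continuous_on_subset) auto
    show "inj_on f {0<..<1}"
      using that(1) unfolding simple_path_def loop_free_def inj_on_def by force
    show "f ` {0<..<1} \<subseteq> C" using that(2) by (auto simp: path_image_def)
  qed auto
  \<comment> \<open>The base point of \<open>g\<close> has an inner parameter in the shifted loop,
    so two open intervals cover the whole image.\<close>
  define h where "h = shiftpath (1/2) g"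
  have h: "simple_path h" "path_image h = path_image g"
    using g by (auto simp: h_def simple_path_shiftpath path_image_shiftpath)
  have "path_image g = g ` {0<..<1} \<union> h ` {0<..<1}"
  proof -
    have sub: "f ` {0<..<1} \<subseteq> path_image f" for f :: "real \<Rightarrow> 'a" unfolding path_image_def
      by (intro image_mono) auto
    have "g x \<in> g ` {0<..<1} \<union> h ` {0<..<1}" if "x \<in> {0..1}" for x
    proof (cases "x \<in> {0<..<1}")
      case False
      then have "x = 0 \<or> x = 1" using that by auto
      then have "g x = h (1/2)" using g(2) by
        (auto simp: h_def shiftpath_def pathstart_def pathfinish_def)
      then show ?thesis by (auto simp: image_iff intro!: bexI[of _ "1/2"])
    qed auto
    then show ?thesis using sub[of g] sub[of h] h(2) unfolding path_image_def by blast
  qed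
  then have "openin (top_of_set C) (path_image g)"
    using op[OF g(1,3)] op[OF h(1)] h(2) g(3) by (metis openin_Un)
  moreover have "closedin (top_of_set C) (path_image g)"
    using g by (intro closed_subset) (auto simp: closed_simple_path_image)
  ultimately show ?thesis
    using C(2) path_image_nonempty[of g] unfolding connected_clopen by metis
qed

text \<open>Charts make \<open>C\<close> locally path connected, so connectedness yields paths, and
  these can be replaced by arcs.\<close>

lemma curve_like_arc_between:
  fixes C :: "'a::euclidean_space set"
  assumes C: "curve_like C" "connected C" and xy: "x \<in> C" "y \<in> C" "x \<noteq> y"
  obtains g where "arc g" "path_image g \<subseteq> C" "pathstart g = x" "pathfinish g = y"
proof -
  have "path_component C a b" if ab: "a \<in> C" "b \<in> C" for a b
  proof (rule connected_equivalence_relation[OF C(2) ab])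
    show "\<And>x y. path_component C x y \<Longrightarrow> path_component C y x" by (rule path_component_sym)
    show "\<And>x y z. path_component C x y \<Longrightarrow> path_component C y z \<Longrightarrow> path_component C x z"
      by (rule path_component_trans)
    fix p assume "p \<in> C"
    then obtain \<kappa> where \<kappa>: "arc \<kappa>" "\<kappa> (1/2) = p" "path_image \<kappa> \<subseteq> C"
      "openin (top_of_set C) (\<kappa> ` {0<..<1})"
      using C(1) unfolding curve_like_def by blast
    have "path_connected (\<kappa> ` {0<..<1})"
      using \<kappa>(1) by (intro path_connected_continuous_image convex_imp_path_connected)
        (auto simp: arc_def path_def intro: continuous_on_subset)
    moreover have "p \<in> \<kappa> ` {0<..<1}" using \<kappa>(2) by auto
    ultimately have "\<forall>x\<in>\<kappa> ` {0<..<1}. path_component C p x"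
      using openin_imp_subset[OF \<kappa>(4)] by (meson path_component_of_subset path_connected_component)
    then show "\<exists>T. openin (top_of_set C) T \<and> p \<in> T \<and> (\<forall>x\<in>T. path_component C p x)"
      using \<kappa>(4) \<open>p \<in> \<kappa> ` {0<..<1}\<close> by blast
  qed
  then have "path_connected C" by (simp add: path_connected_component)
  then show ?thesis using xy that unfolding path_connected_arcwise by blast
qed

text \<open>The open part of \<open>g\<close> is relatively open in \<open>C\<close>. Had
  \<open>k\<close> first met \<open>g\<close> there, it would have been on \<open>g\<close> a moment
  earlier; so it arrives at an end.\<close>

lemma curve_like_first_hit:
  fixes C :: "'a::euclidean_space set"
  assumes C: "curve_like C" and g: "arc g" "path_image g \<subseteq> C" and k: "arc k" "path_image k \<subseteq> C"
    and ends: "pathstart k \<notin> path_image g" "pathfinish k \<in> path_image g"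
  obtains k' where "arc k'" "path_image k' \<subseteq> path_image k" "pathstart k' = pathstart k"
    "path_image k' \<inter> path_image g = {pathfinish k'}" "pathfinish k' \<in> {pathstart g, pathfinish g}"
proof -
  have kc: "continuous_on {0..1} k" and gc: "continuous_on {0..1} g" "inj_on g {0..1}"
    using g k by (auto simp: arc_def path_def)
  define A where "A = {0..1} \<inter> k -` path_image g"
  have "compact A" unfolding A_def
    by (simp add: compact_eq_bounded_closed bounded_Int continuous_closed_preimage[OF kc] closed_arc_image[OF g(1)])
  moreover have "A \<noteq> {}"
  proof -
    have "1 \<in> A" using ends(2) by (simp add: A_def pathfinish_def)
    then show ?thesis by blast
  qed
  ultimately obtain t where t: "t \<in> A" "\<And>s. s \<in> A \<Longrightarrow> t \<le> s"
    using compact_attains_inf by metis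
  have t01: "0 \<le> t" "t \<le> 1" "k t \<in> path_image g" using t by (auto simp: A_def)
  have "t \<noteq> 0" using ends(1) t01(3) by (auto simp: pathstart_def)
  have before: "k s \<notin> path_image g" if "0 \<le> s" "s < t" for s
    using t(2)[of s] that t01 by (auto simp: A_def)
  have end_pt: "k t \<in> {pathstart g, pathfinish g}"
  proof (rule ccontr)
    assume neg: "k t \<notin> {pathstart g, pathfinish g}"
    obtain s where s: "s \<in> {0..1}" "k t = g s" using t01(3) by (auto simp: path_image_def)
    then have "s \<in> {0<..<1}" using neg by (cases "s = 0 \<or> s = 1")
      (auto simp: pathstart_def pathfinish_def)
    have "openin (top_of_set C) (g ` {0<..<1})"
    proof (rule curve_like_image_open[OF C])
      show "g ` {0<..<1} \<subseteq> C" using g(2) by (auto simp: path_image_def)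
    qed (auto intro: continuous_on_subset[OF gc(1)] inj_on_subset[OF gc(2)])
    then obtain T where T: "open T" "g ` {0<..<1} = C \<inter> T" by (auto simp: openin_open)
    have "k t \<in> T" using T s \<open>s \<in> {0<..<1}\<close> by blast
    then obtain e where e: "e > 0" "ball (k t) e \<subseteq> T" using T(1) open_contains_ball by blast
    obtain d where d: "d > 0" "\<And>s. \<lbrakk>s \<in> {0..1}; dist s t < d\<rbrakk> \<Longrightarrow> dist (k s) (k t) < e"
      using kc t01 e(1) unfolding continuous_on_iff by (metis atLeastAtMost_iff)
    \<comment> \<open>A parameter shortly before the first hit; the maximum with 0 keeps it in the
      domain.\<close>
    define s' where "s' = max 0 (t - d/2)"
    have s': "0 \<le> s'" "s' < t" "dist s' t < d" using d(1) t01 \<open>t \<noteq> 0\<close> by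
      (auto simp: s'_def dist_real_def)
    then have "k s' \<in> ball (k t) e" using d(2)[of s'] t01 by (auto simp: dist_commute)
    moreover have "k s' \<in> C" using k(2) s' t01 by (auto simp: path_image_def)
    ultimately have "k s' \<in> g ` {0<..<1}" using e(2) T(2) by blast
    then show False using before[OF s'(1,2)] by (auto simp: path_image_def)
  qed
  show ?thesis
  proof (rule that[of "subpath 0 t k"])
    show "arc (subpath 0 t k)" using k(1) t01 \<open>t \<noteq> 0\<close> by (intro arc_subpath_arc) auto
    show "path_image (subpath 0 t k) \<subseteq> path_image k" using t01 k(1)
      by (intro path_image_subpath_subset) auto
    show "path_image (subpath 0 t k) \<inter> path_image g = {pathfinish (subpath 0 t k)}"
    proof
      show "path_image (subpath 0 t k) \<inter> path_image g \<subseteq> {pathfinish (subpath 0 t k)}"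
        using before t01 by (force simp: path_image_subpath)
      show "{pathfinish (subpath 0 t k)} \<subseteq> path_image (subpath 0 t k) \<inter> path_image g"
        using t01 by (auto simp: path_image_subpath)
    qed
  qed (use end_pt in \<open>simp_all add: pathstart_def[of k]\<close>)
qed

text \<open>An arc from \<open>x\<close> can reach \<open>g\<close> only at an end, so stopping it
  there and appending \<open>g\<close>, or \<open>g\<close> reversed, gives an arc again.\<close>

lemma curve_like_extend_to:
  fixes C :: "'a::euclidean_space set"
  assumes C: "curve_like C" "connected C" and g: "arc g" "path_image g \<subseteq> C" and x: "x \<in> C"
  obtains g' where "arc g'" "path_image g' \<subseteq> C" "insert x (path_image g) \<subseteq> path_image g'"
proof (cases "x \<in> path_image g")
  case True
  then show ?thesis using that g by blast
next
  case False
  have "pathstart g \<in> C" "x \<noteq> pathstart g" using g(2) False by auto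
  then obtain k where k: "arc k" "path_image k \<subseteq> C" "pathstart k = x" "pathfinish k = pathstart g"
    using curve_like_arc_between[OF C x] by metis
  obtain k' where k': "arc k'" "path_image k' \<subseteq> path_image k" "pathstart k' = pathstart k"
    "path_image k' \<inter> path_image g = {pathfinish k'}" "pathfinish k' \<in> {pathstart g, pathfinish g}"
    using curve_like_first_hit[OF C(1) g k(1,2)] False k by (metis pathstart_in_path_image)
  have xk': "x \<in> path_image k'" using k' k by (metis pathstart_in_path_image)
  show ?thesis
  proof (cases "pathfinish k' = pathstart g")
    case True
    show ?thesis
    proof (rule that[of "k' +++ g"])
      show "arc (k' +++ g)" using k' True g by (intro arc_join) auto
    qed (use k' k g True xk' in \<open>auto simp: path_image_join\<close>)
  next
    case F: False
    show ?thesis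
    proof (rule that[of "k' +++ reversepath g"])
      show "arc (k' +++ reversepath g)" using k' F g by (intro arc_join arc_reversepath) auto
    qed (use k' k g F xk' in \<open>auto simp: path_image_join\<close>)
  qed
qed

text \<open>A chart at the end of \<open>g\<close> cannot stay inside \<open>g\<close>: transported
  to the parameter interval of \<open>g\<close>, it would be an open set around 1 inside
  \<open>{0..1}\<close>. A chart point off \<open>g\<close> is then joined back to the end.\<close>

lemma curve_like_extend_beyond_end:
  fixes C :: "'a::euclidean_space set"
  assumes C: "curve_like C" and g: "arc g" "path_image g \<subseteq> C"
  obtains k where "arc k" "path_image k \<subseteq> C" "pathstart k = pathfinish g"
    "path_image g \<inter> path_image k = {pathfinish g}"
proof -
  have "pathfinish g \<in> C" using g by auto
  then obtain \<kappa> where \<kappa>: "arc \<kappa>" "\<kappa> (1/2) = pathfinish g" "path_image \<kappa> \<subseteq> C"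
    using C unfolding curve_like_def by blast
  have \<kappa>c: "continuous_on {0..1} \<kappa>" "inj_on \<kappa> {0..1}" using \<kappa> by (auto simp: arc_def path_def)
  have "open ({0<..<1} \<inter> \<kappa> -` (- {pathstart g}))"
    by (intro continuous_open_preimage continuous_on_subset[OF \<kappa>c(1)]) auto
  moreover have "1/2 \<in> {0<..<1} \<inter> \<kappa> -` (- {pathstart g})"
    using \<kappa>(2) arc_distinct_ends[OF g(1)] by auto
  \<comment> \<open>Near the parameter 1/2 the chart avoids the start of \<open>g\<close>, so
    \<open>curve_like_first_hit\<close> can only stop at \<open>pathfinish g\<close>.\<close>
  ultimately obtain r where r: "r > 0" "ball (1/2) r \<subseteq> {0<..<1} \<inter> \<kappa> -` (- {pathstart g})"
    using open_contains_ball by blast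
  have "\<exists>t\<in>ball (1/2) r. \<kappa> t \<notin> path_image g"
  proof (rule ccontr)
    assume "\<not> ?thesis"
    then have sub: "\<kappa> ` ball (1/2) r \<subseteq> path_image g" by blast
    obtain h where h: "homeomorphism {0..1} (path_image g) g h"
      using homeomorphism_arc[OF g(1)] by blast
    have hh: "continuous_on (path_image g) h" "inj_on h (path_image g)" "h ` path_image g = {0..1}"
      using h unfolding homeomorphism_def inj_on_def by (auto, metis)
    have "open ((h \<circ> \<kappa>) ` ball (1/2) r)"
    proof (rule invariance_of_domain)
      show "continuous_on (ball (1/2) r) (h \<circ> \<kappa>)"
        using sub r(2) by (intro continuous_on_compose continuous_on_subset[OF \<kappa>c(1)] continuous_on_subset[OF hh(1)]) force+
      show "inj_on (h \<circ> \<kappa>) (ball (1/2) r)"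
        using sub r(2) by (intro comp_inj_on inj_on_subset[OF \<kappa>c(2)] inj_on_subset[OF hh(2)]) force+
    qed auto
    moreover have "1 \<in> (h \<circ> \<kappa>) ` ball (1/2) r"
    proof (rule image_eqI)
      show "1 = (h \<circ> \<kappa>) (1/2)" using h \<kappa>(2) by (simp add: homeomorphism_def pathfinish_def)
    qed (use r in auto)
    ultimately obtain e where e: "e > 0" "ball 1 e \<subseteq> (h \<circ> \<kappa>) ` ball (1/2) r"
      using open_contains_ball by blast
    have "(h \<circ> \<kappa>) ` ball (1/2) r \<subseteq> {0..1}" using hh(3) sub by auto
    moreover have "1 + e/2 \<in> ball 1 e" using e by (simp add: dist_real_def)
    ultimately have "1 + e/2 \<in> {0..1}" using e(2) by blast
    then show False using e(1) by simp
  qed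
  then obtain t where t: "t \<in> ball (1/2) r" "\<kappa> t \<notin> path_image g" by blast
  have t01: "t \<in> {0..1}" using t(1) r(2) by force
  have "t \<noteq> 1/2"
  proof
    assume "t = 1/2"
    then have "\<kappa> t = pathfinish g" using \<kappa>(2) by (simp only:)
    then show False using t(2) pathfinish_in_path_image by metis
  qed
  define k where "k = subpath t (1/2) \<kappa>"
  have "closed_segment t (1/2) \<subseteq> ball (1/2) r"
    using t(1) r(1) by (intro closed_segment_subset) auto
  then have kim: "path_image k \<subseteq> \<kappa> ` ball (1/2) r"
    unfolding k_def path_image_subpath_gen by (rule image_mono)
  then have k_start: "pathstart g \<notin> path_image k"
  proof -
    have "\<kappa> x \<noteq> pathstart g" if "x \<in> ball (1/2) r" for x using subsetD[OF r(2) that] by simp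
    then show ?thesis using kim by (metis imageE subsetD)
  qed
  have k: "arc k" "path_image k \<subseteq> C" "pathstart k = \<kappa> t" "pathfinish k = pathfinish g"
    using \<kappa> t01 \<open>t \<noteq> 1/2\<close> path_image_subpath_subset[of t "1/2" \<kappa>]
    by (auto simp: k_def intro!: arc_subpath_arc)
  obtain k' where k': "arc k'" "path_image k' \<subseteq> path_image k" "pathstart k' = pathstart k"
    "path_image k' \<inter> path_image g = {pathfinish k'}" "pathfinish k' \<in> {pathstart g, pathfinish g}"
    using curve_like_first_hit[OF C g k(1,2)] k t(2) by (metis pathfinish_in_path_image)
  have "pathfinish k' \<noteq> pathstart g" using k_start k'(2) pathfinish_in_path_image[of k']
    by (metis subsetD)
  then have "pathfinish k' = pathfinish g" using k'(5) by simp
  with k'(1-4) k(2) show ?thesis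
    by (intro that[of "reversepath k'"]) (auto simp: arc_reversepath Int_commute)
qed

text \<open>That the old arc lies in the open part of the new one is what gives strictly positive
  slopes when a parametrization is prolonged.\<close>

lemma curve_like_extend_both_ends:
  fixes C :: "'a::euclidean_space set"
  assumes C: "curve_like C" and g: "arc g" "path_image g \<subseteq> C"
  obtains g' where "arc g'" "path_image g' \<subseteq> C" "path_image g \<subseteq> g' ` {0<..<1}"
proof -
  have ext: "\<exists>f'. arc f' \<and> path_image f' \<subseteq> C \<and> path_image f \<subseteq> path_image f' \<and>
      pathstart f' = pathstart f \<and> pathfinish f' \<notin> path_image f" if f: "arc f" "path_image f \<subseteq> C" for f
  proof -
    obtain k where k: "arc k" "path_image k \<subseteq> C" "pathstart k = pathfinish f"
      "path_image f \<inter> path_image k = {pathfinish f}"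
      using curve_like_extend_beyond_end[OF C f] by blast
    have "pathfinish k \<noteq> pathfinish f" using k arc_distinct_ends by metis
    then have "pathfinish k \<notin> path_image f" using k(4) pathfinish_in_path_image by blast
    then show ?thesis using k f
      by (intro exI[of _ "f +++ k"]) (auto simp: path_image_join intro!: arc_join)
  qed
  obtain f where f: "arc f" "path_image f \<subseteq> C" "path_image g \<subseteq> path_image f"
    "pathfinish f \<notin> path_image g" using ext[OF g] by blast
  have "arc (reversepath f)" "path_image (reversepath f) \<subseteq> C" using f by
    (auto simp: arc_reversepath)
  from ext[OF this] obtain g' where g': "arc g'" "path_image g' \<subseteq> C" "path_image f \<subseteq> path_image g'"
    "pathstart g' = pathfinish f" "pathfinish g' \<notin> path_image f" by auto
  have "path_image g' \<subseteq> g' ` {0<..<1} \<union> {pathstart g', pathfinish g'}"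
  proof
    fix z assume "z \<in> path_image g'"
    then obtain s where "s \<in> {0..1}" "z = g' s" by (auto simp: path_image_def)
    then show "z \<in> g' ` {0<..<1} \<union> {pathstart g', pathfinish g'}"
      by (cases "s = 0 \<or> s = 1") (auto simp: pathstart_def pathfinish_def)
  qed
  moreover have "pathstart g' \<notin> path_image g" "pathfinish g' \<notin> path_image g"
    using f(3,4) g'(4,5) by auto
  ultimately have "path_image g \<subseteq> g' ` {0<..<1}" using f(3) g'(3) by blast
  then show ?thesis using that[OF g'(1,2)] by blast
qed

text \<open>An excursion of \<open>v\<close> away from \<open>a\<close>, closed up by the piece of
  \<open>a\<close> between its two feet, would be a simple loop, and by
  \<open>curve_like_loop\<close> all of \<open>C\<close>.\<close>

lemma curve_like_arc_subset:
  fixes C :: "'a::euclidean_space set"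
  assumes C: "curve_like C" "connected C"
    and noloop: "\<nexists>g. simple_path g \<and> pathfinish g = pathstart g \<and> path_image g = C"
    and v: "arc v" "path_image v \<subseteq> C" and a: "arc a" "path_image a \<subseteq> C"
    and ends: "pathstart v \<in> path_image a" "pathfinish v \<in> path_image a"
  shows "path_image v \<subseteq> path_image a"
proof (rule ccontr)
  assume "\<not> ?thesis"
  then obtain t where t: "t \<in> {0..1}" "v t \<notin> path_image a" unfolding path_image_def by blast
  have vc: "continuous_on {0..1} v" "inj_on v {0..1}" using v by (auto simp: arc_def path_def)
  have cl: "closed (path_image a)" using a by (simp add: closed_arc_image)
  have cmp: "compact ({x..y} \<inter> v -` path_image a)" if "0 \<le> x" "y \<le> 1" for x y
    using that continuous_closed_preimage[OF continuous_on_subset[OF vc(1), of "{x..y}"] _ cl]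
    by (auto simp: compact_eq_bounded_closed bounded_Int)
  have "0 \<in> {0..t} \<inter> v -` path_image a" "1 \<in> {t..1} \<inter> v -` path_image a"
    using ends t by (auto simp: pathstart_def pathfinish_def)
  \<comment> \<open>The excursion around \<open>t\<close> runs from the last earlier to the first
    later parameter at which \<open>v\<close> lies on \<open>a\<close>.\<close>
  then obtain t1 t2 where t1: "t1 \<in> {0..t}" "v t1 \<in> path_image a"
    "\<And>s. s \<in> {0..t} \<inter> v -` path_image a \<Longrightarrow> s \<le> t1"
    and t2: "t2 \<in> {t..1}" "v t2 \<in> path_image a" "\<And>s. s \<in> {t..1} \<inter> v -` path_image a \<Longrightarrow> t2 \<le> s"
    using compact_attains_sup[OF cmp[of 0 t]] compact_attains_inf[OF cmp[of t 1]] t(1)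
    by (metis IntE atLeastAtMost_iff empty_iff order_refl vimageE)
  have tt: "t1 \<noteq> t" "t2 \<noteq> t" using t t1 t2 by auto
  then have lt: "0 \<le> t1" "t1 < t" "t < t2" "t2 \<le> 1" using t1 t2 by auto
  obtain s1 s2 where s: "s1 \<in> {0..1}" "a s1 = v t1" "s2 \<in> {0..1}" "a s2 = v t2"
    using t1(2) t2(2) by (auto simp: path_image_def)
  have "v t1 \<noteq> v t2" using vc(2) lt by (auto dest: inj_onD)
  then have "s1 \<noteq> s2" using s by auto
  define p where "p = subpath t1 t2 v"
  define q where "q = subpath s2 s1 a"
  have pq: "arc p" "arc q" "pathfinish p = pathstart q" "pathfinish q = pathstart p"
    using s lt v a \<open>s1 \<noteq> s2\<close> by (auto simp: p_def q_def intro!: arc_subpath_arc)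
  have pqC: "path_image p \<subseteq> path_image v" "path_image q \<subseteq> path_image a"
    unfolding p_def q_def using s lt by (simp_all add: path_image_subpath_subset)
  have "path_image p \<inter> path_image a \<subseteq> {v t1, v t2}"
  proof
    fix z assume z: "z \<in> path_image p \<inter> path_image a"
    then obtain x where x: "t1 \<le> x" "x \<le> t2" "z = v x"
      using lt by (auto simp: p_def path_image_subpath)
    show "z \<in> {v t1, v t2}"
    proof (cases "x \<le> t")
      case True
      then have "x \<le> t1" using t1(3)[of x] x z lt by auto
      then show ?thesis using x by simp
    next
      case False
      then have "t2 \<le> x" using t2(3)[of x] x z lt by auto
      then show ?thesis using x by simp
    qed
  qed
  then have "path_image p \<inter> path_image q \<subseteq> {pathstart p, pathstart q}"
    using pqC(2) s by (auto simp: p_def q_def)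
  then have "simple_path (p +++ q)" using pq by (intro simple_path_join_loop) auto
  moreover have "pathfinish (p +++ q) = pathstart (p +++ q)" using pq by simp
  moreover have "path_image (p +++ q) \<subseteq> C" using pq pqC v(2) a(2) by (auto simp: path_image_join)
  ultimately show False using curve_like_loop[OF C, of "p +++ q"] noloop by blast
qed

text \<open>The inductive step for parametrizing \<open>C\<close> by the line. Growth by 1 at each
  end makes the domains exhaust the line, keeping old values makes a limit exist, and swallowing
  \<open>v\<close> makes it surjective.\<close>

lemma curve_like_extend_parametrization:
  fixes C :: "'a::euclidean_space set" and a b :: real
  assumes C: "curve_like C" "connected C"
    and noloop: "\<nexists>g. simple_path g \<and> pathfinish g = pathstart g \<and> path_image g = C"
    and \<gamma>: "a < b" "continuous_on {a..b} \<gamma>" "inj_on \<gamma> {a..b}" "\<gamma> ` {a..b} \<subseteq> C"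
    and v: "arc v" "path_image v \<subseteq> C"
  obtains \<gamma>' where "continuous_on {a-1..b+1} \<gamma>'" "inj_on \<gamma>' {a-1..b+1}" "\<gamma>' ` {a-1..b+1} \<subseteq> C"
    "\<And>x. x \<in> {a..b} \<Longrightarrow> \<gamma>' x = \<gamma> x" "path_image v \<subseteq> \<gamma>' ` {a-1..b+1}"
proof -
  define g where "g = \<gamma> \<circ> (\<lambda>t. a + t * (b - a))"
  have im: "(\<lambda>t. a + t * (b - a)) ` {0..1} = {a..b}"
  proof (intro equalityI subsetI)
    fix x assume "x \<in> {a..b}"
    then show "x \<in> (\<lambda>t. a + t * (b - a)) ` {0..1}"
      using \<gamma>(1) by (intro image_eqI[of _ _ "(x - a) / (b - a)"]) (auto simp: field_simps)
  next
    fix x assume "x \<in> (\<lambda>t. a + t * (b - a)) ` {0..1}"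
    then obtain t where t: "0 \<le> t" "t \<le> 1" "x = a + t * (b - a)" by auto
    then have "t * (b - a) \<ge> 0" "t * (b - a) \<le> 1 * (b - a)"
      using \<gamma>(1) by (auto intro: mult_right_mono)
    then show "x \<in> {a..b}" using t by auto
  qed
  have "arc g" unfolding arc_def path_def g_def
  proof
    show "continuous_on {0..1} (\<gamma> \<circ> (\<lambda>t. a + t * (b - a)))"
      unfolding comp_def
      by (rule continuous_on_compose2[OF \<gamma>(2)]) (use im in \<open>auto intro!: continuous_intros\<close>)
    show "inj_on (\<gamma> \<circ> (\<lambda>t. a + t * (b - a))) {0..1}"
      using \<gamma>(1) im by (intro comp_inj_on) (auto simp: inj_on_def \<gamma>(3)[unfolded inj_on_def])
  qed
  have gim: "path_image g = \<gamma> ` {a..b}" unfolding path_image_def g_def image_comp[symmetric] im ..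
  \<comment> \<open>First the two ends of \<open>v\<close> are absorbed;
    \<open>curve_like_arc_subset\<close> then absorbs \<open>v\<close> itself.\<close>
  obtain g1 where g1: "arc g1" "path_image g1 \<subseteq> C"
    "insert (pathstart v) (path_image g) \<subseteq> path_image g1"
    using curve_like_extend_to[OF C \<open>arc g\<close>, of "pathstart v"] gim \<gamma>(4) v(2)
      by (metis pathstart_in_path_image subsetD)
  obtain g2 where g2: "arc g2" "path_image g2 \<subseteq> C"
    "insert (pathfinish v) (path_image g1) \<subseteq> path_image g2"
    using curve_like_extend_to[OF C g1(1,2), of "pathfinish v"] v(2)
      by (metis pathfinish_in_path_image subsetD)
  have vg2: "path_image v \<subseteq> path_image g2"
    by (rule curve_like_arc_subset[OF C noloop v g2(1,2)]) (use g1 g2 in auto)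
  obtain \<beta>0 where \<beta>0: "arc \<beta>0" "path_image \<beta>0 \<subseteq> C" "path_image g2 \<subseteq> \<beta>0 ` {0<..<1}"
    using curve_like_extend_both_ends[OF C(1) g2(1,2)] by blast
  obtain h where h: "homeomorphism {0..1} (path_image \<beta>0) \<beta>0 h"
    using homeomorphism_arc[OF \<beta>0(1)] by blast
  have hh: "continuous_on (path_image \<beta>0) h" "\<And>y. y \<in> path_image \<beta>0 \<Longrightarrow> \<beta>0 (h y) = y"
    "\<And>x. x \<in> {0..1} \<Longrightarrow> h (\<beta>0 x) = x"
    using h by (auto simp: homeomorphism_def)
  have \<gamma>sub: "\<gamma> ` {a..b} \<subseteq> \<beta>0 ` {0<..<1}" using gim g1 g2 \<beta>0 by blast
  have sub01: "\<beta>0 ` {0<..<1} \<subseteq> path_image \<beta>0" unfolding path_image_def by (intro image_mono) auto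
  define \<theta>0 where "\<theta>0 = h \<circ> \<gamma>"
  have \<theta>0: "\<theta>0 x \<in> {0<..<1}" "\<beta>0 (\<theta>0 x) = \<gamma> x" if x: "x \<in> {a..b}" for x
  proof -
    obtain t where t: "t \<in> {0<..<1}" "\<gamma> x = \<beta>0 t" using \<gamma>sub x by blast
    then have "\<theta>0 x = t" using hh(3)[of t] by (simp add: \<theta>0_def)
    then show "\<theta>0 x \<in> {0<..<1}" "\<beta>0 (\<theta>0 x) = \<gamma> x" using t by auto
  qed
  have \<theta>0c: "continuous_on {a..b} \<theta>0"
    unfolding \<theta>0_def using \<gamma>sub sub01
    by (intro continuous_on_compose \<gamma> continuous_on_subset[OF hh(1)]) auto
  have "inj_on \<theta>0 {a..b}"
    using \<theta>0(2) \<gamma>(3) unfolding inj_on_def by metis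
  then have mono: "strict_mono_on {a..b} \<theta>0 \<or> strict_antimono_on {a..b} \<theta>0"
    using injective_eq_monotone_map[OF _ \<theta>0c] is_interval_cc by blast
  \<comment> \<open>Reversing \<open>\<beta>0\<close> if necessary makes the old parameter increase
    along it.\<close>
  obtain \<beta> \<theta> where \<beta>: "arc \<beta>" "path_image \<beta> = path_image \<beta>0"
    and \<theta>: "continuous_on {a..b} \<theta>" "\<And>x. x \<in> {a..b} \<Longrightarrow> \<theta> x \<in> {0<..<1}"
      "\<And>x. x \<in> {a..b} \<Longrightarrow> \<beta> (\<theta> x) = \<gamma> x" "strict_mono_on {a..b} \<theta>"
    using mono
  proof
    assume "strict_mono_on {a..b} \<theta>0"
    then show ?thesis using that[of \<beta>0 \<theta>0] \<theta>0 \<theta>0c \<beta>0(1) by blast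
  next
    assume anti: "strict_antimono_on {a..b} \<theta>0"
    show ?thesis
    proof (rule that[of "reversepath \<beta>0" "\<lambda>x. 1 - \<theta>0 x"])
      show "strict_mono_on {a..b} (\<lambda>x. 1 - \<theta>0 x)"
        using anti by (auto simp: monotone_on_def)
      show "1 - \<theta>0 x \<in> {0<..<1}" if "x \<in> {a..b}" for x using \<theta>0(1)[OF that] by auto
      show "reversepath \<beta>0 (1 - \<theta>0 x) = \<gamma> x" if "x \<in> {a..b}" for x
        using \<theta>0(2)[OF that] by (simp add: reversepath_def)
    qed (use \<beta>0(1) \<theta>0c in \<open>auto simp: arc_reversepath intro!: continuous_intros\<close>)
  qed
  \<comment> \<open>\<open>c\<close> clamps to \<open>{a..b}\<close>. The linear pieces of \<Theta>
    get the slopes \<open>\<theta> a\<close> and \<open>1 - \<theta> b\<close>, so that the added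
    unit intervals end exactly at 0 and 1.\<close>
  define c where "c x = max a (min b x)" for x
  define \<Theta> where "\<Theta> x = \<theta> (c x) + min (x - a) 0 * \<theta> a + max (x - b) 0 * (1 - \<theta> b)" for x
  have cab: "c x \<in> {a..b}" for x using \<gamma>(1) by (auto simp: c_def)
  have c_mono: "c x \<le> c y" if "x \<le> y" for x y using that by (auto simp: c_def)
  have c_id: "c x = x" if "x \<in> {a..b}" for x using that by (auto simp: c_def)
  have \<theta>ab: "0 < \<theta> a" "\<theta> b < 1" using \<theta>(2)[of a] \<theta>(2)[of b] \<gamma>(1) by auto
  have \<theta>_le: "\<theta> x \<le> \<theta> y" if "x \<in> {a..b}" "y \<in> {a..b}" "x \<le> y" for x y
    using \<theta>(4) that unfolding monotone_on_def by (metis less_eq_real_def)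
  have \<Theta>c: "continuous_on A \<Theta>" for A
  proof -
    have "continuous_on A c" unfolding c_def by (intro continuous_intros)
    then have "continuous_on A (\<lambda>x. \<theta> (c x))"
      by (rule continuous_on_compose2[OF \<theta>(1)]) (use cab in blast)
    then show ?thesis unfolding \<Theta>_def by (intro continuous_intros)
  qed
  have \<Theta>_mono: "\<Theta> x < \<Theta> y" if xy: "x < y" for x y
  proof -
    have le: "\<theta> (c x) \<le> \<theta> (c y)" using \<theta>_le[OF cab cab c_mono] xy by simp
    have le1: "min (x - a) 0 * \<theta> a \<le> min (y - a) 0 * \<theta> a"
      using xy \<theta>ab by (intro mult_right_mono) auto
    have le2: "max (x - b) 0 * (1 - \<theta> b) \<le> max (y - b) 0 * (1 - \<theta> b)"
      using xy \<theta>ab by (intro mult_right_mono) auto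
    consider "x < a" | "y > b" | "x \<in> {a..b}" "y \<in> {a..b}" using xy by force
    then show ?thesis
    proof cases
      case 1
      then have "min (x - a) 0 * \<theta> a < min (y - a) 0 * \<theta> a"
        using xy \<theta>ab by (intro mult_strict_right_mono) auto
      then show ?thesis using le le2 by (simp add: \<Theta>_def)
    next
      case 2
      then have "max (x - b) 0 * (1 - \<theta> b) < max (y - b) 0 * (1 - \<theta> b)"
        using xy \<theta>ab by (intro mult_strict_right_mono) auto
      then show ?thesis using le le1 by (simp add: \<Theta>_def)
    next
      case 3
      then have "\<theta> (c x) < \<theta> (c y)" using \<theta>(4) xy c_id unfolding monotone_on_def by metis
      then show ?thesis using le1 le2 by (simp add: \<Theta>_def)
    qed
  qed
  have ends: "\<Theta> (a - 1) = 0" "\<Theta> (b + 1) = 1"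
    using \<gamma>(1) by (auto simp: \<Theta>_def c_def)
  have \<Theta>_le: "\<Theta> x \<le> \<Theta> y" if "x \<le> y" for x y using \<Theta>_mono[of x y] that by (cases "x = y") auto
  have \<Theta>im: "\<Theta> ` {a-1..b+1} = {0..1}"
  proof
    show "\<Theta> ` {a-1..b+1} \<subseteq> {0..1}" using \<Theta>_le ends by (metis atLeastAtMost_iff image_subsetI)
    show "{0..1} \<subseteq> \<Theta> ` {a-1..b+1}"
    proof
      fix y :: real assume "y \<in> {0..1}"
      then obtain x where "a - 1 \<le> x" "x \<le> b + 1" "\<Theta> x = y"
        using IVT'[of \<Theta> "a - 1" y "b + 1"] ends \<gamma>(1) \<Theta>c by auto
      then show "y \<in> \<Theta> ` {a-1..b+1}" by auto
    qed
  qed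
  have \<beta>c: "continuous_on {0..1} \<beta>" "inj_on \<beta> {0..1}" using \<beta> by (auto simp: arc_def path_def)
  have img: "(\<beta> \<circ> \<Theta>) ` {a-1..b+1} = path_image \<beta>0"
    unfolding image_comp[symmetric] \<Theta>im using \<beta>(2) by (simp add: path_image_def)
  show ?thesis
  proof (rule that[of "\<beta> \<circ> \<Theta>"])
    show "continuous_on {a-1..b+1} (\<beta> \<circ> \<Theta>)"
      by (intro continuous_on_compose \<Theta>c) (simp add: \<Theta>im \<beta>c)
    have "inj_on \<Theta> {a-1..b+1}" by (rule inj_onI) (metis \<Theta>_mono less_irrefl linorder_neqE_linordered_idom)
    then show "inj_on (\<beta> \<circ> \<Theta>) {a-1..b+1}"
      by (rule comp_inj_on) (simp add: \<Theta>im \<beta>c)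
    show "(\<beta> \<circ> \<Theta>) ` {a-1..b+1} \<subseteq> C" using img \<beta>0(2) by simp
    show "(\<beta> \<circ> \<Theta>) x = \<gamma> x" if "x \<in> {a..b}" for x
      using that \<theta>(3)[OF that] c_id[OF that] by (auto simp: \<Theta>_def)
    show "path_image v \<subseteq> (\<beta> \<circ> \<Theta>) ` {a-1..b+1}" using img vg2 \<beta>0(3) sub01 by blast
  qed
qed

text \<open>If there is no loop, countably many chart arcs cover \<open>C\<close>, and swallowing
  them one after another gives compatible injective parametrizations on growing intervals.\<close>

theorem curve_like_classification:
  fixes C :: "'a::euclidean_space set"
  assumes C: "curve_like C" "connected C" "C \<noteq> {}"
  obtains g where "simple_path g" "pathfinish g = pathstart g" "path_image g = C"
  | \<gamma> :: "real \<Rightarrow> 'a" where "continuous_on UNIV \<gamma>" "inj \<gamma>" "range \<gamma> = C"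
proof (cases "\<exists>g. simple_path g \<and> pathfinish g = pathstart g \<and> path_image g = C")
  case True
  then show ?thesis using that(1) by blast
next
  case noloop: False
  define \<F> where "\<F> = {\<kappa> ` {0<..<1} |\<kappa>. arc \<kappa> \<and> path_image \<kappa> \<subseteq> C
    \<and> openin (top_of_set C) (\<kappa> ` {0<..<1})}"
  have "openin (top_of_set C) S" if "S \<in> \<F>" for S using that by (auto simp: \<F>_def)
  then obtain \<F>' where \<F>': "\<F>' \<subseteq> \<F>" "countable \<F>'" "\<Union>\<F>' = \<Union>\<F>" using Lindelof_openin[of \<F> C] by metis
  have cover: "C \<subseteq> \<Union>\<F>"
  proof
    fix p assume "p \<in> C"
    then obtain \<kappa> where \<kappa>: "arc \<kappa>" "\<kappa> (1/2) = p" "path_image \<kappa> \<subseteq> C"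
      "openin (top_of_set C) (\<kappa> ` {0<..<1})"
      using C(1) unfolding curve_like_def by blast
    then have "p \<in> \<kappa> ` {0<..<1}" by auto
    then show "p \<in> \<Union>\<F>" using \<kappa> unfolding \<F>_def by blast
  qed
  then have "\<F>' \<noteq> {}" using \<F>'(3) C(3) by (metis Sup_empty subset_empty)
  have "\<exists>v. arc v \<and> path_image v \<subseteq> C \<and> from_nat_into \<F>' n = v ` {0<..<1}" for n
    using from_nat_into[OF \<open>\<F>' \<noteq> {}\<close>, of n] \<F>'(1) unfolding \<F>_def by blast
  then obtain V where V: "\<And>n. arc (V n)" "\<And>n. path_image (V n) \<subseteq> C"
    "\<And>n. from_nat_into \<F>' n = V n ` {0<..<1}"
    by metis
  have VC: "C \<subseteq> (\<Union>n. path_image (V n))"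
  proof
    fix p assume "p \<in> C"
    then obtain S where S: "S \<in> \<F>'" "p \<in> S" using cover \<F>' by blast
    then obtain n where "S = V n ` {0<..<1}" using from_nat_into_surj[OF \<F>'(2) S(1)] V(3) by metis
    then have "p \<in> path_image (V n)" using S by (auto simp: path_image_def)
    then show "p \<in> (\<Union>n. path_image (V n))" by blast
  qed
  \<comment> \<open>The shift by 1 makes \<open>D 0\<close> nondegenerate, and each
    \<open>D (Suc n)\<close> exceeds \<open>D n\<close> by 1 at both ends.\<close>
  define D where "D n = {- (real n + 1)..real n + 1}" for n
  define P where "P n \<gamma> \<longleftrightarrow> continuous_on (D n) \<gamma> \<and> inj_on \<gamma> (D n) \<and> \<gamma> ` D n \<subseteq> C" for n \<gamma>
  define Q where "Q n \<gamma> \<gamma>' \<longleftrightarrow> (\<forall>x \<in> D n. \<gamma>' x = \<gamma> x) \<and> path_image (V n) \<subseteq> \<gamma>' ` D (Suc n)"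
    for n and \<gamma> \<gamma>' :: "real \<Rightarrow> 'a"
  have "\<exists>f. \<forall>n. P n (f n) \<and> Q n (f n) (f (Suc n))"
  proof (rule dependent_nat_choice)
    let ?f = "V 0 \<circ> (\<lambda>t. (t + 1) / 2)"
    have im: "(\<lambda>t. (t + 1) / 2) ` D 0 \<subseteq> {0..1}" by (auto simp: D_def)
    have V0: "continuous_on {0..1} (V 0)" "inj_on (V 0) {0..1}" using V(1)[of 0] by
      (auto simp: arc_def path_def)
    have "continuous_on (D 0) ?f"
      by (intro continuous_on_compose continuous_intros continuous_on_subset[OF V0(1)] im) auto
    moreover have "inj_on ?f (D 0)"
      by (intro comp_inj_on inj_on_subset[OF V0(2)] im) (auto simp: inj_on_def)
    moreover have "?f ` D 0 \<subseteq> C" using im V(2)[of 0] unfolding path_image_def image_comp[symmetric]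
      by blast
    ultimately show "\<exists>f. P 0 f" unfolding P_def by blast
  next
    fix \<gamma> n assume "P n \<gamma>"
    then have \<gamma>: "continuous_on {- (real n + 1)..real n + 1} \<gamma>"
      "inj_on \<gamma> {- (real n + 1)..real n + 1}"
      "\<gamma> ` {- (real n + 1)..real n + 1} \<subseteq> C" unfolding P_def D_def by auto
    have D: "D (Suc n) = {- (real n + 1) - 1..real n + 1 + 1}" by (simp add: D_def)
    obtain \<gamma>' where "continuous_on (D (Suc n)) \<gamma>'" "inj_on \<gamma>' (D (Suc n))" "\<gamma>' ` D (Suc n) \<subseteq> C"
      "\<And>x. x \<in> {- (real n + 1)..real n + 1} \<Longrightarrow> \<gamma>' x = \<gamma> x" "path_image (V n) \<subseteq> \<gamma>' ` D (Suc n)"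
      unfolding D using curve_like_extend_parametrization[OF C(1,2) noloop _ \<gamma> V(1,2)[of n]] by auto
    then show "\<exists>\<gamma>'. P (Suc n) \<gamma>' \<and> Q n \<gamma> \<gamma>'" unfolding P_def Q_def by (auto simp: D_def)
  qed
  then obtain f where f: "\<And>n. P n (f n)" "\<And>n. Q n (f n) (f (Suc n))" by blast
  have agree: "f (n + k) x = f n x" if "x \<in> D n" for n k x
  proof (induction k)
    case (Suc k)
    have "x \<in> D (n + k)" using that by (auto simp: D_def)
    then show ?case using f(2)[of "n + k"] Suc unfolding Q_def by simp
  qed simp
  \<comment> \<open>Every \<open>n\<close> with \<open>x\<close> in \<open>D n\<close> gives the
    same value; the ceiling merely picks one.\<close>
  define \<gamma> where "\<gamma> x = f (nat \<lceil>\<bar>x\<bar>\<rceil>) x" for x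
  have \<gamma>f: "\<gamma> x = f n x" if x: "x \<in> D n" for n x
  proof -
    have x': "x \<in> D (nat \<lceil>\<bar>x\<bar>\<rceil>)" unfolding D_def by (simp add: abs_le_iff) linarith
    show ?thesis
    proof (cases "n \<le> nat \<lceil>\<bar>x\<bar>\<rceil>")
      case True
      then show ?thesis using agree[OF x, of "nat \<lceil>\<bar>x\<bar>\<rceil> - n"] by (simp add: \<gamma>_def)
    next
      case False
      then have "nat \<lceil>\<bar>x\<bar>\<rceil> + (n - nat \<lceil>\<bar>x\<bar>\<rceil>) = n" by (metis le_add_diff_inverse nat_le_linear)
      then show ?thesis using agree[OF x', of "n - nat \<lceil>\<bar>x\<bar>\<rceil>"] by (simp only: \<gamma>_def)
    qed
  qed
  have exD: "\<exists>n. x \<in> D n \<and> y \<in> D n" for x y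
  proof -
    obtain n where "max \<bar>x\<bar> \<bar>y\<bar> < real n" using reals_Archimedean2 by blast
    then show ?thesis by (intro exI[of _ n]) (auto simp: D_def)
  qed
  have "isCont \<gamma> x" for x
  proof -
    obtain n where n: "\<bar>x\<bar> < real n" using reals_Archimedean2 by blast
    have "continuous_on (D n) \<gamma>"
      using f(1)[of n] \<gamma>f unfolding P_def by (metis (no_types, lifting) continuous_on_cong)
    then have "continuous_on {- (real n + 1)<..<real n + 1} \<gamma>" by (rule continuous_on_subset)
      (auto simp: D_def)
    moreover have "x \<in> {- (real n + 1)<..<real n + 1}" using n by (auto simp: abs_less_iff)
    ultimately show ?thesis by (metis continuous_on_eq_continuous_at open_greaterThanLessThan)
  qed
  then have "continuous_on UNIV \<gamma>" by (simp add: continuous_at_imp_continuous_on)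
  moreover have "inj \<gamma>"
  proof (rule injI)
    fix x y assume xy: "\<gamma> x = \<gamma> y"
    obtain n where n: "x \<in> D n" "y \<in> D n" using exD by blast
    then show "x = y" using xy \<gamma>f f(1)[of n] unfolding P_def inj_on_def by metis
  qed
  moreover have "range \<gamma> = C"
  proof
    show "range \<gamma> \<subseteq> C"
    proof
      fix y assume "y \<in> range \<gamma>"
      then obtain x where "y = \<gamma> x" by blast
      moreover obtain n where "x \<in> D n" using exD by blast
      ultimately show "y \<in> C" using \<gamma>f f(1)[of n] unfolding P_def by auto
    qed
    show "C \<subseteq> range \<gamma>"
    proof
      fix y assume "y \<in> C"
      then obtain n where "y \<in> path_image (V n)" using VC by blast
      then obtain x where "x \<in> D (Suc n)" "y = f (Suc n) x" using f(2)[of n] unfolding Q_def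
        by blast
      then show "y \<in> range \<gamma>" using \<gamma>f by (metis rangeI)
    qed
  qed
  ultimately show ?thesis using that(2) by blast
qed

section \<open>Jordan curves on the sphere\<close>

text \<open>A Moebius map with infinity sent to 0. At \<open>Some c\<close> the value is
  \<open>inverse 0 = 0\<close> as well, so injectivity and continuity are only claimed away from
  \<open>Some c\<close>.\<close>

definition sphere_chart :: "complex \<Rightarrow> complex option \<Rightarrow> complex" where
  "sphere_chart c x = (case x of None \<Rightarrow> 0 | Some z \<Rightarrow> inverse (z - c))"

lemma sphere_chart_simps [simp]:
  "sphere_chart c None = 0" "sphere_chart c (Some z) = inverse (z - c)"
  by (simp_all add: sphere_chart_def)

lemma topspace_riemann_sphere [simp]: "topspace riemann_sphere = UNIV"
  by (simp add: riemann_sphere_def UNIV_option_conv)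

lemma inj_on_sphere_chart: "inj_on (sphere_chart c) (- {Some c})"
  by (auto simp: inj_on_def sphere_chart_def split: option.splits)

text \<open>Only an open set containing 0 involves infinity. The complement of its preimage is then
  bounded, because \<open>norm (z - c) > 1 / e\<close> forces \<open>inverse (z - c)\<close> into
  the ball of radius \<open>e\<close>.\<close>

lemma continuous_map_sphere_chart:
  "continuous_map (subtopology riemann_sphere (- {Some c})) euclidean (sphere_chart c)"
proof -
  have "openin riemann_sphere {x. x \<noteq> Some c \<and> sphere_chart c x \<in> T}" if "open T" for T
  proof -
    let ?I = "\<lambda>z. inverse (z - c)"
    have op: "open {z. z \<noteq> c \<and> ?I z \<in> T}"
    proof -
      have "open ((- {c}) \<inter> ?I -` T)"
        using that by (intro continuous_open_preimage continuous_intros) auto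
      moreover have "(- {c}) \<inter> ?I -` T = {z. z \<noteq> c \<and> ?I z \<in> T}" by auto
      ultimately show ?thesis by simp
    qed
    show ?thesis
    proof (cases "0 \<in> T")
      case False
      have *: "x \<noteq> Some c \<and> sphere_chart c x \<in> T \<longleftrightarrow> x \<in> Some ` {z. z \<noteq> c \<and> ?I z \<in> T}" for x
        using False by (cases x) auto
      have **: "{x. x \<noteq> Some c \<and> sphere_chart c x \<in> T} = Some ` {z. z \<noteq> c \<and> ?I z \<in> T}"
        by (rule set_eqI) (simp only: mem_Collect_eq *)
      show ?thesis
        unfolding ** riemann_sphere_def openin_Alexandroff_compactification_image_Some
        using op by (simp only: open_openin)
    next
      case True
      then obtain e where e: "e > 0" "ball 0 e \<subseteq> T" using \<open>open T\<close> openE by blast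
      define K where "K = - {z. z \<noteq> c \<and> ?I z \<in> T}"
      have "K \<subseteq> cball c (1 / e)"
      proof
        fix z assume "z \<in> K"
        then have "z = c \<or> ?I z \<notin> ball 0 e" using e(2) unfolding K_def by blast
        then show "z \<in> cball c (1 / e)"
        proof
          assume "?I z \<notin> ball 0 e"
          then have "e \<le> inverse (norm (z - c))" by (simp add: norm_inverse)
          then have "norm (z - c) \<le> 1 / e"
            using e(1) by (cases "z = c") (auto simp: field_simps)
          then show ?thesis by (simp add: dist_norm norm_minus_commute)
        qed (use e(1) in simp)
      qed
      then have "compact K" using op by
        (auto simp: compact_eq_bounded_closed K_def closed_Compl intro: bounded_subset)
      moreover have "{x. x \<noteq> Some c \<and> sphere_chart c x \<in> T} = insert None (Some ` (UNIV - K))"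
      proof -
        have *: "x \<noteq> Some c \<and> sphere_chart c x \<in> T \<longleftrightarrow> x \<in> insert None (Some ` (UNIV - K))" for x
          using True by (cases x) (auto simp: K_def)
        show ?thesis by (rule set_eqI) (simp only: mem_Collect_eq *)
      qed
      ultimately show ?thesis
        unfolding riemann_sphere_def openin_Alexandroff_compactification
        by (intro disjI2 exI[of _ K]) (auto simp: compact_imp_closed)
    qed
  qed
  then have *: "openin (subtopology riemann_sphere (- {Some c})) {x \<in> topspace (subtopology riemann_sphere (- {Some c})). sphere_chart c x \<in> T}"
    if "open T" for T
    using that unfolding openin_subtopology
    by (intro exI[of _ "{x. x \<noteq> Some c \<and> sphere_chart c x \<in> T}"]) auto
  show ?thesis
    unfolding continuous_map_def
  proof (intro conjI allI impI)
    fix T :: "complex set" assume "openin euclidean T"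
    then show "openin (subtopology riemann_sphere (- {Some c})) {x \<in> topspace (subtopology riemann_sphere (- {Some c})). sphere_chart c x \<in> T}"
      using * by (simp only: open_openin)
  qed simp
qed

text \<open>A closed subset of the sphere is compact and the plane is Hausdorff, so a continuous
  injection suffices.\<close>

lemma homeomorphic_map_sphere_chart:
  assumes J: "closedin riemann_sphere J" "Some c \<notin> J"
  shows "homeomorphic_map (subtopology riemann_sphere J) (top_of_set (sphere_chart c ` J)) (sphere_chart c)"
proof (rule continuous_imp_homeomorphic_map)
  have sub: "J \<subseteq> - {Some c}" using J(2) by auto
  have "continuous_map (subtopology (subtopology riemann_sphere (- {Some c})) J) euclidean (sphere_chart c)"
    by (rule continuous_map_from_subtopology[OF continuous_map_sphere_chart])
  then show "continuous_map (subtopology riemann_sphere J) (top_of_set (sphere_chart c ` J)) (sphere_chart c)"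
    using sub by (auto simp: continuous_map_in_subtopology subtopology_subtopology Int_absorb1)
  show "compact_space (subtopology riemann_sphere J)"
    using closedin_compact_space[of riemann_sphere J] J(1)
    by (simp add: riemann_sphere_def compact_space_subtopology)
  show "inj_on (sphere_chart c) (topspace (subtopology riemann_sphere J))"
    using sub by (auto intro: inj_on_subset[OF inj_on_sphere_chart])
qed (auto simp: Hausdorff_space_subtopology)

lemma homeomorphic_space_iff_homeomorphic:
  "top_of_set S homeomorphic_space top_of_set T \<longleftrightarrow> S homeomorphic T"
proof -
  have "homeomorphic_maps (top_of_set S) (top_of_set T) f g \<longleftrightarrow> homeomorphism S T f g" for f g
    by (force simp: Pi_iff homeomorphic_maps_def homeomorphism_def)
  then show ?thesis by (simp only: homeomorphic_space_def homeomorphic_def)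
qed

lemma jordan_curve_iff_chart:
  assumes J: "closedin riemann_sphere J" "Some c \<notin> J"
  shows "jordan_curve J \<longleftrightarrow> sphere_chart c ` J homeomorphic sphere (0::complex) 1"
proof -
  have "subtopology riemann_sphere J homeomorphic_space top_of_set (sphere_chart c ` J)"
    using homeomorphic_map_sphere_chart[OF J] homeomorphic_map_imp_homeomorphic_space by blast
  then have "jordan_curve J \<longleftrightarrow> top_of_set (sphere_chart c ` J) homeomorphic_space top_of_set (sphere (0::complex) 1)"
    unfolding jordan_curve_def by (meson homeomorphic_space_sym homeomorphic_space_trans)
  then show ?thesis by (simp only: homeomorphic_space_iff_homeomorphic)
qed

lemma closedin_riemann_sphere_insert: "closed C \<Longrightarrow> closedin riemann_sphere (insert None (Some ` C))"
proof -
  assume "closed C"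
  then have "openin riemann_sphere (Some ` (- C))" by (simp add: riemann_sphere_def open_Compl)
  moreover have "x \<in> UNIV - insert None (Some ` C) \<longleftrightarrow> x \<in> Some ` (- C)" for x by (cases x) auto
  then have "UNIV - insert None (Some ` C) = Some ` (- C)" by (rule set_eqI)
  ultimately show ?thesis unfolding closedin_def topspace_riemann_sphere by simp
qed

lemma closedin_riemann_sphere_compact: "compact C \<Longrightarrow> closedin riemann_sphere (Some ` C)"
  unfolding riemann_sphere_def closedin_Alexandroff_compactification
  by (intro disjI1 exI[of _ C]) (auto simp: compact_imp_closed)

lemma sphere_closure_compact: "compact C \<Longrightarrow> sphere_closure C = Some ` C"
  unfolding sphere_closure_def by (rule closure_of_closedin[OF closedin_riemann_sphere_compact])

lemma sphere_closure_subset: "closed C \<Longrightarrow> sphere_closure C \<subseteq> insert None (Some ` C)"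
  unfolding sphere_closure_def by (rule closure_of_minimal[OF _ closedin_riemann_sphere_insert]) auto

lemma sphere_closure_superset: "Some ` C \<subseteq> sphere_closure C"
  unfolding sphere_closure_def by (rule closure_of_subset) simp

lemma closedin_sphere_closure: "closedin riemann_sphere (sphere_closure C)"
  unfolding sphere_closure_def by simp

lemma sphere_closure_unbounded:
  assumes "closed C" "\<not> bounded C"
  shows "sphere_closure C = insert None (Some ` C)"
proof -
  have "None \<in> sphere_closure C"
    unfolding sphere_closure_def in_closure_of
  proof (intro conjI allI impI)
    fix T assume T: "None \<in> T \<and> openin riemann_sphere T"
    \<comment> \<open>A neighbourhood of infinity is the complement of a compact set, which cannot
      contain the unbounded \<open>C\<close>.\<close>
    then obtain K where K: "compact K" "T = insert None (Some ` (UNIV - K))"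
      by (auto simp: riemann_sphere_def openin_Alexandroff_compactification)
    then have "\<not> C \<subseteq> K" using assms(2) bounded_subset compact_imp_bounded by blast
    then show "\<exists>y. y \<in> Some ` C \<and> y \<in> T" using K(2) by blast
  qed simp
  then show ?thesis
    using sphere_closure_subset[OF assms(1)] sphere_closure_superset[of C]
    by (intro equalityI insert_subsetI)
qed

text \<open>The real line is placed on the circle by stereographic projection from \<open>1\<close>.\<close>

lemma line_with_point_homeomorphic_circle:
  fixes G :: "real \<Rightarrow> complex"
  assumes G: "continuous_on UNIV G" "inj G" "0 \<notin> range G"
    and lim: "\<And>e. e > 0 \<Longrightarrow> \<exists>n. \<forall>x. \<bar>x\<bar> > n \<longrightarrow> norm (G x) < e"
  shows "insert 0 (range G) homeomorphic sphere (0::complex) 1"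
proof -
  define s where "s w = Im w / (1 - Re w)" for w :: complex
  define F where "F w = (if w = 1 then 0 else G (s w))" for w
  have Re1: "Re w < 1" if "w \<in> sphere 0 1" "w \<noteq> 1" for w
  proof -
    have "Re w \<le> 1" using that complex_Re_le_cmod[of w] by simp
    moreover have "Re w \<noteq> 1"
    proof
      assume r: "Re w = 1"
      have "(Re w)\<^sup>2 + (Im w)\<^sup>2 = 1" using that cmod_power2[of w] by simp
      then show False using r that by (auto simp: complex_eq_iff)
    qed
    ultimately show ?thesis by simp
  qed
  \<comment> \<open>The first identity turns closeness of \<open>w\<close> to 1 into a large
    \<open>s w\<close>; the second gives injectivity of \<open>s\<close>.\<close>
  have ssq: "(s w)\<^sup>2 + 1 = 4 / (norm (w - 1))\<^sup>2" "(s w)\<^sup>2 * (1 - Re w) = 1 + Re w"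
    if w: "w \<in> sphere 0 1" "w \<noteq> 1" for w
  proof -
    have i: "(Im w)\<^sup>2 = 1 - (Re w)\<^sup>2" using w cmod_power2[of w] by simp
    have n: "(norm (w - 1))\<^sup>2 = 2 * (1 - Re w)"
      unfolding cmod_power2 using i by (simp add: power2_eq_square algebra_simps)
    have s: "(s w)\<^sup>2 = (1 + Re w) / (1 - Re w)"
    proof -
      have "(Im w)\<^sup>2 = (1 + Re w) * (1 - Re w)" using i by
        (simp add: power2_eq_square algebra_simps)
      then show ?thesis using Re1[OF w] by (simp add: s_def power_divide power2_eq_square)
    qed
    show "(s w)\<^sup>2 * (1 - Re w) = 1 + Re w" using Re1[OF w] s by simp
    show "(s w)\<^sup>2 + 1 = 4 / (norm (w - 1))\<^sup>2" unfolding s n using Re1[OF w] by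
      (simp add: field_simps)
  qed
  have sinj: "w = w'" if w: "w \<in> sphere 0 1" "w \<noteq> 1" and w': "w' \<in> sphere 0 1"
    "w' \<noteq> 1" and eq: "s w = s w'" for w w'
  proof -
    have "(1 + Re w) = (s w)\<^sup>2 * (1 - Re w)" "(1 + Re w') = (s w)\<^sup>2 * (1 - Re w')"
      using ssq(2)[OF w] ssq(2)[OF w'] eq by simp_all
    then have "(Re w - Re w') * (1 + (s w)\<^sup>2) = 0" by (simp add: algebra_simps)
    moreover have "1 + (s w)\<^sup>2 > 0" by (simp add: add_pos_nonneg)
    ultimately have re: "Re w = Re w'" by simp
    have "Im w = s w * (1 - Re w)" "Im w' = s w' * (1 - Re w')"
      using Re1[OF w] Re1[OF w'] by (simp_all add: s_def)
    then show ?thesis using re eq by (simp add: complex_eq_iff)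
  qed
  have ssurj: "\<exists>w\<in>sphere 0 1. w \<noteq> 1 \<and> s w = x" for x
  proof -
    have pos: "x\<^sup>2 + 1 > 0" by (simp add: add_nonneg_pos)
    \<comment> \<open>The inverse stereographic projection of \<open>x\<close>.\<close>
    define w where "w = Complex ((x\<^sup>2 - 1) / (x\<^sup>2 + 1)) (2 * x / (x\<^sup>2 + 1))"
    have "(norm w)\<^sup>2 = ((x\<^sup>2 - 1)\<^sup>2 + (2 * x)\<^sup>2) / (x\<^sup>2 + 1)\<^sup>2"
      unfolding cmod_power2 w_def by (simp add: power_divide add_divide_distrib)
    also have "(x\<^sup>2 - 1)\<^sup>2 + (2 * x)\<^sup>2 = (x\<^sup>2 + 1)\<^sup>2" by (simp add: power2_eq_square algebra_simps)
    finally have "(norm w)\<^sup>2 = 1" using pos by simp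
    then have "norm w = 1" by (simp add: power2_eq_1_iff) (metis norm_ge_zero not_one_le_zero neg_0_le_iff_le)
    moreover have r: "1 - Re w = 2 / (x\<^sup>2 + 1)" using pos by (simp add: w_def field_simps)
    moreover have "s w = x" unfolding s_def r using pos by (simp add: w_def)
    ultimately show ?thesis using pos by (intro bexI[of _ w]) auto
  qed
  have cont: "continuous (at w within sphere 0 1) F" if w: "w \<in> sphere 0 1" for w
  proof (cases "w = 1")
    case True
    show ?thesis unfolding continuous_within_eps_delta
    proof (intro allI impI)
      fix e :: real assume "e > 0"
      then obtain n where n: "\<And>x. \<bar>x\<bar> > n \<Longrightarrow> norm (G x) < e" using lim by blast
      \<comment> \<open>\<open>N\<close> is positive so that squares can be compared, and
        \<open>d\<close> is the distance from 1 at which the modulus of \<open>s\<close> equals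
        \<open>N\<close>.\<close>
      define N where "N = max n 1"
      define d where "d = sqrt (4 / (N\<^sup>2 + 1))"
      have N: "N\<^sup>2 + 1 > 0" "N \<ge> n" "N > 0" by (auto simp: N_def add_nonneg_pos)
      have "d > 0" using N by (simp add: d_def)
      have "dist (F x) (F w) < e" if x: "x \<in> sphere 0 1" "dist x w < d" for x
      proof (cases "x = 1")
        case False
        have "(norm (x - 1))\<^sup>2 < d\<^sup>2" using x(2) True \<open>d > 0\<close> by (intro power_strict_mono)
          (auto simp: dist_norm)
        then have "(norm (x - 1))\<^sup>2 < 4 / (N\<^sup>2 + 1)" using N by (simp add: d_def)
        moreover have "(norm (x - 1))\<^sup>2 > 0" using False by simp
        ultimately have "N\<^sup>2 + 1 < 4 / (norm (x - 1))\<^sup>2" using N by (simp add: field_simps)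
        then have "N\<^sup>2 < (s x)\<^sup>2" using ssq(1)[OF x(1) False] by simp
        then have "N < \<bar>s x\<bar>" using N by (metis abs_le_square_iff abs_of_pos not_le)
        then show ?thesis using n[of "s x"] N False True by (simp add: F_def)
      qed (use True \<open>e > 0\<close> in simp)
      then show "\<exists>d>0. \<forall>x'\<in>sphere 0 1. dist x' w < d \<longrightarrow> dist (F x') (F w) < e"
        using \<open>d > 0\<close> by blast
    qed
  next
    case False
    have "isCont s w" unfolding s_def using Re1[OF w False] by (intro continuous_intros) auto
    moreover have "isCont G (s w)" using G(1) by (simp add: continuous_on_eq_continuous_at)
    ultimately have "isCont (\<lambda>w. G (s w)) w" by (rule isCont_o2)
    then have "isCont F w"
    proof (rule isCont_cong[THEN iffD1, rotated])
      have "eventually (\<lambda>x. x \<in> - {1}) (nhds w)" using False by (intro eventually_nhds_in_open) auto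
      then show "eventually (\<lambda>x. G (s x) = F x) (nhds w)" by eventually_elim (auto simp: F_def)
    qed
    then show ?thesis using continuous_at_imp_continuous_within by blast
  qed
  have "\<exists>h. homeomorphism (sphere 0 1) (insert 0 (range G)) F h"
  proof (rule homeomorphism_compact)
    show "continuous_on (sphere 0 1) F" using cont by (simp add: continuous_on_eq_continuous_within)
    show "F ` sphere 0 1 = insert 0 (range G)"
    proof
      show "F ` sphere 0 1 \<subseteq> insert 0 (range G)" by (auto simp: F_def)
      have "0 \<in> F ` sphere 0 1" by (rule image_eqI[of _ _ 1]) (auto simp: F_def)
      moreover have "G x \<in> F ` sphere 0 1" for x
        using ssurj[of x] by (metis F_def imageI)
      ultimately show "insert 0 (range G) \<subseteq> F ` sphere 0 1" by blast
    qed
    show "inj_on F (sphere 0 1)"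
    proof (rule inj_onI)
      fix w w' assume w: "w \<in> sphere 0 1" "w' \<in> sphere 0 1" "F w = F w'"
      have "G x \<noteq> 0" for x using G(3) by (metis rangeI)
      then show "w = w'"
        using w sinj[of w w'] injD[OF G(2)] by (metis F_def)
    qed
  qed simp
  then show ?thesis using homeomorphic_def homeomorphic_sym by metis
qed

text \<open>If the line returned to a bounded set at arbitrarily large parameters, it would
  accumulate at some \<open>\<gamma> t\<close>, as \<open>C\<close> is closed. The image of
  \<open>ball t 1\<close> is a relative neighbourhood of this point, so by injectivity those
  parameters would lie within 1 of \<open>t\<close>.\<close>

lemma curve_like_line_proper:
  fixes \<gamma> :: "real \<Rightarrow> 'a::euclidean_space"
  assumes C: "curve_like C" "closed C" and \<gamma>: "continuous_on UNIV \<gamma>" "inj \<gamma>" "range \<gamma> = C"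
  shows "\<exists>n. \<forall>x. \<bar>x\<bar> > n \<longrightarrow> norm (\<gamma> x) > R"
proof (rule ccontr)
  assume "\<not> ?thesis"
  then have "\<forall>n::nat. \<exists>x. \<bar>x\<bar> > real n \<and> norm (\<gamma> x) \<le> R" by (meson not_le)
  then obtain x where x: "\<And>n::nat. \<bar>x n\<bar> > real n" "\<And>n. norm (\<gamma> (x n)) \<le> R" by metis
  have "compact (C \<inter> cball 0 R)" using C(2) by (simp add: closed_Int_compact)
  moreover have "\<forall>n. \<gamma> (x n) \<in> C \<inter> cball 0 R" using x \<gamma>(3) by auto
  ultimately obtain y r where yr: "y \<in> C \<inter> cball 0 R" "strict_mono r" "((\<lambda>n. \<gamma> (x n)) \<circ> r) \<longlonglongrightarrow> y"
    unfolding compact_def by meson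
  then obtain t where t: "y = \<gamma> t" using \<gamma>(3) by blast
  have "openin (top_of_set C) (\<gamma> ` ball t 1)"
    by (rule curve_like_image_open[OF C(1)])
      (use \<gamma> in \<open>auto intro: continuous_on_subset inj_on_subset\<close>)
  then obtain T where T: "open T" "\<gamma> ` ball t 1 = C \<inter> T" by (auto simp: openin_open)
  have "y \<in> \<gamma> ` ball t 1" using t by simp
  then have "eventually (\<lambda>n. \<gamma> (x (r n)) \<in> T) sequentially"
    using topological_tendstoD[OF yr(3) T(1)] T(2) by (simp add: o_def)
  moreover obtain N :: nat where "\<bar>t\<bar> + 1 < real N" using reals_Archimedean2 by blast
  ultimately obtain n where n: "\<gamma> (x (r n)) \<in> T" "n \<ge> N"
    unfolding eventually_sequentially by (metis max.cobounded1 max.cobounded2)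
  have "\<gamma> (x (r n)) \<in> \<gamma> ` ball t 1" using n(1) T(2) \<gamma>(3) by blast
  then have "x (r n) \<in> ball t 1" using \<gamma>(2) by (simp add: inj_image_mem_iff)
  moreover have "real N \<le> real (r n)" using n(2) seq_suble[OF yr(2), of n] by simp
  ultimately show False using x(1)[of "r n"] \<open>\<bar>t\<bar> + 1 < real N\<close> by (auto simp: dist_real_def)
qed

text \<open>The chart with pole \<open>c\<close> reduces both cases of the classification to plane
  sets; infinity becomes the point 0 added to the image of a line.\<close>

lemma jordan_curve_sphere_closure_curve_like:
  fixes C :: "complex set"
  assumes C: "curve_like C" "connected C" "closed C" "C \<noteq> {}" and c: "c \<notin> C"
  shows "jordan_curve (sphere_closure C)"
proof -
  have cJ: "Some c \<notin> sphere_closure C" using sphere_closure_subset[OF C(3)] c by auto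
  have injI: "inj_on (\<lambda>z. inverse (z - c)) C" using c by (auto simp: inj_on_def)
  have contI: "continuous_on C (\<lambda>z. inverse (z - c))" using c by (intro continuous_intros) auto
  have "sphere_chart c ` sphere_closure C homeomorphic sphere (0::complex) 1"
    using C(1,2,4)
  proof (cases rule: curve_like_classification)
    case (1 g)
    then have "compact C" by (metis compact_simple_path_image)
    then have "sphere_chart c ` sphere_closure C = (\<lambda>z. inverse (z - c)) ` C"
      by (simp add: sphere_closure_compact image_image)
    moreover have "C homeomorphic (\<lambda>z. inverse (z - c)) ` C"
      using homeomorphism_compact[OF \<open>compact C\<close> contI refl injI] homeomorphic_def by blast
    moreover have "C homeomorphic sphere (0::complex) 1"
      using homeomorphic_simple_path_image_circle[of g 1 0] 1 by simp
    ultimately show ?thesis by (metis homeomorphic_sym homeomorphic_trans)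
  next
    case (2 \<gamma>)
    note proper = curve_like_line_proper[OF C(1,3) 2]
    have "\<not> bounded C"
    proof
      assume "bounded C"
      then obtain R where R: "\<And>z. z \<in> C \<Longrightarrow> norm z \<le> R" by (auto simp: bounded_iff)
      obtain n where "\<forall>x. \<bar>x\<bar> > n \<longrightarrow> norm (\<gamma> x) > R" using proper by blast
      then have "norm (\<gamma> (\<bar>n\<bar> + 1)) > R" by simp
      then show False using R[of "\<gamma> (\<bar>n\<bar> + 1)"] 2(3) by auto
    qed
    then have "sphere_chart c ` sphere_closure C = insert 0 (range (\<lambda>x. inverse (\<gamma> x - c)))"
      using C(3) 2(3) by (auto simp: sphere_closure_unbounded image_image)
    also have "\<dots> homeomorphic sphere (0::complex) 1"
    proof (rule line_with_point_homeomorphic_circle)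
      have \<gamma>c: "\<gamma> x \<noteq> c" for x using c 2(3) by blast
      show "continuous_on UNIV (\<lambda>x. inverse (\<gamma> x - c))"
        using 2(1) \<gamma>c by (intro continuous_intros) auto
      show "inj (\<lambda>x. inverse (\<gamma> x - c))" using 2(2) by (auto simp: inj_on_def)
      show "0 \<notin> range (\<lambda>x. inverse (\<gamma> x - c))" using \<gamma>c by (auto simp: image_iff)
      fix e :: real assume "e > 0"
      \<comment> \<open>Beyond norm \<open>norm c + 1 / e\<close> the distance to \<open>c\<close>
        exceeds \<open>1 / e\<close>.\<close>
      obtain n where n: "\<forall>x. \<bar>x\<bar> > n \<longrightarrow> norm (\<gamma> x) > norm c + 1 / e" using proper by blast
      have "norm (inverse (\<gamma> x - c)) < e" if "\<bar>x\<bar> > n" for x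
      proof -
        have "norm (\<gamma> x - c) > 1 / e" using n that norm_triangle_ineq2[of "\<gamma> x" c] by force
        moreover from this have "norm (\<gamma> x - c) > 0" using \<open>e > 0\<close>
          by (meson divide_pos_pos less_trans zero_less_one)
        ultimately show ?thesis
          using \<open>e > 0\<close> unfolding norm_inverse
          by (simp only: inverse_eq_divide pos_divide_less_eq mult.commute)
      qed
      then show "\<exists>n. \<forall>x. \<bar>x\<bar> > n \<longrightarrow> norm (inverse (\<gamma> x - c)) < e" by blast
    qed
    finally show ?thesis .
  qed
  then show ?thesis by (simp only: jordan_curve_iff_chart[OF closedin_sphere_closure cJ])
qed

section \<open>Boundary components of planar domains\<close>

lemma embedding_map_cballD:
  fixes \<tau> :: "complex \<Rightarrow> complex"
  assumes "embedding_map (top_of_set (cball 0 1)) (top_of_set S) \<tau>"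
  shows "continuous_on (cball 0 1) \<tau>" "inj_on \<tau> (cball 0 1)" "\<tau> ` cball 0 1 \<subseteq> S"
proof -
  have "continuous_map (top_of_set (cball 0 1)) (top_of_set S) \<tau>"
    using assms unfolding embedding_map_def
    by (metis continuous_map_in_subtopology homeomorphic_imp_continuous_map)
  then show "continuous_on (cball 0 1) \<tau>" "\<tau> ` cball 0 1 \<subseteq> S" by auto
  show "inj_on \<tau> (cball 0 1)"
    using assms unfolding embedding_map_def by (auto dest: homeomorphic_imp_injective_map)
qed

text \<open>All points of \<Omega> near \<open>p\<close> come from the open disc, and injectivity of
  \<tau> keeps them apart from the image of the circle. A short arc of the circle about the preimage
  of \<open>p\<close> therefore supplies the chart.\<close>

lemma curve_like_boundary_component:
  assumes \<Omega>: "open \<Omega>" "condition1 \<Omega>" and C: "C \<in> components (frontier \<Omega>)"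
  shows "curve_like C"
  unfolding curve_like_def
proof
  fix p assume "p \<in> C"
  then have p: "p \<in> frontier \<Omega>" using C in_components_subset by blast
  then have p\<Omega>: "p \<notin> \<Omega>" "p \<in> closure \<Omega>" using \<Omega>(1) by (auto simp: frontier_def interior_open)
  from bspec[OF \<Omega>(2)[unfolded condition1_def] p]
  obtain \<tau> :: "complex \<Rightarrow> complex" where all: "embedding_map (top_of_set (cball 0 1)) (top_of_set (closure \<Omega>)) \<tau> \<and>
      \<tau> ` ball 0 1 \<subseteq> \<Omega> \<and>
      (\<forall>z. (\<forall>n. z n \<in> \<Omega>) \<and> z \<longlonglongrightarrow> p \<longrightarrow> (\<forall>\<^sub>F n in sequentially. z n \<in> \<tau> ` ball 0 1))"
    by (rule exE)
  note em = conjunct1[OF all] and \<tau>\<Omega> = conjunct1[OF conjunct2[OF all]]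
    and ev = conjunct2[OF conjunct2[OF all]]
  note \<tau> = embedding_map_cballD[OF em]
  \<comment> \<open>Otherwise points of \<Omega> off the image, at distances from \<open>p\<close>
    tending to 0, would violate the condition on sequences.\<close>
  have "\<exists>r>0. \<Omega> \<inter> ball p r \<subseteq> \<tau> ` ball 0 1"
  proof (rule ccontr)
    assume "\<not> ?thesis"
    then have neg: "\<not> \<Omega> \<inter> ball p r \<subseteq> \<tau> ` ball 0 1" if "r > 0" for r using that by blast
    have "\<exists>z. z \<in> \<Omega> \<and> dist p z < inverse (real (Suc n)) \<and> z \<notin> \<tau> ` ball 0 1" for n
      using neg[of "inverse (real (Suc n))"] unfolding subset_iff Int_iff mem_ball by fastforce
    then obtain z where z: "\<And>n::nat. z n \<in> \<Omega>" "\<And>n. dist p (z n) < inverse (real (Suc n))"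
      "\<And>n. z n \<notin> \<tau> ` ball 0 1"
      by metis
    have "(\<lambda>n. dist (z n) p) \<longlonglongrightarrow> 0"
    proof (rule real_tendsto_sandwich[OF _ _ tendsto_const LIMSEQ_inverse_real_of_nat])
      show "eventually (\<lambda>n. dist (z n) p \<le> inverse (real (Suc n))) sequentially"
        using z(2) by (intro always_eventually allI less_imp_le) (simp add: dist_commute)
    qed simp
    then have "z \<longlonglongrightarrow> p" by (simp add: tendsto_dist_iff[symmetric])
    then have "\<forall>\<^sub>F n in sequentially. z n \<in> \<tau> ` ball 0 1" using ev z(1) by blast
    then show False using z(3) by simp
  qed
  then obtain r where r: "r > 0" "\<Omega> \<inter> ball p r \<subseteq> \<tau> ` ball 0 1" by blast
  have front: "frontier \<Omega> \<inter> ball p r = \<tau> ` sphere 0 1 \<inter> ball p r"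
  proof (intro equalityI subsetI)
    fix x assume x: "x \<in> frontier \<Omega> \<inter> ball p r"
    have "closed (\<tau> ` cball 0 1)" using \<tau>(1) by
      (simp add: compact_imp_closed compact_continuous_image)
    moreover have "\<Omega> \<inter> ball p r \<subseteq> \<tau> ` cball 0 1" using r(2) by force
    ultimately have "closure (\<Omega> \<inter> ball p r) \<subseteq> \<tau> ` cball 0 1" by (simp add: closure_minimal)
    moreover have "x \<in> closure (\<Omega> \<inter> ball p r)"
      using open_Int_closure_subset[of "ball p r" \<Omega>] x by (auto simp: frontier_def Int_commute)
    ultimately obtain w where w: "w \<in> cball 0 1" "x = \<tau> w" by blast
    have "x \<notin> \<Omega>" using x \<Omega>(1) by (auto simp: frontier_def interior_open)
    then have "w \<notin> ball 0 1" using \<tau>\<Omega> w by blast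
    then show "x \<in> \<tau> ` sphere 0 1 \<inter> ball p r" using w x by auto
  next
    fix x assume x: "x \<in> \<tau> ` sphere 0 1 \<inter> ball p r"
    then obtain w where w: "w \<in> sphere 0 1" "x = \<tau> w" by blast
    have "x \<notin> \<Omega>"
    proof
      assume "x \<in> \<Omega>"
      then obtain w' where w': "w' \<in> ball 0 1" "x = \<tau> w'" using r(2) x by blast
      then have "w = w'" using \<tau>(2) w by (auto simp: inj_on_def)
      then show False using w w' by auto
    qed
    moreover have "x \<in> closure \<Omega>" using \<tau>(3) w by auto
    ultimately show "x \<in> frontier \<Omega> \<inter> ball p r" using \<Omega>(1) x by
      (auto simp: frontier_def interior_open)
  qed
  obtain \<zeta> where \<zeta>: "norm \<zeta> = 1" "p = \<tau> \<zeta>" using front p r(1) by force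
  obtain \<delta> where \<delta>: "\<delta> > 0" "\<And>x. \<lbrakk>x \<in> cball 0 1; dist x \<zeta> < \<delta>\<rbrakk> \<Longrightarrow> dist (\<tau> x) p < r"
  proof -
    have "\<zeta> \<in> cball 0 1" using \<zeta> by simp
    then show ?thesis using \<tau>(1) \<zeta>(2) r(1) that unfolding continuous_on_iff by blast
  qed
  \<comment> \<open>\<open>s \<le> \<delta>\<close> keeps the arc in \<open>ball p r\<close>, and
    \<open>s \<le> 1\<close> makes it shorter than a full turn.\<close>
  define s where "s = min 1 \<delta>"
  have s: "0 < s" "s \<le> 1" "s \<le> \<delta>" using \<delta> by (auto simp: s_def)
  \<comment> \<open>The circle at angular speed \<open>s\<close>, passing through \<zeta> at the
    parameter 1/2.\<close>
  define e where "e \<theta> = \<zeta> * cis (s * (\<theta> - 1/2))" for \<theta>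
  have e1: "norm (e \<theta>) = 1" for \<theta> using \<zeta> by (simp add: e_def norm_mult)
  have e_half: "e (1/2) = \<zeta>" by (simp add: e_def)
  have e_eq: "\<theta> = \<theta>'" if "e \<theta> = e \<theta>'" "s * \<bar>\<theta> - \<theta>'\<bar> < 2 * pi" for \<theta> \<theta>'
  proof -
    have "cis (s * (\<theta> - 1/2)) = cis (s * (\<theta>' - 1/2))" using that(1) \<zeta> by (auto simp: e_def)
    then have "sin ((s * (\<theta> - 1/2) - s * (\<theta>' - 1/2)) / 2) = 0"
      using norm_cis_diff[of "s * (\<theta> - 1/2)" "s * (\<theta>' - 1/2)"] by simp
    then have "sin (s * (\<theta> - \<theta>') / 2) = 0" by (simp add: algebra_simps)
    moreover have "\<bar>s * (\<theta> - \<theta>')\<bar> < 2 * pi" using that(2) s by (simp add: abs_mult)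
    then have "- pi < s * (\<theta> - \<theta>') / 2" "s * (\<theta> - \<theta>') / 2 < pi" by linarith+
    ultimately have "s * (\<theta> - \<theta>') / 2 = 0" using sin_eq_0_pi by blast
    then show ?thesis using s by simp
  qed
  have ce: "continuous_on A e" for A unfolding e_def by (intro continuous_intros)
  define \<kappa> where "\<kappa> = \<tau> \<circ> e"
  have "arc \<kappa>" unfolding arc_def path_def
  proof
    show "continuous_on {0..1} \<kappa>" unfolding \<kappa>_def
      by (intro continuous_on_compose ce continuous_on_subset[OF \<tau>(1)]) (auto simp: e1)
    show "inj_on \<kappa> {0..1}" unfolding \<kappa>_def
    proof (rule comp_inj_on)
      show "inj_on e {0..1}"
      proof (rule inj_onI)
        fix x y :: real assume xy: "x \<in> {0..1}" "y \<in> {0..1}" "e x = e y"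
        have "s * \<bar>x - y\<bar> \<le> 1 * 1" using s xy by (intro mult_mono) auto
        then show "x = y" using e_eq[OF xy(3)] pi_gt3 by simp
      qed
      show "inj_on \<tau> (e ` {0..1})" by (rule inj_on_subset[OF \<tau>(2)]) (auto simp: e1)
    qed
  qed
  have \<kappa>r: "\<kappa> x \<in> \<tau> ` sphere 0 1 \<inter> ball p r" if "x \<in> {0..1}" for x
  proof -
    have "dist (e x) \<zeta> = norm (cis (s * (x - 1/2)) - cis 0)"
    proof -
      have "e x - \<zeta> = \<zeta> * (cis (s * (x - 1/2)) - cis 0)" by (simp add: e_def algebra_simps)
      then show ?thesis using \<zeta> by (simp only: dist_norm norm_mult mult_1)
    qed
    also have "\<dots> \<le> \<bar>s * (x - 1/2)\<bar>" using norm_cis_diff_le[of "s * (x - 1/2)" 0] by simp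
    also have "\<dots> = s * \<bar>x - 1/2\<bar>" using s by (simp add: abs_mult)
    also have "\<dots> \<le> s * (1/2)"
    proof (rule mult_left_mono)
      show "\<bar>x - 1/2\<bar> \<le> 1/2" using that unfolding atLeastAtMost_iff by linarith
    qed (use s in simp)
    also have "\<dots> < \<delta>" using s by simp
    finally have "dist (\<tau> (e x)) p < r" using \<delta>(2)[of "e x"] e1 by simp
    then show ?thesis using e1 by (auto simp: \<kappa>_def dist_commute)
  qed
  have \<kappa>_half: "\<kappa> (1/2) = p" using \<zeta> by (simp add: \<kappa>_def e_half)
  have \<kappa>C: "path_image \<kappa> \<subseteq> C"
  proof (rule components_maximal[OF C])
    show "connected (path_image \<kappa>)" using \<open>arc \<kappa>\<close> by (simp add: connected_arc_image)
    show "path_image \<kappa> \<subseteq> frontier \<Omega>" using \<kappa>r front unfolding path_image_def by blast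
    have "p \<in> path_image \<kappa>" unfolding path_image_def using \<kappa>_half
      by (intro image_eqI[of _ _ "1/2"]) auto
    then show "C \<inter> path_image \<kappa> \<noteq> {}" using \<open>p \<in> C\<close> by blast
  qed
  \<comment> \<open>The rest of the circle with both ends of the arc: \<open>e\<close> has period
    \<open>2 * pi / s\<close>, so the parameters from 1 onwards return to \<open>e 0\<close>.
    Removing this compact image leaves exactly the open arc.\<close>
  define B where "B = \<tau> ` e ` {1..2 * pi / s}"
  have "compact B" unfolding B_def
    by (intro compact_continuous_image ce continuous_on_subset[OF \<tau>(1)]) (auto simp: e1)
  have eq: "\<kappa> ` {0<..<1} = C \<inter> (ball p r - B)"
  proof (intro equalityI subsetI)
    fix y assume "y \<in> \<kappa> ` {0<..<1}"
    then obtain x where x: "x \<in> {0<..<1}" "y = \<kappa> x" by blast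
    have "y \<in> C" using x \<kappa>C by (auto simp: path_image_def)
    moreover have "y \<in> ball p r" using \<kappa>r[of x] x by auto
    moreover have "y \<notin> B"
    proof
      assume "y \<in> B"
      then obtain x' where x': "1 \<le> x'" "x' \<le> 2 * pi / s" "y = \<tau> (e x')" by (auto simp: B_def)
      then have "e x = e x'" using \<tau>(2) x(2) e1 by (auto simp: \<kappa>_def inj_on_def)
      moreover have "s * \<bar>x - x'\<bar> < s * (2 * pi / s)" using s x x'
        by (intro mult_strict_left_mono) auto
      ultimately have "x = x'" using e_eq s by simp
      then show False using x x' by simp
    qed
    ultimately show "y \<in> C \<inter> (ball p r - B)" by blast
  next
    fix y assume y: "y \<in> C \<inter> (ball p r - B)"
    then have "y \<in> frontier \<Omega> \<inter> ball p r" using C in_components_subset by blast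
    then obtain w where w: "norm w = 1" "y = \<tau> w" using front by auto
    have "norm (w / e 0) = 1" using w e1 by (simp add: norm_divide)
    then obtain t where t: "0 \<le> t" "t < 2 * pi" "w / e 0 = cis t"
      using Arg2pi[of "w / e 0"] by (auto simp: cis_conv_exp is_Arg_def)
    have "e 0 \<noteq> 0" using e1[of 0] by auto
    then have "w = e 0 * cis t" using t(3) by (simp add: field_simps)
    have e_div: "e (x / s) = e 0 * cis x" for x
    proof -
      have "s * (x / s - 1/2) = s * (0 - 1/2) + x" using s by (simp add: field_simps)
      then show ?thesis by (simp only: e_def mult.assoc cis_mult)
    qed
    then have w_e: "w = e (t / s)" using \<open>w = e 0 * cis t\<close> by simp
    \<comment> \<open>The end point \<open>e 0\<close> belongs to \<open>B\<close> through its
      parameter after a full turn.\<close>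
    have w_e2: "w = e (2 * pi / s)" if "t = 0"
      using that \<open>w = e 0 * cis t\<close> e_div[of "2 * pi"] by simp
    have "2 * pi / s \<ge> 1" using s pi_gt3 by (simp add: field_simps)
    have "t / s \<in> {0<..<1}"
    proof (rule ccontr)
      assume "t / s \<notin> {0<..<1}"
      then consider "t = 0" | "t / s \<ge> 1" using t(1) s(1) by (cases "t = 0") auto
      then have "w \<in> e ` {1..2 * pi / s}"
      proof cases
        case 1
        then show ?thesis using w_e2 \<open>2 * pi / s \<ge> 1\<close> by (intro image_eqI[of _ _ "2 * pi / s"]) auto
      next
        case 2
        then show ?thesis using w_e t s by (intro image_eqI[of _ _ "t / s"])
          (auto intro: divide_right_mono)
      qed
      then show False using y w by (auto simp: B_def)
    qed
    then show "y \<in> \<kappa> ` {0<..<1}" using w w_e by (auto simp: \<kappa>_def)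
  qed
  have "openin (top_of_set C) (\<kappa> ` {0<..<1})"
    unfolding eq using \<open>compact B\<close> by (intro openin_open_Int open_Diff)
      (auto simp: compact_imp_closed)
  then show "\<exists>\<kappa>. arc \<kappa> \<and> \<kappa> (1/2) = p \<and> path_image \<kappa> \<subseteq> C \<and> openin (top_of_set C) (\<kappa> ` {0<..<1})"
    using \<open>arc \<kappa>\<close> \<kappa>_half \<kappa>C by blast
qed

section \<open>From Jordan curves back to Condition 1\<close>

text \<open>
  The half disc is the Caratheodory image of a lens, a compact convex neighbourhood of a boundary point
  in the closed unit disc.
\<close>

lemma Jordan_domain_half_disc:
  fixes g :: "real \<Rightarrow> complex"
  assumes g: "simple_path g" "pathfinish g = pathstart g" and q: "q \<in> path_image g" and "\<epsilon> > 0"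
  obtains \<sigma> :: "complex \<Rightarrow> complex" and \<delta> where "continuous_on (cball 0 1) \<sigma>" "inj_on \<sigma> (cball 0 1)"
    "\<sigma> ` cball 0 1 \<subseteq> ball q \<epsilon>" "\<sigma> ` ball 0 1 \<subseteq> inside (path_image g)"
    "\<delta> > 0" "inside (path_image g) \<inter> ball q \<delta> \<subseteq> \<sigma> ` ball 0 1"
proof -
  define U where "U = inside (path_image g)"
  have U: "open U" "bounded U" "frontier U = path_image g"
    using Jordan_inside_outside[OF g] by (auto simp: U_def)
  have qU: "q \<in> closure U" "q \<notin> U" using q U by (auto simp: frontier_def interior_open)
  obtain \<Phi> :: "complex \<Rightarrow> complex" where \<Phi>: "continuous_on (closure U) \<Phi>" "inj_on \<Phi> (closure U)"
    "\<Phi> ` closure U = cball 0 1" "\<Phi> ` U = ball 0 1"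
    using Caratheodory_Jordan_domain[OF g] unfolding U_def by blast
  obtain G where G: "homeomorphism (closure U) (cball 0 1) \<Phi> G"
    using homeomorphism_compact[OF _ \<Phi>(1,3,2)] U(2) by (auto simp: compact_closure)
  have G': "continuous_on (cball 0 1) G" "\<And>z. z \<in> closure U \<Longrightarrow> G (\<Phi> z) = z" "\<And>w. w \<in> cball 0 1
    \<Longrightarrow> \<Phi> (G w) = w"
    using G by (auto simp: homeomorphism_def)
  define a where "a = \<Phi> q"
  have a: "a \<in> cball 0 1" "G a = q" using \<Phi>(3) qU G'(2) by (auto simp: a_def)
  obtain \<rho> where \<rho>: "\<rho> > 0" "\<And>w. \<lbrakk>w \<in> cball 0 1; dist w a < \<rho>\<rbrakk> \<Longrightarrow> dist (G w) q < \<epsilon>"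
    using G'(1) a \<open>\<epsilon> > 0\<close> unfolding continuous_on_iff by metis
  define N where "N = cball 0 1 \<inter> cball a (\<rho>/2)"
  have N: "convex N" "compact N" unfolding N_def by (auto simp: convex_Int compact_Int)
  have intN: "interior N = ball 0 1 \<inter> ball a (\<rho>/2)" by (simp add: N_def)
  have "a \<in> closure (ball 0 1)" using a by simp
  then obtain w where "w \<in> ball 0 1" "dist w a < \<rho>/2" using \<rho>(1)
    by (meson closure_approachable half_gt_zero)
  then have "interior N \<noteq> {}" unfolding intN by (auto simp: dist_commute)
  then have "cball (0::complex) 1 homeomorphic N"
    using homeomorphic_convex_compact_cball[OF N, of 1 0] homeomorphic_sym by (metis zero_less_one)
  then obtain k k' where k: "homeomorphism (cball (0::complex) 1) N k k'" unfolding homeomorphic_def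
    by blast
  have kk: "continuous_on (cball 0 1) k" "inj_on k (cball 0 1)" "k ` cball 0 1 = N"
    "continuous_on N k'" "inj_on k' N" "k' ` N = cball 0 1" "\<And>y. y \<in> N \<Longrightarrow> k (k' y) = y"
    using k unfolding homeomorphism_def by (auto intro: inj_on_inverseI)
  \<comment> \<open>Invariance of domain, applied to \<open>k\<close> and to its inverse, identifies
    the interiors.\<close>
  have kball: "k ` ball 0 1 = interior N"
  proof
    have "open (k ` ball 0 1)"
      using kk(1,2) ball_subset_cball by (intro invariance_of_domain)
        (auto intro: continuous_on_subset inj_on_subset)
    moreover have "k ` ball 0 1 \<subseteq> N" using kk(3) by force
    ultimately show "k ` ball 0 1 \<subseteq> interior N" by (rule interior_maximal[rotated])
    have "open (k' ` interior N)"
      using kk(4,5) interior_subset by (intro invariance_of_domain)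
        (auto intro: continuous_on_subset inj_on_subset)
    moreover have "k' ` interior N \<subseteq> cball 0 1" using kk(6) interior_subset by blast
    ultimately have "k' ` interior N \<subseteq> ball 0 1" by (metis interior_cball interior_maximal)
    show "interior N \<subseteq> k ` ball 0 1"
    proof
      fix y assume y: "y \<in> interior N"
      then have "k' y \<in> ball 0 1" using \<open>k' ` interior N \<subseteq> ball 0 1\<close> by (meson image_subset_iff)
      moreover have "y = k (k' y)" using kk(7) y interior_subset by (metis subsetD)
      ultimately show "y \<in> k ` ball 0 1" by blast
    qed
  qed
  obtain \<delta> where \<delta>: "\<delta> > 0" "\<And>z. \<lbrakk>z \<in> closure U; dist z q < \<delta>\<rbrakk> \<Longrightarrow> dist (\<Phi> z) a < \<rho>/2"
    using \<Phi>(1) qU \<rho>(1) unfolding continuous_on_iff a_def by (metis half_gt_zero)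
  have GU: "G w \<in> U" if "w \<in> ball 0 1" for w
  proof -
    have "w \<in> \<Phi> ` U" using \<Phi>(4) that by simp
    then obtain u where "u \<in> U" "w = \<Phi> u" by blast
    then show ?thesis using G'(2)[of u] closure_subset[of U] by auto
  qed
  have sub: "k x \<in> N" if "x \<in> cball 0 1" for x using kk(3) that by blast
  show ?thesis
  proof (rule that[of "G \<circ> k" \<delta>])
    show "continuous_on (cball 0 1) (G \<circ> k)"
      using sub by (intro continuous_on_compose kk(1) continuous_on_subset[OF G'(1)])
        (auto simp: N_def)
    show "inj_on (G \<circ> k) (cball 0 1)"
    proof (rule comp_inj_on[OF kk(2)])
      show "inj_on G (k ` cball 0 1)"
        using G'(3) unfolding kk(3) N_def inj_on_def by (metis IntD1)
    qed
    show "(G \<circ> k) ` cball 0 1 \<subseteq> ball q \<epsilon>"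
    proof
      fix y assume "y \<in> (G \<circ> k) ` cball 0 1"
      then obtain x where x: "x \<in> cball 0 1" "y = G (k x)" by auto
      have "k x \<in> cball 0 1" "dist (k x) a < \<rho>" using sub[OF x(1)] \<rho>(1) by
        (auto simp: N_def dist_commute)
      then show "y \<in> ball q \<epsilon>" using \<rho>(2) x by (auto simp: dist_commute)
    qed
    show "(G \<circ> k) ` ball 0 1 \<subseteq> inside (path_image g)"
      unfolding image_comp[symmetric] kball intN using GU by (auto simp: U_def)
    show "inside (path_image g) \<inter> ball q \<delta> \<subseteq> (G \<circ> k) ` ball 0 1"
    proof
      fix z assume z: "z \<in> inside (path_image g) \<inter> ball q \<delta>"
      then have zU: "z \<in> U" "z \<in> closure U" using closure_subset by (auto simp: U_def)
      have "\<Phi> z \<in> interior N"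
        using \<Phi>(4) zU \<delta>(2)[OF zU(2)] z unfolding intN by (auto simp: dist_commute)
      then have "G (\<Phi> z) \<in> G ` k ` ball 0 1" using kball by blast
      then show "z \<in> (G \<circ> k) ` ball 0 1" using G'(2)[OF zU(2)] by (simp add: image_comp)
    qed
  qed (use \<delta> in auto)
qed

text \<open>Points near the pole \<open>d\<close> become unbounded, so the punctured inside goes to
  the outside of the image curve. If the outside went there too, the inside of the image curve could
  contain no point but 0, the image of infinity; yet it is open and nonempty.\<close>

lemma inversion_outside_subset_inside:
  fixes g :: "real \<Rightarrow> complex"
  assumes g: "simple_path g" "pathfinish g = pathstart g" and d: "d \<in> inside (path_image g)"
  defines "m \<equiv> \<lambda>w. inverse (w - d)"
  shows "simple_path (m \<circ> g)" "pathfinish (m \<circ> g) = pathstart (m \<circ> g)"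
    "m ` outside (path_image g) \<subseteq> inside (path_image (m \<circ> g))"
proof -
  let ?J = "path_image g" and ?K = "path_image (m \<circ> g)"
  note J = Jordan_inside_outside[OF g]
  have dJ: "d \<notin> ?J" using d inside_no_overlap by blast
  have cont: "continuous_on A m" if "d \<notin> A" for A
    unfolding m_def using that by (intro continuous_intros) auto
  have minj: "m x = m y \<longleftrightarrow> x = y" for x y by (simp add: m_def)
  show sm: "simple_path (m \<circ> g)"
    using g dJ cont by (intro simple_path_continuous_image) (auto simp: inj_on_def minj)
  show lm: "pathfinish (m \<circ> g) = pathstart (m \<circ> g)"
    using g by (simp add: pathstart_compose pathfinish_compose)
  note K = Jordan_inside_outside[OF sm lm]
  have Kim: "?K = m ` ?J" by (simp add: path_image_compose)
  have "inj m" by (simp add: inj_def minj)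
  then have mK: "m w \<notin> ?K" if "w \<notin> ?J" for w using that by (simp add: Kim inj_image_mem_iff)
  have dich: "m ` A \<subseteq> outside ?K" if A: "connected A" "d \<notin> A" "A \<inter> ?J = {}" "m w \<in> outside ?K"
    "w \<in> A" for A w
  proof -
    have "connected (m ` A)" using A cont by (intro connected_continuous_image) auto
    moreover have "m ` A \<inter> ?K = {}" using A(3) mK by blast
    ultimately show ?thesis
      using connected_Int_frontier[of "m ` A" "outside ?K"] A(4,5) K by blast
  qed
  have d_out: "d \<notin> outside ?J" using d inside_Int_outside by blast
  have out: "m ` outside ?J \<subseteq> outside ?K" if "w \<in> outside ?J" "m w \<in> outside ?K" for w
    using dich[of "outside ?J" w] J d_out that outside_no_overlap[of ?J] by blast
  obtain e where e: "e > 0" "cball d e \<subseteq> inside ?J" using J d open_contains_cball by metis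
  have ins: "m ` (inside ?J - {d}) \<subseteq> outside ?K"
  proof (rule ccontr)
    assume neg: "\<not> ?thesis"
    have con: "connected (inside ?J - {d})" using J by (intro connected_open_delete) auto
    have "m w \<notin> outside ?K" if "w \<in> inside ?J - {d}" for w
    proof
      assume "m w \<in> outside ?K"
      from dich[OF con _ _ this that] inside_no_overlap[of ?J] neg show False by blast
    qed
    moreover have "m w \<notin> ?K" if "w \<in> inside ?J - {d}" for w
      by (rule mK) (use that inside_no_overlap[of ?J] in blast)
    ultimately have sub: "m ` (inside ?J - {d}) \<subseteq> inside ?K"
      using inside_Un_outside[of ?K] by (metis ComplI UnE image_subsetI)
    have "bounded (inside ?K)" using K by blast
    then obtain B where B: "\<And>z. z \<in> inside ?K \<Longrightarrow> norm z \<le> B" unfolding bounded_iff by blast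
    \<comment> \<open>Close enough to the pole that the image has norm \<open>inverse t\<close>,
      which exceeds the bound \<open>B\<close>.\<close>
    define t where "t = min e (inverse (\<bar>B\<bar> + 1))"
    have t: "0 < t" "t \<le> e" "t \<le> inverse (\<bar>B\<bar> + 1)" using e by (auto simp: t_def)
    have "d + of_real t \<in> inside ?J - {d}" using e t by
      (auto simp: dist_norm intro!: subsetD[OF e(2)])
    then have "norm (m (d + of_real t)) \<le> B" by (intro B subsetD[OF sub] imageI)
    moreover have "norm (m (d + of_real t)) = inverse t" using t by (simp add: m_def norm_inverse)
    moreover have "inverse t \<ge> \<bar>B\<bar> + 1" using t by (metis inverse_inverse_eq le_imp_inverse_le)
    ultimately show False by linarith
  qed
  show "m ` outside ?J \<subseteq> inside ?K"
  proof (rule ccontr)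
    assume "\<not> ?thesis"
    then obtain w where w: "w \<in> outside ?J" "m w \<notin> inside ?K" by blast
    then have "m w \<in> outside ?K"
      using mK[of w] outside_no_overlap[of ?J] inside_Un_outside[of ?K] by blast
    then have o: "m ` outside ?J \<subseteq> outside ?K" using out w by blast
    have "inside ?K \<subseteq> {0}"
    proof
      fix v assume v: "v \<in> inside ?K"
      show "v \<in> {0}"
      proof (rule ccontr)
        assume "v \<notin> {0}"
        define u where "u = d + inverse v"
        have u: "v = m u" "u \<noteq> d" using \<open>v \<notin> {0}\<close> by (auto simp: u_def m_def)
        have "u \<notin> ?J" using v u(1) inside_no_overlap[of ?K] unfolding Kim by blast
        then have "v \<in> outside ?K" using o ins u inside_Un_outside[of ?J] by blast
        then show False using v inside_Int_outside by blast
      qed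
    qed
    then show False using K by (metis not_open_singleton subset_singletonD)
  qed
qed

lemma simple_loop_of_homeomorphic_circle:
  fixes S :: "'a::real_normed_vector set"
  assumes "S homeomorphic sphere (0::complex) 1"
  obtains g where "simple_path g" "pathfinish g = pathstart g" "path_image g = S"
proof -
  obtain h k where h: "homeomorphism (sphere (0::complex) 1) S h k"
    using assms homeomorphic_sym unfolding homeomorphic_def by blast
  have hh: "continuous_on (sphere 0 1) h" "inj_on h (sphere 0 1)" "h ` sphere 0 1 = S"
    using h unfolding homeomorphism_def by (auto intro: inj_on_inverseI)
  have "simple_path (h \<circ> circlepath 0 1)"
    using hh by (intro simple_path_continuous_image) (auto simp: simple_path_circlepath)
  then show ?thesis
    using that[of "h \<circ> circlepath 0 1"] hh(3)
    by (simp add: pathstart_compose pathfinish_compose path_image_compose)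
qed

text \<open>\<open>T\<close> is the inversion with pole \<open>c0\<close> followed by one with pole
  \<open>d\<close> inside the image curve. It places \<Omega> without \<open>c0\<close> inside a
  Jordan curve through \<open>T p\<close>, and a half disc at \<open>T p\<close> is pulled back by
  the inverse map \<open>S\<close>. Relative openness of \<open>C\<close> permits one so small that
  it meets no other part of the boundary.\<close>

lemma boundary_point_half_disc:
  assumes \<Omega>: "open \<Omega>" "connected \<Omega>" and c0: "c0 \<in> \<Omega>"
    and C: "closed C" "C \<subseteq> frontier \<Omega>" "openin (top_of_set (frontier \<Omega>)) C"
      "jordan_curve (sphere_closure C)"
    and p: "p \<in> C"
  shows "\<exists>\<tau> :: complex \<Rightarrow> complex. embedding_map (top_of_set (cball 0 1)) (top_of_set (closure \<Omega>)) \<tau> \<and>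
    \<tau> ` ball 0 1 \<subseteq> \<Omega> \<and>
    (\<forall>z. (\<forall>n. z n \<in> \<Omega>) \<and> z \<longlonglongrightarrow> p \<longrightarrow> (\<forall>\<^sub>F n in sequentially. z n \<in> \<tau> ` ball 0 1))"
proof -
  have fr: "frontier \<Omega> \<inter> \<Omega> = {}" using \<Omega>(1) by (auto simp: frontier_def interior_open)
  have c0C: "c0 \<notin> C" and pc0: "p \<noteq> c0" and p\<Omega>: "p \<in> closure \<Omega>"
    using C(2) c0 p fr by (auto simp: frontier_def)
  define J where "J = sphere_closure C"
  have J: "Some ` C \<subseteq> J" "J \<subseteq> insert None (Some ` C)" "closedin riemann_sphere J"
    using sphere_closure_superset sphere_closure_subset[OF C(1)] closedin_sphere_closure by
      (auto simp: J_def)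
  have cJ: "Some c0 \<notin> J" using J(2) c0C by auto
  define \<iota> where "\<iota> z = inverse (z - c0)" for z
  define J0 where "J0 = sphere_chart c0 ` J"
  have "J0 homeomorphic sphere (0::complex) 1"
    using C(4) jordan_curve_iff_chart[OF J(3) cJ] by (simp add: J_def J0_def)
  then obtain g where g: "simple_path g" "pathfinish g = pathstart g" "path_image g = J0"
    by (rule simple_loop_of_homeomorphic_circle)
  have \<iota>J0: "\<iota> z \<in> J0" if "z \<in> C" for z
  proof -
    have "Some z \<in> J" using J(1) that by blast
    then show ?thesis unfolding J0_def by (rule image_eqI[rotated]) (simp add: \<iota>_def)
  qed
  have \<iota>notJ0: "\<iota> z \<notin> J0" if z: "z \<in> \<Omega>" "z \<noteq> c0" for z
  proof
    assume "\<iota> z \<in> J0"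
    then obtain j where j: "j \<in> J" "\<iota> z = sphere_chart c0 j" by (auto simp: J0_def)
    have "\<iota> z = sphere_chart c0 (Some z)" by (simp add: \<iota>_def)
    then have "j = Some z"
      using inj_onD[OF inj_on_sphere_chart, of c0 j "Some z"] j cJ z by auto
    then have "z \<in> C" using j(1) J(2) by auto
    then show False using C(2) fr z by blast
  qed
  note JJ = Jordan_inside_outside[OF g(1,2), unfolded g(3)]
  define \<Omega>0 where "\<Omega>0 = \<Omega> - {c0}"
  have \<Omega>0: "connected \<Omega>0" unfolding \<Omega>0_def using \<Omega> by (intro connected_open_delete) auto
  have \<iota>c: "continuous_on (- {c0}) \<iota>" unfolding \<iota>_def by (intro continuous_intros) auto
  \<comment> \<open>The image of the punctured domain is connected, misses the curve and is
    unbounded near the pole \<open>c0\<close>, so it cannot lie in the inside.\<close>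
  have out: "\<iota> ` \<Omega>0 \<subseteq> outside J0"
  proof (rule ccontr)
    assume neg: "\<not> ?thesis"
    have con: "connected (\<iota> ` \<Omega>0)"
      by (intro connected_continuous_image \<Omega>0 continuous_on_subset[OF \<iota>c]) (auto simp: \<Omega>0_def)
    have dis: "\<iota> ` \<Omega>0 \<inter> J0 = {}" using \<iota>notJ0 by (auto simp: \<Omega>0_def)
    have "\<iota> ` \<Omega>0 \<inter> inside J0 \<noteq> {}" using neg dis inside_Un_outside[of J0] by blast
    then have "\<iota> ` \<Omega>0 \<subseteq> inside J0"
      using connected_Int_frontier[OF con, of "inside J0"] JJ dis by blast
    then have "bounded (\<iota> ` \<Omega>0)" using JJ bounded_subset by blast
    then obtain B where B: "\<And>z. z \<in> \<Omega>0 \<Longrightarrow> norm (\<iota> z) \<le> B" unfolding bounded_iff by blast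
    obtain e where e: "e > 0" "cball c0 e \<subseteq> \<Omega>" using \<Omega>(1) c0 open_contains_cball by blast
    define t where "t = min e (inverse (\<bar>B\<bar> + 1))"
    have t: "0 < t" "t \<le> e" "t \<le> inverse (\<bar>B\<bar> + 1)" using e by (auto simp: t_def)
    have "c0 + of_real t \<in> \<Omega>0" using e t by (auto simp: \<Omega>0_def dist_norm intro!: subsetD[OF e(2)])
    then have "norm (\<iota> (c0 + of_real t)) \<le> B" by (rule B)
    moreover have "norm (\<iota> (c0 + of_real t)) = inverse t" using t by (simp add: \<iota>_def norm_inverse)
    moreover have "inverse t \<ge> \<bar>B\<bar> + 1" using t by (metis inverse_inverse_eq le_imp_inverse_le)
    ultimately show False by linarith
  qed
  obtain d where d: "d \<in> inside J0"
    using JJ by blast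
  define m where "m w = inverse (w - d)" for w
  define G where "G = m \<circ> g"
  have G: "simple_path G" "pathfinish G = pathstart G" "m ` outside J0 \<subseteq> inside (path_image G)"
    using inversion_outside_subset_inside[OF g(1,2), of d] d unfolding g(3) G_def m_def[abs_def]
      by auto
  define U where "U = inside (path_image G)"
  have Gim: "path_image G = m ` J0" by (simp add: G_def path_image_compose g(3))
  define T where "T z = m (\<iota> z)" for z
  have T\<Omega>: "T z \<in> U" if "z \<in> \<Omega>" "z \<noteq> c0" for z
  proof -
    have "\<iota> z \<in> outside J0" using out that by (auto simp: \<Omega>0_def)
    then have "m (\<iota> z) \<in> m ` outside J0" by (rule imageI)
    then show ?thesis using G(3) by (auto simp: T_def U_def)
  qed
  have TC: "T z \<in> path_image G" if "z \<in> C" for z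
    using \<iota>J0[OF that] by (simp add: T_def Gim)
  define q where "q = T p"
  have qG: "q \<in> path_image G" using TC[OF p] by (simp add: q_def)
  have \<iota>pd: "\<iota> p \<noteq> d" using \<iota>J0[OF p] d inside_no_overlap by blast
  define S where "S v = c0 + inverse (d + inverse v)" for v
  \<comment> \<open>On \<open>W\<close> both inverses in \<open>S\<close> have nonzero arguments;
    what is left out are the images of \<open>c0\<close> and of infinity.\<close>
  define W where "W = {v. v \<noteq> 0 \<and> d + inverse v \<noteq> 0}"
  have ST: "S (T z) = z" if "z \<noteq> c0" "\<iota> z \<noteq> d" for z
    using that by (simp add: S_def T_def m_def \<iota>_def)
  have TS: "T (S v) = v" if "v \<in> W" for v
    using that by (simp add: S_def T_def m_def \<iota>_def W_def)
  have dTp: "d + inverse q = \<iota> p" using \<iota>pd by (simp add: q_def T_def m_def)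
  have qW: "q \<in> W"
  proof -
    have "q \<noteq> 0" using \<iota>pd by (simp add: q_def T_def m_def)
    moreover have "\<iota> p \<noteq> 0" using pc0 by (simp add: \<iota>_def)
    ultimately show ?thesis using dTp by (simp add: W_def)
  qed
  have "open ((- {0}) \<inter> (\<lambda>v. d + inverse v) -` (- {0}))"
    by (intro continuous_open_preimage continuous_intros) auto
  moreover have "(- {0}) \<inter> (\<lambda>v. d + inverse v) -` (- {0}) = W" by (auto simp: W_def)
  ultimately have oW: "open W" by simp
  have Sc: "continuous_on W S" unfolding S_def W_def by (intro continuous_intros) auto
  \<comment> \<open>\<open>O'\<close> shuts out the rest of the boundary, and \<epsilon> will keep
    the pulled-back half disc inside it.\<close>
  obtain O' where O': "open O'" "C = frontier \<Omega> \<inter> O'" using C(3) by (auto simp: openin_open)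
  have "open (W \<inter> S -` O')" by (rule continuous_open_preimage[OF Sc oW O'(1)])
  moreover have "q \<in> W \<inter> S -` O'" using qW ST[OF pc0 \<iota>pd] p O'(2) by (auto simp: q_def)
  ultimately obtain \<epsilon> where \<epsilon>: "\<epsilon> > 0" "ball q \<epsilon> \<subseteq> W \<inter> S -` O'" using open_contains_ball by blast
  obtain \<sigma> :: "complex \<Rightarrow> complex" and \<delta> where \<sigma>: "continuous_on (cball 0 1) \<sigma>"
    "inj_on \<sigma> (cball 0 1)"
    "\<sigma> ` cball 0 1 \<subseteq> ball q \<epsilon>" "\<sigma> ` ball 0 1 \<subseteq> U" "\<delta> > 0" "U \<inter> ball q \<delta> \<subseteq> \<sigma> ` ball 0 1"
    using Jordan_domain_half_disc[OF G(1,2) qG \<epsilon>(1)] unfolding U_def by blast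
  define \<tau> where "\<tau> = S \<circ> \<sigma>"
  have \<sigma>W: "\<sigma> x \<in> W" "S (\<sigma> x) \<in> O'" if "x \<in> cball 0 1" for x
  proof -
    have "\<sigma> x \<in> ball q \<epsilon>" using \<sigma>(3) that by blast
    then have "\<sigma> x \<in> W \<inter> S -` O'" using \<epsilon>(2) by blast
    then show "\<sigma> x \<in> W" "S (\<sigma> x) \<in> O'" by auto
  qed
  have \<tau>c: "continuous_on (cball 0 1) \<tau>"
    unfolding \<tau>_def using \<sigma>W by (intro continuous_on_compose \<sigma>(1) continuous_on_subset[OF Sc]) auto
  have \<tau>i: "inj_on \<tau> (cball 0 1)"
  proof (rule inj_onI)
    fix x y assume xy: "x \<in> cball 0 1" "y \<in> cball 0 1" "\<tau> x = \<tau> y"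
    then have "T (S (\<sigma> x)) = T (S (\<sigma> y))" by (simp add: \<tau>_def)
    then have "\<sigma> x = \<sigma> y" using TS \<sigma>W(1) xy by simp
    then show "x = y" using \<sigma>(2) xy by (auto dest: inj_onD)
  qed
  have ev: "\<forall>\<^sub>F n in sequentially. z n \<in> \<tau> ` ball 0 1" if z: "\<forall>n. z n \<in> \<Omega>" "z \<longlonglongrightarrow> p"
    for z :: "nat \<Rightarrow> complex"
  proof -
    have "(\<lambda>n. T (z n)) \<longlonglongrightarrow> T p"
      unfolding T_def m_def \<iota>_def
      by (intro tendsto_intros z(2)) (use pc0 \<iota>pd in \<open>auto simp: \<iota>_def\<close>)
    then have "\<forall>\<^sub>F n in sequentially. dist (T (z n)) q < \<delta>"
      using \<sigma>(5) by (simp add: q_def tendstoD)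
    moreover have "\<forall>\<^sub>F n in sequentially. z n \<noteq> c0"
      using tendsto_imp_eventually_ne[OF z(2) pc0] .
    ultimately show ?thesis
    proof eventually_elim
      case (elim n)
      have zn: "z n \<in> \<Omega>" using z(1) by blast
      have "\<iota> (z n) \<in> outside J0" using out zn elim by (auto simp: \<Omega>0_def)
      then have "\<iota> (z n) \<noteq> d" using d inside_Int_outside[of J0] by blast
      have "T (z n) \<in> U \<inter> ball q \<delta>" using T\<Omega>[OF zn] elim by (simp add: dist_commute)
      then obtain x where x: "x \<in> ball 0 1" "T (z n) = \<sigma> x" using \<sigma>(6) by blast
      then have "\<tau> x = z n" using ST[OF elim(2) \<open>\<iota> (z n) \<noteq> d\<close>] by (simp add: \<tau>_def)
      then show ?case using x(1) by (metis imageI)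
    qed
  qed
  have "\<tau> ` ball 0 1 \<inter> \<Omega> \<noteq> {}"
  proof -
    obtain z where z: "\<forall>n. z n \<in> \<Omega>" "z \<longlonglongrightarrow> p" using p\<Omega> unfolding closure_sequential by blast
    obtain n where "z n \<in> \<tau> ` ball 0 1"
      using eventually_happens'[OF sequentially_bot ev[OF z]] by blast
    then show ?thesis using z(1) by blast
  qed
  \<comment> \<open>A frontier point in the image would lie in \<open>O'\<close>, hence on
    \<open>C\<close>, and \<sigma> would meet the curve itself instead of its inside. Connectedness
    then keeps the image within \<Omega>.\<close>
  moreover have "\<tau> ` ball 0 1 \<inter> frontier \<Omega> = {}"
  proof (rule ccontr)
    assume "\<not> ?thesis"
    then obtain x where x: "x \<in> ball 0 1" "\<tau> x \<in> frontier \<Omega>" by blast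
    then have x': "x \<in> cball 0 1" by simp
    have "\<tau> x \<in> C" using x(2) \<sigma>W(2)[OF x'] O'(2) by (simp add: \<tau>_def)
    then have "\<sigma> x \<in> path_image G" using TC TS[OF \<sigma>W(1)[OF x']] by (metis \<tau>_def comp_apply)
    moreover have "\<sigma> x \<in> U" using \<sigma>(4) x(1) by blast
    ultimately show False using inside_no_overlap[of "path_image G"] unfolding U_def by blast
  qed
  moreover have "connected (\<tau> ` ball 0 1)"
    by (intro connected_continuous_image continuous_on_subset[OF \<tau>c]) auto
  ultimately have \<tau>\<Omega>: "\<tau> ` ball 0 1 \<subseteq> \<Omega>"
    using connected_Int_frontier[of "\<tau> ` ball 0 1" \<Omega>] by blast
  have "\<tau> ` closure (ball 0 1) \<subseteq> closure \<Omega>"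
    by (rule image_closure_subset) (use \<tau>c \<tau>\<Omega> closure_subset[of \<Omega>] in auto)
  then have \<tau>cl: "\<tau> ` cball 0 1 \<subseteq> closure \<Omega>" by simp
  have "embedding_map (top_of_set (cball 0 1)) (top_of_set (closure \<Omega>)) \<tau>"
    by (rule continuous_imp_embedding_map)
      (use \<tau>c \<tau>i \<tau>cl in \<open>auto simp: Hausdorff_space_subtopology compact_space_subtopology\<close>)
  then show ?thesis using \<tau>\<Omega> ev by blast
qed

theorem proposition4p14:
  fixes \<Omega> :: "complex set"
  assumes "hyperbolic_domain \<Omega>"
  shows "(condition1 \<Omega> \<longrightarrow>
            (\<forall>C \<in> components (frontier \<Omega>). jordan_curve (sphere_closure C))) \<and>
         ((\<forall>C \<in> components (frontier \<Omega>). jordan_curve (sphere_closure C)) \<and>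
            locally connected (frontier \<Omega>) \<longrightarrow> condition1 \<Omega>)"
proof -
  have \<Omega>: "open \<Omega>" "connected \<Omega>" "\<Omega> \<noteq> {}"
    using assms by (auto simp: hyperbolic_domain_def)
  \<comment> \<open>A point of \<Omega> lies on no boundary component and serves as the pole of the
    charts in both directions.\<close>
  then obtain c where c: "c \<in> \<Omega>" by blast
  have c_comp: "c \<notin> C" if "C \<in> components (frontier \<Omega>)" for C
    using in_components_subset[OF that] c \<Omega>(1) by (auto simp: frontier_def interior_open)
  have closed_comp: "closed C" if "C \<in> components (frontier \<Omega>)" for C
    using closed_components[OF _ that] by simp
  show ?thesis
  proof (intro conjI impI ballI)
    fix C assume "condition1 \<Omega>" and C: "C \<in> components (frontier \<Omega>)"
    then show "jordan_curve (sphere_closure C)"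
      using curve_like_boundary_component[OF \<Omega>(1)] c_comp closed_comp
      by (intro jordan_curve_sphere_closure_curve_like in_components_connected in_components_nonempty) auto
  next
    assume hyp: "(\<forall>C\<in>components (frontier \<Omega>). jordan_curve (sphere_closure C))
      \<and> locally connected (frontier \<Omega>)"
    show "condition1 \<Omega>"
      unfolding condition1_def
    proof
      fix p assume "p \<in> frontier \<Omega>"
      then obtain C where C: "C \<in> components (frontier \<Omega>)" "p \<in> C"
        using Union_components[of "frontier \<Omega>"] by blast
      show "\<exists>\<tau> :: complex \<Rightarrow> complex. embedding_map (top_of_set (cball 0 1)) (top_of_set (closure \<Omega>)) \<tau> \<and>
          \<tau> ` ball 0 1 \<subseteq> \<Omega> \<and>
          (\<forall>z. (\<forall>n. z n \<in> \<Omega>) \<and> z \<longlonglongrightarrow> p \<longrightarrow> (\<forall>\<^sub>F n in sequentially. z n \<in> \<tau> ` ball 0 1))"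
        using boundary_point_half_disc[OF \<Omega>(1,2) c closed_comp[OF C(1)] in_components_subset[OF C(1)]
            openin_components_locally_connected[OF _ C(1)] _ C(2)] hyp C(1) by blast
    qed
  qed
qed

end
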